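(* The following is a complete list of pairwise non-isomorphic finite dimensional simple modules for $MU_{\mathbf{v}}(2)$, up to isomorphism: $$ \{L^\pm(n,0)~|~ n\in\mathbb{N} \}\cup\{L^\pm(n,1)~|~ n\in\mathbb{N}\}\cup\{L^\pm(n,01)~|~n\in\mathbb{N}_+\}.$$
   Context: $\mathbb{N}$ is the set of nonnegative integers, $\mathbb{N}_+$ the set of positive integers, $\mathbf{v}$ an indeterminate, $[m]=\frac{\mathbf{v}^m-\mathbf{v}^{-m}}{\mathbf{v}-\mathbf{v}^{-1}}$. Modules are left modules over $\mathbb{C}(\mathbf{v})$-algebras. $MU_{\mathbf{v}}(2)$ is the unital associative $\mathbb{C}(\mathbf{v})$-algebra with generators $e,f,k,k^{-1},\ell$ and relations (i) $kk^{-1}=k^{-1}k=1$; $kek^{-1}=\mathbf{v}^2e$; $kfk^{-1}=\mathbf{v}^{-2}f$; $ef-fe=\frac{k-k^{-1}}{\mathbf{v}-\mathbf{v}^{-1}}$; (ii) $\ell^2=\ell$; $k\ell=\ell k$; $\ell e\ell=\ell e$; $\ell f\ell=f\ell$; $[2]e\ell e=\mathbf{v}^{-1}e^2\ell+\mathbf{v}\ell e^2$; $[2]f\ell f=\mathbf{v}^{-1}\ell f^2+\mathbf{v}f^2\ell$. $U_{\mathbf{v}}(\mathfrak{sl}_2)$ is the unital $\mathbb{C}(\mathbf{v})$-algebra with generators $e,f,k,k^{-1}$ and relations (i). There are surjective algebra maps $\pi_0,\pi_1:MU_{\mathbf{v}}(2)\to U_{\mathbf{v}}(\mathfrak{sl}_2)$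 sending $e,f,k,k^{-1}$ to the generators of the same name, with $\pi_0(\ell)=0$, $\pi_1(\ell)=1$. For $n\in\mathbb{N}$, $L^\pm(n)$ is the simple $(n+1)$-dimensional $U_{\mathbf{v}}(\mathfrak{sl}_2)$-module with highest weight ($k$-eigenvalue) $\pm\mathbf{v}^n$, and $L^\pm(n,0)=\pi_0^*(L^\pm(n))$, $L^\pm(n,1)=\pi_1^*(L^\pm(n))$ are the pullbacks (so $\ell$ acts by $0$, respectively by the identity). For $n\in\mathbb{N}_+$, $L^\pm(n,01)$ is the $MU_{\mathbf{v}}(2)$-module with basis $\{m^\pm_{i,0}: 0\le i\le n-1\}\cup\{m^\pm_{j,1}:1\le j\le n\}$ and action (with $m^\pm_{i,\epsilon}=0$ if the index is out of range) $k m^\pm_{i,\epsilon}=\pm\mathbf{v}^{n-2i}m^\pm_{i,\epsilon}$, $\ell m^\pm_{i,\epsilon}=\epsilon m^\pm_{i,\epsilon}$, $f m^\pm_{i,0}=m^\pm_{i+1,0}+\frac{\mathbf{v}^i}{[i+1]}m^\pm_{i+1,1}$, $f m^\pm_{i,1}=\mathbf{v}^{-1}\frac{[i]}{[i+1]}m^\pm_{i+1,1}$, $e m^\pm_{i,0}=\pm\mathbf{v}[i][n-i]m^\pm_{i-1,0}$, $e m^\pm_{i,1}=\pm[i][n+1-i]m^\pm_{i-1,1}\pm\mathbf{v}^{i-n}[i]m^\pm_{i-1,0}$ (upper signs for $L^+$, lower signs for $L^-$). *)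

theory Defs
  imports
    "HOL-Library.Poly_Mapping"
    "HOL-Algebra.QuotRing"
    "HOL-Algebra.Algebraic_Closure_Type"
    "Jordan_Normal_Form.Missing_VectorSpace"
begin

section \<open>The ground field\<close>

type_synonym ratfun = "complex poly fract"

definition vv :: ratfun where
  "vv = Fract [:0, 1:] 1"

definition qint :: "int \<Rightarrow> ratfun" where
  "qint m = (vv powi m - vv powi (- m)) / (vv - inverse vv)"

abbreviation ground :: "ratfun ring" where
  "ground \<equiv> ring_of_type_algebra"


section \<open>Free algebras and presentations\<close>

text \<open>Words form the free monoid, written additively because \<^typ>\<open>'a \<Rightarrow>\<^sub>0 'b\<close> is the monoid
  algebra of an additive (not necessarily commutative) monoid.\<close>

datatype 'g word = Word (letters: "'g list")

instantiation word :: (type) monoid_add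
begin
definition "0 = Word []"
definition "u + w = Word (letters u @ letters w)"
instance
  by standard (simp_all add: zero_word_def plus_word_def)
end

type_synonym 'g free_alg = "'g word \<Rightarrow>\<^sub>0 ratfun"

definition scal :: "ratfun \<Rightarrow> 'g free_alg" where
  "scal c = Poly_Mapping.single 0 c"

definition gen :: "'g \<Rightarrow> 'g free_alg" where
  "gen g = Poly_Mapping.single (Word [g]) 1"

abbreviation free_ring :: "'g free_alg ring" where
  "free_ring \<equiv> ring_of_type_algebra"

definition relators_ideal :: "'g free_alg set \<Rightarrow> 'g free_alg set" where
  "relators_ideal rels = genideal free_ring rels"

definition presented :: "'g free_alg set \<Rightarrow> 'g free_alg set ring" where
  "presented rels = free_ring Quot relators_ideal rels"

definition cls :: "'g free_alg set \<Rightarrow> 'g free_alg \<Rightarrow> 'g free_alg set" where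
  "cls rels p = a_r_coset free_ring (relators_ideal rels) p"

text \<open>The algebra homomorphism between free algebras with prescribed values on the generators.\<close>

definition subst :: "('g \<Rightarrow> 'h free_alg) \<Rightarrow> 'g free_alg \<Rightarrow> 'h free_alg" where
  "subst \<phi> p = (\<Sum>w\<in>Poly_Mapping.keys p.
     scal (Poly_Mapping.lookup p w) * prod_list (map \<phi> (letters w)))"

text \<open>The map it induces on presented algebras; \<^const>\<open>the_elem\<close> is meaningful whenever
  \<^term>\<open>subst \<phi>\<close> maps the first set of relators into the ideal generated by the second (see \<open>proj_rels\<close> for the case used here).\<close>

definition induced_hom ::
  "'h free_alg set \<Rightarrow> ('g \<Rightarrow> 'h free_alg) \<Rightarrow> 'g free_alg set \<Rightarrow> 'h free_alg set" where
  "induced_hom rels' \<phi> a = the_elem ((\<lambda>p. cls rels' (subst \<phi> p)) ` a)"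


section \<open>Left modules over rings and over presented algebras\<close>

text \<open>The locale \<^locale>\<open>module\<close> of the library requires a commutative ring.\<close>

locale left_module = R?: ring R + M?: abelian_group M
  for R :: "('a, 'r) ring_scheme" (structure) and M :: "('a, 'b, 'c) module_scheme" (structure) +
  assumes lsmult_closed:
      "\<lbrakk>a \<in> carrier R; x \<in> carrier M\<rbrakk> \<Longrightarrow> a \<odot>\<^bsub>M\<^esub> x \<in> carrier M"
    and lsmult_l_distr:
      "\<lbrakk>a \<in> carrier R; b \<in> carrier R; x \<in> carrier M\<rbrakk> \<Longrightarrow>
        (a \<oplus>\<^bsub>R\<^esub> b) \<odot>\<^bsub>M\<^esub> x = a \<odot>\<^bsub>M\<^esub> x \<oplus>\<^bsub>M\<^esub> b \<odot>\<^bsub>M\<^esub> x"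
    and lsmult_r_distr:
      "\<lbrakk>a \<in> carrier R; x \<in> carrier M; y \<in> carrier M\<rbrakk> \<Longrightarrow>
        a \<odot>\<^bsub>M\<^esub> (x \<oplus>\<^bsub>M\<^esub> y) = a \<odot>\<^bsub>M\<^esub> x \<oplus>\<^bsub>M\<^esub> a \<odot>\<^bsub>M\<^esub> y"
    and lsmult_assoc:
      "\<lbrakk>a \<in> carrier R; b \<in> carrier R; x \<in> carrier M\<rbrakk> \<Longrightarrow>
        (a \<otimes>\<^bsub>R\<^esub> b) \<odot>\<^bsub>M\<^esub> x = a \<odot>\<^bsub>M\<^esub> (b \<odot>\<^bsub>M\<^esub> x)"
    and lsmult_one:
      "x \<in> carrier M \<Longrightarrow> \<one>\<^bsub>R\<^esub> \<odot>\<^bsub>M\<^esub> x = x"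

text \<open>The qualified name matters: \<open>submodule\<close> from the vector space library
  presupposes a commutative ring.\<close>

definition simple_module :: "('a, 'r) ring_scheme \<Rightarrow> ('a, 'b, 'm) module_scheme \<Rightarrow> bool" where
  "simple_module R M \<longleftrightarrow> left_module R M \<and> carrier M \<noteq> {\<zero>\<^bsub>M\<^esub>} \<and>
     (\<forall>N. Module.submodule N R M \<longrightarrow> N = {\<zero>\<^bsub>M\<^esub>} \<or> N = carrier M)"

definition module_iso ::
  "('a, 'r) ring_scheme \<Rightarrow> ('a, 'b, 'm) module_scheme \<Rightarrow> ('a, 'c, 'n) module_scheme \<Rightarrow> bool" where
  "module_iso R M N \<longleftrightarrow> (\<exists>h \<in> module_hom R M N. bij_betw h (carrier M) (carrier N))"

definition pullback :: "('a \<Rightarrow> 'a') \<Rightarrow> ('a', 'b, 'm) module_scheme \<Rightarrow> ('a, 'b) module" where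
  "pullback h M = \<lparr>carrier = carrier M, monoid.mult = monoid.mult M, one = one M,
     ring.zero = ring.zero M, add = add M,
     module.smult = (\<lambda>a x. h a \<odot>\<^bsub>M\<^esub> x)\<rparr>"

text \<open>The underlying vector space over the ground field of a module over a presented algebra.\<close>

definition underlying_vs ::
  "'g free_alg set \<Rightarrow> ('g free_alg set, 'b, 'm) module_scheme \<Rightarrow> (ratfun, 'b) module" where
  "underlying_vs rels M = pullback (\<lambda>c. cls rels (scal c)) M"

definition fd_simple :: "'g free_alg set \<Rightarrow> ('g free_alg set, 'b, 'm) module_scheme \<Rightarrow> bool" where
  "fd_simple rels M \<longleftrightarrow> simple_module (presented rels) M \<and>
     vectorspace.fin_dim ground (underlying_vs rels M)"


section \<open>Modules given by a basis and the action of the generators\<close>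

text \<open>The vector space with basis \<open>B\<close> consists of the functions vanishing outside \<open>B\<close>;
  basis vectors with index out of range are zero.\<close>

definition bvec :: "'b set \<Rightarrow> 'b \<Rightarrow> 'b \<Rightarrow> ratfun" where
  "bvec B b = (\<lambda>j. if j = b \<and> b \<in> B then 1 else 0)"

definition vadd :: "('b \<Rightarrow> ratfun) \<Rightarrow> ('b \<Rightarrow> ratfun) \<Rightarrow> 'b \<Rightarrow> ratfun" where
  "vadd x y = (\<lambda>j. x j + y j)"

definition vscale :: "ratfun \<Rightarrow> ('b \<Rightarrow> ratfun) \<Rightarrow> 'b \<Rightarrow> ratfun" where
  "vscale c x = (\<lambda>j. c * x j)"

definition lin_ext :: "'b set \<Rightarrow> ('b \<Rightarrow> 'b \<Rightarrow> ratfun) \<Rightarrow> ('b \<Rightarrow> ratfun) \<Rightarrow> 'b \<Rightarrow> ratfun" where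
  "lin_ext B T x = (\<lambda>j. \<Sum>b\<in>B. x b * T b j)"

definition free_act ::
  "('g \<Rightarrow> ('b \<Rightarrow> ratfun) \<Rightarrow> 'b \<Rightarrow> ratfun) \<Rightarrow> 'g free_alg \<Rightarrow> ('b \<Rightarrow> ratfun) \<Rightarrow> 'b \<Rightarrow> ratfun" where
  "free_act ops p x = (\<lambda>j. \<Sum>w\<in>Poly_Mapping.keys p.
     Poly_Mapping.lookup p w * foldr ops (letters w) x j)"

text \<open>\<open>act g b\<close> is the vector \<open>g \<cdot> m\<^sub>b\<close>. The components \<^const>\<open>monoid.mult\<close> and \<^const>\<open>one\<close> of
  a module record play no role.\<close>

definition rep_module ::
  "'b set \<Rightarrow> ('g \<Rightarrow> 'b \<Rightarrow> 'b \<Rightarrow> ratfun) \<Rightarrow> ('g free_alg set, 'b \<Rightarrow> ratfun) module" where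
  "rep_module B act = \<lparr>carrier = {x. \<forall>b. b \<notin> B \<longrightarrow> x b = 0},
     monoid.mult = undefined, one = undefined, ring.zero = (\<lambda>_. 0), add = vadd,
     module.smult = (\<lambda>a x. the_elem ((\<lambda>p. free_act (\<lambda>g. lin_ext B (act g)) p x) ` a))\<rparr>"


section \<open>The algebras\<close>

datatype sl2_gen = E | F | K | Kinv

datatype mu_gen = Sl2 sl2_gen | Ell

definition sl2_relators :: "(sl2_gen \<Rightarrow> 'g free_alg) \<Rightarrow> 'g free_alg set" where
  "sl2_relators g = (let e = g E; f = g F; k = g K; k' = g Kinv in
    {k * k' - 1,
     k' * k - 1,
     k * e * k' - scal (vv\<^sup>2) * e,
     k * f * k' - scal (inverse vv ^ 2) * f,
     (e * f - f * e) - scal (1 / (vv - inverse vv)) * (k - k')})"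

definition U_rels :: "sl2_gen free_alg set" where
  "U_rels = sl2_relators gen"

definition MU_rels :: "mu_gen free_alg set" where
  "MU_rels = sl2_relators (\<lambda>g. gen (Sl2 g)) \<union>
    (let e = gen (Sl2 E); f = gen (Sl2 F); k = gen (Sl2 K); l = gen Ell in
    {l * l - l,
     k * l - l * k,
     l * e * l - l * e,
     l * f * l - f * l,
     scal (qint 2) * (e * l * e) - (scal (inverse vv) * (e * e * l) + scal vv * (l * e * e)),
     scal (qint 2) * (f * l * f) - (scal (inverse vv) * (l * f * f) + scal vv * (f * f * l))})"

abbreviation U :: "sl2_gen free_alg set ring" where
  "U \<equiv> presented U_rels"

abbreviation MU :: "mu_gen free_alg set ring" where
  "MU \<equiv> presented MU_rels"

text \<open>\<open>\<pi>\<^sub>0\<close> is \<^term>\<open>proj False\<close> and \<open>\<pi>\<^sub>1\<close> is \<^term>\<open>proj True\<close>.\<close>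

fun proj_gen :: "bool \<Rightarrow> mu_gen \<Rightarrow> sl2_gen free_alg" where
  "proj_gen \<epsilon> (Sl2 g) = gen g"
| "proj_gen \<epsilon> Ell = of_bool \<epsilon>"

definition proj :: "bool \<Rightarrow> mu_gen free_alg set \<Rightarrow> sl2_gen free_alg set" where
  "proj \<epsilon> = induced_hom U_rels (proj_gen \<epsilon>)"


section \<open>The modules\<close>

datatype sign = Plus | Minus

fun sval :: "sign \<Rightarrow> ratfun" where
  "sval Plus = 1"
| "sval Minus = - 1"

text \<open>The standard model of the simple module of dimension \<open>n + 1\<close> with highest weight
  \<open>\<plusminus>v\<^sup>n\<close>; see \<open>L_simple\<close>, \<open>L_dim\<close> and \<open>L_highest_weight\<close> below. Truncation of \<open>i - 1\<close> at \<open>i = 0\<close> is harmless here and below: the coefficient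
  \<^term>\<open>qint 0\<close> vanishes.\<close>

fun L_act :: "sign \<Rightarrow> nat \<Rightarrow> sl2_gen \<Rightarrow> nat \<Rightarrow> nat \<Rightarrow> ratfun" where
  "L_act s n E i = vscale (sval s * qint (int i) * qint (int n + 1 - int i)) (bvec {..n} (i - 1))"
| "L_act s n F i = bvec {..n} (i + 1)"
| "L_act s n K i = vscale (sval s * vv powi (int n - 2 * int i)) (bvec {..n} i)"
| "L_act s n Kinv i = vscale (inverse (sval s * vv powi (int n - 2 * int i))) (bvec {..n} i)"

definition L :: "sign \<Rightarrow> nat \<Rightarrow> (sl2_gen free_alg set, nat \<Rightarrow> ratfun) module" where
  "L s n = rep_module {..n} (L_act s n)"

text \<open>\<open>L\<^sup>\<plusminus>(n,0)\<close> and \<open>L\<^sup>\<plusminus>(n,1)\<close>.\<close>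

definition L_eps :: "sign \<Rightarrow> nat \<Rightarrow> bool \<Rightarrow> (mu_gen free_alg set, nat \<Rightarrow> ratfun) module" where
  "L_eps s n \<epsilon> = pullback (proj \<epsilon>) (L s n)"

text \<open>The basis vector \<open>m\<^sub>i\<^sub>,\<^sub>\<epsilon>\<close> of \<open>L\<^sup>\<plusminus>(n,01)\<close> has index \<open>(i, \<epsilon>)\<close>.\<close>

definition B01 :: "nat \<Rightarrow> (nat \<times> bool) set" where
  "B01 n = {0..<n} \<times> {False} \<union> {1..n} \<times> {True}"

fun L01_act :: "sign \<Rightarrow> nat \<Rightarrow> mu_gen \<Rightarrow> nat \<times> bool \<Rightarrow> nat \<times> bool \<Rightarrow> ratfun" where
  "L01_act s n (Sl2 K) (i, \<epsilon>) =
     vscale (sval s * vv powi (int n - 2 * int i)) (bvec (B01 n) (i, \<epsilon>))"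
| "L01_act s n (Sl2 Kinv) (i, \<epsilon>) =
     vscale (inverse (sval s * vv powi (int n - 2 * int i))) (bvec (B01 n) (i, \<epsilon>))"
| "L01_act s n Ell (i, \<epsilon>) = vscale (of_bool \<epsilon>) (bvec (B01 n) (i, \<epsilon>))"
| "L01_act s n (Sl2 F) (i, False) =
     vadd (bvec (B01 n) (i + 1, False))
       (vscale (vv powi (int i) / qint (int i + 1)) (bvec (B01 n) (i + 1, True)))"
| "L01_act s n (Sl2 F) (i, True) =
     vscale (inverse vv * (qint (int i) / qint (int i + 1))) (bvec (B01 n) (i + 1, True))"
| "L01_act s n (Sl2 E) (i, False) =
     vscale (sval s * vv * qint (int i) * qint (int n - int i)) (bvec (B01 n) (i - 1, False))"
| "L01_act s n (Sl2 E) (i, True) =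
     vadd (vscale (sval s * qint (int i) * qint (int n + 1 - int i)) (bvec (B01 n) (i - 1, True)))
       (vscale (sval s * vv powi (int i - int n) * qint (int i)) (bvec (B01 n) (i - 1, False)))"

definition L01 :: "sign \<Rightarrow> nat \<Rightarrow> (mu_gen free_alg set, nat \<times> bool \<Rightarrow> ratfun) module" where
  "L01 s n = rep_module (B01 n) (L01_act s n)"

section \<open>The presented algebras, the maps \<open>\<pi>\<^sub>0\<close>, \<open>\<pi>\<^sub>1\<close> and \<open>L\<^sup>\<plusminus>(n)\<close> behave as intended\<close>

lemma vv_power: "vv ^ m = Fract (monom 1 m) 1"
  by (induction m) (auto simp: vv_def One_fract_def monom_Suc monom_0 one_pCons)

lemma vv_nz: "vv \<noteq> 0"
  by (simp add: vv_def Zero_fract_def eq_fract)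

lemma vv_power_eq_1: "vv ^ m = 1 \<Longrightarrow> m = 0"
  by (simp add: vv_power One_fract_def eq_fract monom_eq_1_iff)

lemma vv_powi_eq_1: "vv powi m = 1 \<Longrightarrow> m = 0"
  using vv_power_eq_1[of "nat m"] vv_power_eq_1[of "nat (- m)"]
  by (auto simp: power_int_def power_inverse split: if_splits)

lemma vv_diff_nz: "vv - inverse vv \<noteq> 0"
  using vv_nz vv_power_eq_1[of 2] by (auto simp: field_simps power2_eq_square)

lemma qint_nz: "m \<noteq> 0 \<Longrightarrow> qint m \<noteq> 0"
proof
  assume "m \<noteq> 0" "qint m = 0"
  then have "vv powi m = vv powi (- m)" using vv_diff_nz by (simp add: qint_def)
  then have "vv powi m * vv powi m = 1" using vv_nz by (simp add: power_int_minus field_simps)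
  then have "vv powi (m + m) = 1" using vv_nz power_int_add[of vv m m] by simp
  with vv_powi_eq_1[of "m + m"] \<open>m \<noteq> 0\<close> show False by simp
qed

lemma qint_0 [simp]: "qint 0 = 0"
  by (simp add: qint_def)

lemma free_ring_simps [simp]:
  "carrier (free_ring :: 'g free_alg ring) = UNIV"
  "monoid.mult (free_ring :: 'g free_alg ring) = (*)"
  "one (free_ring :: 'g free_alg ring) = 1"
  "ring.zero (free_ring :: 'g free_alg ring) = 0"
  "add (free_ring :: 'g free_alg ring) = (+)"
  by (simp_all add: ring_of_type_algebra_def fun_eq_iff)

lemma ground_simps [simp]:
  "carrier ground = UNIV" "monoid.mult ground = (*)" "one ground = 1" "ring.zero ground = 0"
  "add ground = (+)"
  by (simp_all add: ring_of_type_algebra_def fun_eq_iff)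

lemma ring_free_ring: "ring (free_ring :: 'g free_alg ring)"
proof -
  have "\<exists>y. x + y = 0 \<and> y + x = 0" for x :: "'g free_alg"
    by (rule exI[of _ "- x"]) simp
  then show ?thesis
    by unfold_locales (auto simp: algebra_simps Units_def)
qed

lemma free_ring_inv: "inv\<^bsub>add_monoid free_ring\<^esub> p = - (p :: 'g free_alg)"
proof -
  interpret ring "free_ring :: 'g free_alg ring" by (rule ring_free_ring)
  have "\<ominus>\<^bsub>free_ring\<^esub> p = - p" by (rule minus_equality) auto
  then show ?thesis by (simp add: a_inv_def)
qed

lemma ideal_free_ringI:
  fixes J :: "'g free_alg set"
  assumes "0 \<in> J" "\<And>p q. p \<in> J \<Longrightarrow> q \<in> J \<Longrightarrow> p + q \<in> J"
    and "\<And>p. p \<in> J \<Longrightarrow> - p \<in> J"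
    and "\<And>p q. q \<in> J \<Longrightarrow> p * q \<in> J" "\<And>p q. q \<in> J \<Longrightarrow> q * p \<in> J"
  shows "ideal J free_ring"
proof (rule idealI[OF ring_free_ring])
  show "subgroup J (add_monoid free_ring)"
  proof (rule subgroup.intro)
    show "inv\<^bsub>add_monoid free_ring\<^esub> x \<in> J" if "x \<in> J" for x
      unfolding free_ring_inv by (rule assms(3)[OF that])
  qed (use assms in auto)
qed (use assms in auto)

lemma ideal_relators: "ideal (relators_ideal rels) free_ring"
proof -
  interpret ring "free_ring :: 'g free_alg ring" for type_g :: "'g itself" by (rule ring_free_ring)
  show ?thesis unfolding relators_ideal_def by (rule genideal_ideal) auto
qed

lemma relators_idealD:
  "0 \<in> relators_ideal rels"
  "p \<in> relators_ideal rels \<Longrightarrow> q \<in> relators_ideal rels \<Longrightarrow> p + q \<in> relators_ideal rels"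
  "p \<in> relators_ideal rels \<Longrightarrow> - p \<in> relators_ideal rels"
  "q \<in> relators_ideal rels \<Longrightarrow> r * q \<in> relators_ideal rels"
  "q \<in> relators_ideal rels \<Longrightarrow> q * r \<in> relators_ideal rels"
proof -
  interpret ideal "relators_ideal rels" free_ring by (rule ideal_relators)
  show "0 \<in> relators_ideal rels"
    using additive_subgroup.zero_closed[OF additive_subgroup_axioms] by simp
  show "p \<in> relators_ideal rels \<Longrightarrow> q \<in> relators_ideal rels \<Longrightarrow> p + q \<in> relators_ideal rels"
    using additive_subgroup.a_closed[OF additive_subgroup_axioms, of p q] by simp
  show "p \<in> relators_ideal rels \<Longrightarrow> - p \<in> relators_ideal rels"
    using subgroup.m_inv_closed[OF a_subgroup, of p] unfolding free_ring_inv .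
  show "q \<in> relators_ideal rels \<Longrightarrow> r * q \<in> relators_ideal rels" using I_l_closed[of q r] by simp
  show "q \<in> relators_ideal rels \<Longrightarrow> q * r \<in> relators_ideal rels" using I_r_closed[of q r] by simp
qed

lemma relators_subset: "rels \<subseteq> relators_ideal rels"
  by (auto simp: relators_ideal_def genideal_def)

lemma relators_minimal: "ideal J free_ring \<Longrightarrow> rels \<subseteq> J \<Longrightarrow> relators_ideal rels \<subseteq> J"
  by (auto simp: relators_ideal_def genideal_def)

lemma cls_eq: "cls rels p = {r + p | r. r \<in> relators_ideal rels}"
  by (auto simp: cls_def a_r_coset_def r_coset_def)

lemma cls_self: "p \<in> cls rels p"
  using relators_idealD(1)[of rels] by (force simp: cls_eq)

lemma cls_cong: "p - q \<in> relators_ideal rels \<Longrightarrow> cls rels p = cls rels q"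
proof -
  have *: "cls rels p \<subseteq> cls rels q" if "p - q \<in> relators_ideal rels" for p q
    using relators_idealD(2)[OF _ that] by (force simp: cls_eq algebra_simps)
  assume "p - q \<in> relators_ideal rels"
  moreover from relators_idealD(3)[OF this] have "q - p \<in> relators_ideal rels" by simp
  ultimately show ?thesis using * by blast
qed

lemma presented_ring: "ring (presented rels)"
  unfolding presented_def by (rule ideal.quotient_is_ring[OF ideal_relators])

lemma presented_simps:
  "carrier (presented rels) = range (cls rels)"
  "monoid.mult (presented rels) (cls rels p) (cls rels q) = cls rels (p * q)"
  "one (presented rels) = cls rels 1"
  "add (presented rels) (cls rels p) (cls rels q) = cls rels (p + q)"
proof -
  interpret ideal "relators_ideal rels" free_ring by (rule ideal_relators)
  show "carrier (presented rels) = range (cls rels)"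
    by (auto simp: presented_def FactRing_def A_RCOSETS_def' cls_def)
  show "monoid.mult (presented rels) (cls rels p) (cls rels q) = cls rels (p * q)"
    using rcoset_mult_add[of p q] by (simp add: presented_def FactRing_def cls_def)
  show "one (presented rels) = cls rels 1"
    by (simp add: presented_def FactRing_def cls_def)
  show "add (presented rels) (cls rels p) (cls rels q) = cls rels (p + q)"
    using a_rcos_sum[of p q] by (simp add: presented_def FactRing_def cls_def)
qed

lemma free_alg_induct:
  fixes p :: "'g free_alg"
  assumes "P 0" "\<And>w c. P (Poly_Mapping.single w c)" "\<And>p q. P p \<Longrightarrow> P q \<Longrightarrow> P (p + q)"
  shows "P p"
proof (induction p rule: update_induct)
  case const
  show ?case by fact
next
  case (update f a b)
  have "Poly_Mapping.update a b f = f + Poly_Mapping.single a b"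
    using update(1) by (intro poly_mapping_eqI)
      (auto simp: lookup_update lookup_add lookup_single when_def in_keys_iff)
  then show ?case using assms update by simp
qed

subsection \<open>The substitution homomorphism\<close>

lemma sum_keys_superset:
  assumes "finite A" "Poly_Mapping.keys p \<subseteq> A" "\<And>w. f w 0 = 0"
  shows "(\<Sum>w\<in>Poly_Mapping.keys p. f w (Poly_Mapping.lookup p w)) =
    (\<Sum>w\<in>A. f w (Poly_Mapping.lookup p w) :: 'z :: comm_monoid_add)"
  using assms by (intro sum.mono_neutral_left) (auto simp: in_keys_iff)

lemma sum_keys_add:
  assumes "\<And>w. f w 0 = 0" "\<And>w c d. f w (c + d) = f w c + f w d"
  shows "(\<Sum>w\<in>Poly_Mapping.keys (p + q). f w (Poly_Mapping.lookup (p + q) w)) =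
    (\<Sum>w\<in>Poly_Mapping.keys p. f w (Poly_Mapping.lookup p w)) +
    (\<Sum>w\<in>Poly_Mapping.keys q. f w (Poly_Mapping.lookup q w) :: 'z :: comm_monoid_add)"
proof -
  let ?A = "Poly_Mapping.keys p \<union> Poly_Mapping.keys q"
  have "Poly_Mapping.keys (p + q) \<subseteq> ?A" by (rule Poly_Mapping.keys_add)
  then show ?thesis
    using assms by (subst (1 2 3) sum_keys_superset[of ?A]) (auto simp: lookup_add sum.distrib)
qed

lemma scal_simps:
  "scal 0 = 0" "scal 1 = 1" "scal (c + d) = scal c + scal d" "scal c * scal d = scal (c * d)"
  by (auto simp: scal_def single_add mult_single)

lemma scal_commute: "scal c * p = p * scal c"
  by (induction p rule: free_alg_induct)
    (auto simp: scal_def mult_single algebra_simps)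

lemma subst_add: "subst \<phi> (p + q) = subst \<phi> p + subst \<phi> q"
  unfolding subst_def
  by (rule sum_keys_add[where f = "\<lambda>w c. scal c * prod_list (map \<phi> (letters w))"])
    (auto simp: scal_simps algebra_simps)

lemma subst_single: "subst \<phi> (Poly_Mapping.single w c) = scal c * prod_list (map \<phi> (letters w))"
  by (cases "c = 0") (auto simp: subst_def scal_simps)

lemma subst_0 [simp]: "subst \<phi> 0 = 0"
  by (simp add: subst_def)

lemma subst_mult: "subst \<phi> (p * q) = subst \<phi> p * subst \<phi> q"
proof (induction p rule: free_alg_induct)
  case (2 w c)
  show ?case
  proof (induction q rule: free_alg_induct)
    case (2 u d)
    let ?w = "prod_list (map \<phi> (letters w))" and ?u = "prod_list (map \<phi> (letters u))"
    have "subst \<phi> (Poly_Mapping.single w c * Poly_Mapping.single u d) = scal c * (scal d * ?w) * ?u"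
      by (simp add: mult_single subst_single plus_word_def scal_simps(4)[symmetric] mult.assoc)
    also have "\<dots> = (scal c * ?w) * (scal d * ?u)"
      by (simp add: scal_commute[of d ?w] mult.assoc)
    finally show ?case by (simp add: subst_single)
  qed (auto simp: subst_add algebra_simps)
qed (auto simp: subst_add algebra_simps)

lemma subst_scal [simp]: "subst \<phi> (scal c) = scal c"
  unfolding scal_def[of c] subst_single by (simp add: scal_def zero_word_def)

lemma subst_gen [simp]: "subst \<phi> (gen g) = \<phi> g"
  by (simp add: gen_def subst_single scal_simps)

lemma subst_uminus: "subst \<phi> (- p) = - subst \<phi> p"
  using subst_add[of \<phi> p "- p"] by (simp add: eq_neg_iff_add_eq_0 add.commute)

lemma subst_diff: "subst \<phi> (p - q) = subst \<phi> p - subst \<phi> q"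
  using subst_add[of \<phi> p "- q"] by (simp add: subst_uminus)

lemma subst_1 [simp]: "subst \<phi> 1 = 1"
  using subst_scal[of \<phi> 1] by (simp add: scal_simps)

lemma induced_hom_cls:
  assumes "subst \<phi> ` rels \<subseteq> relators_ideal rels'"
  shows "induced_hom rels' \<phi> (cls rels p) = cls rels' (subst \<phi> p)"
proof -
  have "relators_ideal rels \<subseteq> {p. subst \<phi> p \<in> relators_ideal rels'}"
    using assms by (intro relators_minimal ideal_free_ringI)
      (auto simp: subst_add subst_mult subst_uminus intro: relators_idealD)
  then have "(\<lambda>p. cls rels' (subst \<phi> p)) ` cls rels p = {cls rels' (subst \<phi> p)}"
    using relators_idealD(1)[of rels]
    by (auto simp: cls_eq[of rels] subst_add intro!: cls_cong image_eqI[of _ _ p] exI[of _ "0::'a free_alg"])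
       
  then show ?thesis by (simp add: induced_hom_def)
qed

lemma proj_rels: "subst (proj_gen \<epsilon>) ` MU_rels \<subseteq> relators_ideal U_rels"
proof -
  have q2: "qint 2 = inverse vv + vv"
    using vv_nz vv_diff_nz by (simp add: qint_def field_simps power2_eq_square power_int_minus)
  have *: "sl2_relators gen \<subseteq> relators_ideal U_rels"
    using relators_subset[of U_rels] by (simp add: U_rels_def)
  have 1: "subst (proj_gen \<epsilon>) ` sl2_relators (\<lambda>g. gen (Sl2 g)) = sl2_relators gen"
    by (simp add: sl2_relators_def Let_def subst_diff subst_add subst_mult)
  have 2: "subst (proj_gen \<epsilon>) ` (MU_rels - sl2_relators (\<lambda>g. gen (Sl2 g))) \<subseteq> {0}"
    unfolding MU_rels_def
    by (cases \<epsilon>) (auto simp: Let_def subst_diff subst_add subst_mult q2 scal_simps algebra_simps)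
  show ?thesis
  proof (rule image_subsetI)
    fix r assume r: "r \<in> MU_rels"
    show "subst (proj_gen \<epsilon>) r \<in> relators_ideal U_rels"
    proof (cases "r \<in> sl2_relators (\<lambda>g. gen (Sl2 g))")
      case True
      then have "subst (proj_gen \<epsilon>) r \<in> sl2_relators gen" using 1 by blast
      then show ?thesis using * by blast
    next
      case False
      then have "subst (proj_gen \<epsilon>) r \<in> {0}" using 2 r by blast
      then show ?thesis using relators_idealD(1)[of U_rels] by simp
    qed
  qed
qed

lemma proj_cls: "proj \<epsilon> (cls MU_rels p) = cls U_rels (subst (proj_gen \<epsilon>) p)"
  unfolding proj_def by (rule induced_hom_cls[OF proj_rels])

lemma proj_generators:
  "proj \<epsilon> (cls MU_rels (scal c)) = cls U_rels (scal c)"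
  "proj \<epsilon> (cls MU_rels (gen (Sl2 g))) = cls U_rels (gen g)"
  "proj \<epsilon> (cls MU_rels (gen Ell)) = (if \<epsilon> then \<one>\<^bsub>U\<^esub> else cls U_rels 0)"
  by (auto simp: proj_cls presented_simps)

lemma proj_ring_hom: "proj \<epsilon> \<in> ring_hom MU U"
  by (rule ring_hom_memI) (auto simp: presented_simps proj_cls subst_mult subst_add)

lemma proj_surj: "proj \<epsilon> ` carrier MU = carrier U"
proof -
  have "subst (proj_gen \<epsilon>) (subst (\<lambda>g. gen (Sl2 g)) p) = p" for p
  proof (induction p rule: free_alg_induct)
    case (2 w c)
    have "Poly_Mapping.single (Word l) 1 = prod_list (map gen l)" for l :: "sl2_gen list"
    proof (induction l)
      case Nil
      show ?case by (simp add: zero_word_def flip: single_one)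
    next
      case (Cons a l)
      have "Poly_Mapping.single (Word (a # l)) 1 = gen a * Poly_Mapping.single (Word l) 1"
        by (simp add: gen_def mult_single plus_word_def)
      then show ?case using Cons by simp
    qed
    from this[of "letters w"]
    have w: "Poly_Mapping.single w 1 = prod_list (map gen (letters w))" by simp
    have "Poly_Mapping.single w c = scal c * Poly_Mapping.single w 1"
      by (simp add: scal_def mult_single)
    then have "Poly_Mapping.single w c = scal c * prod_list (map gen (letters w))"
      by (simp add: w)
    moreover have "subst (proj_gen \<epsilon>) (subst (\<lambda>g. gen (Sl2 g)) (prod_list (map gen l))) =
      prod_list (map gen l)" for l
      by (induction l) (auto simp: subst_mult)
    ultimately show ?case by (simp add: subst_single subst_mult)
  qed (auto simp: subst_add)
  then have "cls U_rels p \<in> proj \<epsilon> ` range (cls MU_rels)" for p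
    by (metis proj_cls rangeI imageI)
  then show ?thesis by (auto simp: presented_simps proj_cls)
qed


subsection \<open>Modules with a given basis\<close>

abbreviation car :: "'b set \<Rightarrow> ('b \<Rightarrow> ratfun) set" where
  "car B \<equiv> {x. \<forall>b. b \<notin> B \<longrightarrow> x b = 0}"

lemma lin_ext_linear:
  "lin_ext B T (vadd x y) = vadd (lin_ext B T x) (lin_ext B T y)"
  "lin_ext B T (vscale c x) = vscale c (lin_ext B T x)"
  by (auto simp: lin_ext_def vadd_def vscale_def algebra_simps sum.distrib sum_distrib_left)

locale gen_ops =
  fixes ops :: "'g \<Rightarrow> ('b \<Rightarrow> ratfun) \<Rightarrow> 'b \<Rightarrow> ratfun"
  assumes ops_add: "ops g (vadd x y) = vadd (ops g x) (ops g y)"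
    and ops_scale: "ops g (vscale c x) = vscale c (ops g x)"
begin

lemma word_linear:
  "foldr ops l (vadd x y) = vadd (foldr ops l x) (foldr ops l y)"
  "foldr ops l (vscale c x) = vscale c (foldr ops l x)"
  by (induction l) (auto simp: ops_add ops_scale)

lemma free_act_add: "free_act ops (p + q) x = vadd (free_act ops p x) (free_act ops q x)"
  unfolding free_act_def vadd_def
  by (rule ext, rule sum_keys_add) (auto simp: algebra_simps)

lemma free_act_single: "free_act ops (Poly_Mapping.single w c) x = vscale c (foldr ops (letters w) x)"
  by (cases "c = 0") (auto simp: free_act_def vscale_def)

lemma free_act_0: "free_act ops 0 x = (\<lambda>_. 0)"
  by (simp add: free_act_def)

lemma free_act_linear:
  "free_act ops p (vadd x y) = vadd (free_act ops p x) (free_act ops p y)"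
  "free_act ops p (vscale c x) = vscale c (free_act ops p x)"
  by (auto simp: free_act_def word_linear) 
    (auto simp: vadd_def vscale_def algebra_simps sum.distrib sum_distrib_left)

lemma free_act_mult: "free_act ops (p * q) x = free_act ops p (free_act ops q x)"
proof (induction p rule: free_alg_induct)
  case 1
  show ?case by (simp add: free_act_0)
next
  case (2 w c)
  show ?case
  proof (induction q rule: free_alg_induct)
    case 1
    have "foldr ops l (\<lambda>_. 0) = (\<lambda>_. 0)" for l
      using word_linear(2)[of l 0 "\<lambda>_. 0"] by (simp add: vscale_def)
    then show ?case by (simp add: free_act_0 free_act_single vscale_def)
  next
    case (2 u d)
    show ?case
      by (simp add: mult_single free_act_single plus_word_def word_linear)
        (simp add: vscale_def mult.assoc)
  next
    case (3 p q)
    then show ?case by (simp add: distrib_left free_act_add free_act_linear)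
  qed
next
  case (3 p q)
  then show ?case by (simp add: distrib_right free_act_add)
qed

lemma free_act_gen: "free_act ops (gen g) x = ops g x"
  by (simp add: gen_def free_act_single vscale_def)

lemma free_act_scal: "free_act ops (scal c) x = vscale c x"
  by (simp add: scal_def free_act_single zero_word_def)

lemma free_act_1: "free_act ops 1 x = x"
  using free_act_scal[of 1 x] by (simp add: scal_simps vscale_def)

lemma free_act_diff: "free_act ops (p - q) x = (\<lambda>j. free_act ops p x j - free_act ops q x j)"
  using free_act_add[of "p - q" q x] by (auto simp: vadd_def fun_eq_iff algebra_simps)

lemmas free_act_simps = free_act_add free_act_mult free_act_gen free_act_scal free_act_1 free_act_diff

end

lemma gen_ops_lin_ext: "gen_ops (\<lambda>g. lin_ext B (act g))"
  by unfold_locales (rule lin_ext_linear)+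

lemma car_closed:
  "(\<lambda>_. 0) \<in> car B"
  "x \<in> car B \<Longrightarrow> y \<in> car B \<Longrightarrow> vadd x y \<in> car B"
  "x \<in> car B \<Longrightarrow> vscale c x \<in> car B"
  "bvec B b \<in> car B"
  by (auto simp: vadd_def vscale_def bvec_def)

lemma rep_module_simps [simp]:
  "carrier (rep_module B act) = car B"
  "ring.zero (rep_module B act) = (\<lambda>_. 0)"
  "add (rep_module B act) = vadd"
  by (simp_all add: rep_module_def)

lemma abelian_group_rep_module: "abelian_group (rep_module B act)"
proof (rule abelian_groupI)
  fix x assume "x \<in> carrier (rep_module B act)"
  then show "\<exists>y\<in>carrier (rep_module B act). y \<oplus>\<^bsub>rep_module B act\<^esub> x = \<zero>\<^bsub>rep_module B act\<^esub>"
    by (intro bexI[of _ "\<lambda>j. - x j"]) (auto simp: vadd_def)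
qed (auto simp: vadd_def fun_eq_iff algebra_simps)

locale gen_rep =
  fixes B :: "'b set" and act :: "'g \<Rightarrow> 'b \<Rightarrow> 'b \<Rightarrow> ratfun" and rels :: "'g free_alg set"
  assumes fin: "finite B"
    and act_car: "b \<in> B \<Longrightarrow> act g b \<in> car B"
    and act_rels: "r \<in> rels \<Longrightarrow> x \<in> car B \<Longrightarrow>
      free_act (\<lambda>g. lin_ext B (act g)) r x = (\<lambda>_. 0)"
begin

abbreviation "ops \<equiv> \<lambda>g. lin_ext B (act g)"

sublocale gen_ops ops by (rule gen_ops_lin_ext)

lemma free_act_car: "x \<in> car B \<Longrightarrow> free_act ops p x \<in> car B"
proof -
  assume x: "x \<in> car B"
  have "foldr ops l x \<in> car B" for l
    using x act_car by (induction l) (auto simp: lin_ext_def intro!: sum.neutral)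
  then show ?thesis by (auto simp: free_act_def)
qed

lemma relators_act:
  assumes "p \<in> relators_ideal rels" "x \<in> car B"
  shows "free_act ops p x = (\<lambda>_. 0)"
proof -
  have z: "free_act ops q (\<lambda>_. 0) = (\<lambda>_. 0)" for q
    using free_act_linear(2)[of q 0 "\<lambda>_. 0"] by (simp add: vscale_def)
  have "relators_ideal rels \<subseteq> {p. \<forall>x\<in>car B. free_act ops p x = (\<lambda>_. 0)}"
  proof (intro relators_minimal ideal_free_ringI)
    show "rels \<subseteq> {p. \<forall>x\<in>car B. free_act ops p x = (\<lambda>_. 0)}" using act_rels by blast
    show "- p \<in> {p. \<forall>x\<in>car B. free_act ops p x = (\<lambda>_. 0)}"
      if "p \<in> {p. \<forall>x\<in>car B. free_act ops p x = (\<lambda>_. 0)}" for p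
      using that free_act_diff[of 0 p] by (simp add: free_act_0)
    show "q * p \<in> {p. \<forall>x\<in>car B. free_act ops p x = (\<lambda>_. 0)}"
      if "q \<in> {p. \<forall>x\<in>car B. free_act ops p x = (\<lambda>_. 0)}" for p q
      using that free_act_car[of _ p] by (simp add: free_act_mult)
  qed (auto simp: free_act_0 free_act_add vadd_def free_act_mult z)
  with assms show ?thesis by blast
qed

lemma rep_smult:
  assumes "x \<in> car B"
  shows "cls rels p \<odot>\<^bsub>rep_module B act\<^esub> x = free_act ops p x"
proof -
  have "free_act ops q x = free_act ops p x" if "q \<in> cls rels p" for q
    using that relators_act[OF _ assms] by (auto simp: cls_eq free_act_add vadd_def)
  then have "(\<lambda>q. free_act ops q x) ` cls rels p = {free_act ops p x}"
    using cls_self[of p rels] by blast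
  then show ?thesis by (simp add: rep_module_def)
qed

lemma left_module_rep: "left_module (presented rels) (rep_module B act)"
proof -
  interpret R: ring "presented rels" by (rule presented_ring)
  interpret M: abelian_group "rep_module B act" by (rule abelian_group_rep_module)
  note simps = presented_simps(2,3,4) rep_smult rep_module_simps free_act_add free_act_linear
    free_act_mult free_act_1 free_act_car car_closed
  show ?thesis
  proof (unfold_locales, goal_cases)
    case (1 a x)
    then obtain p where "a = cls rels p" by (auto simp: presented_simps(1))
    with 1 show ?case by (simp only: simps)
  next
    case (2 a b x)
    then obtain p q where "a = cls rels p" "b = cls rels q" by (auto simp: presented_simps(1))
    with 2 show ?case by (simp only: simps)
  next
    case (3 a x y)
    then obtain p where "a = cls rels p" by (auto simp: presented_simps(1))
    with 3 show ?case by (simp only: simps)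
  next
    case (4 a b x)
    then obtain p q where "a = cls rels p" "b = cls rels q" by (auto simp: presented_simps(1))
    with 4 show ?case by (simp only: simps)
  next
    case (5 x)
    then show ?case by (simp only: simps)
  qed
qed

lemma vs_simps:
  "carrier (underlying_vs rels (rep_module B act)) = car B"
  "ring.zero (underlying_vs rels (rep_module B act)) = (\<lambda>_. 0)"
  "add (underlying_vs rels (rep_module B act)) = vadd"
  "x \<in> car B \<Longrightarrow> c \<odot>\<^bsub>underlying_vs rels (rep_module B act)\<^esub> x = vscale c x"
  by (simp_all add: underlying_vs_def pullback_def rep_smult free_act_scal)

lemma vectorspace_rep: "vectorspace ground (underlying_vs rels (rep_module B act))"
proof -
  let ?V = "underlying_vs rels (rep_module B act)"
  have "field ground" by (rule field_from_type_algebra)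
  moreover have "module ground ?V"
  proof (rule moduleI)
    show "cring ground" by (rule cring_from_type_algebra)
    show "abelian_group ?V"
    proof (rule abelian_groupI)
      fix x assume "x \<in> carrier ?V"
      then show "\<exists>y\<in>carrier ?V. y \<oplus>\<^bsub>?V\<^esub> x = \<zero>\<^bsub>?V\<^esub>"
        by (intro bexI[of _ "\<lambda>j. - x j"]) (auto simp: vs_simps vadd_def)
    qed (auto simp: vs_simps vadd_def fun_eq_iff algebra_simps)
  qed (auto simp del: mem_Collect_eq simp: vs_simps car_closed,
       auto simp: vadd_def vscale_def algebra_simps)
  ultimately show ?thesis by (simp add: vectorspace_def)
qed

lemma finsum_rep:
  assumes "finite A" "f \<in> A \<rightarrow> car B"
  shows "finsum (underlying_vs rels (rep_module B act)) f A = (\<lambda>j. \<Sum>a\<in>A. f a j)"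
proof -
  interpret V: vectorspace ground "underlying_vs rels (rep_module B act)" by (rule vectorspace_rep)
  show ?thesis using assms
  proof (induction A rule: finite_induct)
    case empty
    then show ?case by (simp add: vs_simps)
  next
    case (insert a A)
    then have "finsum (underlying_vs rels (rep_module B act)) f (insert a A) =
      vadd (f a) (finsum (underlying_vs rels (rep_module B act)) f A)"
      by (subst V.finsum_insert) (auto simp: vs_simps)
    then show ?case using insert by (simp add: vadd_def Pi_iff)
  qed
qed

lemma basis_rep: "vectorspace.basis ground (underlying_vs rels (rep_module B act)) (bvec B ` B)"
proof -
  interpret V: vectorspace ground "underlying_vs rels (rep_module B act)" by (rule vectorspace_rep)
  have inj: "inj_on (bvec B) B"
    by (rule inj_onI) (metis bvec_def zero_neq_one)
  have sub: "bvec B ` B \<subseteq> carrier (underlying_vs rels (rep_module B act))"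
    using car_closed(4)[of B] by (auto simp: vs_simps)
  have lc: "V.lincomb a (bvec B ` S) = (\<lambda>j. if j \<in> S then a (bvec B j) else 0)" if "S \<subseteq> B" for a S
  proof -
    have f: "finite S" using that fin finite_subset by blast
    have "V.lincomb a (bvec B ` S) =
      (\<lambda>j. \<Sum>v\<in>bvec B ` S. (a v \<odot>\<^bsub>underlying_vs rels (rep_module B act)\<^esub> v) j)"
      unfolding V.lincomb_def
    proof (rule finsum_rep)
      have "vscale c (bvec B b) \<in> car B" for c b by (intro car_closed)
      then show "(\<lambda>v. a v \<odot>\<^bsub>underlying_vs rels (rep_module B act)\<^esub> v) \<in> bvec B ` S \<rightarrow> car B"
        by (simp add: Pi_iff vs_simps(4)[OF car_closed(4)] del: mem_Collect_eq)
    qed (use f in simp)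
    also have "\<dots> = (\<lambda>j. \<Sum>b\<in>S. a (bvec B b) * bvec B b j)"
      using inj_on_subset[OF inj that]
      by (auto simp: sum.reindex vs_simps(4)[OF car_closed(4)] vscale_def)
    also have "\<dots> = (\<lambda>j. \<Sum>b\<in>S. if j = b then a (bvec B b) else 0)"
      using that by (intro ext sum.cong) (auto simp: bvec_def)
    finally show ?thesis using f by (simp add: sum.delta)
  qed
  have "V.lin_indpt (bvec B ` B)"
  proof
    assume "V.lin_dep (bvec B ` B)"
    then obtain A a v where A: "A \<subseteq> bvec B ` B" "V.lincomb a A = (\<lambda>_. 0)" "v \<in> A" "a v \<noteq> 0"
      unfolding V.lin_dep_def vs_simps ground_simps by blast
    then obtain S where S: "S \<subseteq> B" "A = bvec B ` S" by (meson subset_imageE)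
    with A obtain b where "b \<in> S" "v = bvec B b" by blast
    with A S lc[of S a] show False by (auto dest!: fun_cong[of _ _ b])
  qed
  moreover have "V.gen_set (bvec B ` B)"
  proof -
    have "x \<in> V.span (bvec B ` B)" if "x \<in> car B" for x
    proof -
      define a where "a v = x (the_inv_into B (bvec B) v)" for v
      have "V.lincomb a (bvec B ` B) = x"
        using that lc[of B a] by (auto simp: a_def the_inv_into_f_f[OF inj] fun_eq_iff)
      then show ?thesis
        unfolding V.span_def using fin by force
    qed
    then show ?thesis using V.span_is_subset2[OF sub] by (auto simp: vs_simps)
  qed
  ultimately show ?thesis using sub by (simp add: V.basis_def)
qed

lemma fin_dim_rep: "vectorspace.fin_dim ground (underlying_vs rels (rep_module B act))"
proof -
  interpret V: vectorspace ground "underlying_vs rels (rep_module B act)" by (rule vectorspace_rep)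
  have "V.basis (bvec B ` B)" by (rule basis_rep)
  then have "bvec B ` B \<subseteq> carrier (underlying_vs rels (rep_module B act))" "V.gen_set (bvec B ` B)"
    by (auto simp only: V.basis_def)
  then show ?thesis unfolding V.fin_dim_def
    by (intro exI[of _ "bvec B ` B"] conjI finite_imageI fin)
qed

lemma dim_rep: "vectorspace.dim ground (underlying_vs rels (rep_module B act)) = card B"
proof -
  interpret V: vectorspace ground "underlying_vs rels (rep_module B act)" by (rule vectorspace_rep)
  have "inj_on (bvec B) B"
    by (rule inj_onI) (metis bvec_def zero_neq_one)
  then have "card (bvec B ` B) = card B" by (rule card_image)
  with V.dim_basis[OF finite_imageI[OF fin] basis_rep] show ?thesis by (rule trans)
qed

end

subsection \<open>The modules \<open>L\<^sup>\<plusminus>(n)\<close>\<close>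

lemma sval_nz [simp]: "sval s \<noteq> 0" and sval_inverse [simp]: "inverse (sval s) = sval s"
  by (cases s; simp)+

lemma qint_identity: "qint (j + 1) * qint (n - j) - qint j * qint (n + 1 - j) = qint (n - 2 * j)"
proof -
  define a b d where "a = vv powi j" and "b = vv powi n" and "d = vv - inverse vv"
  have nz: "a \<noteq> 0" "b \<noteq> 0" "d \<noteq> 0" "vv \<noteq> 0"
    using vv_nz vv_diff_nz by (auto simp: a_def b_def d_def)
  have v2: "vv powi (n - 2 * j) = b / (a * a)" "vv powi (2 * j - n) = a * a / b"
    using vv_nz power_int_add[of vv j j] by (simp_all add: a_def b_def power_int_diff)
  have q: "qint (j + 1) = (a * vv - 1 / (a * vv)) / d" "qint (n - j) = (b / a - a / b) / d"
    "qint j = (a - 1 / a) / d" "qint (n + 1 - j) = (b * vv / a - a / (b * vv)) / d"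
    "qint (n - 2 * j) = (b / (a * a) - a * a / b) / d"
    using vv_nz v2 by (auto simp: qint_def a_def b_def d_def power_int_diff power_int_add power_int_minus
      field_simps)
  have "((a * vv - 1 / (a * vv)) * (b / a - a / b) - (a - 1 / a) * (b * vv / a - a / (b * vv))) =
    (b / (a * a) - a * a / b) * d"
    using nz by (simp add: d_def field_simps)
  then have "((a * vv - 1 / (a * vv)) * (b / a - a / b) - (a - 1 / a) * (b * vv / a - a / (b * vv))) / (d * d) =
    (b / (a * a) - a * a / b) / d"
    using nz by simp
  then show ?thesis by (simp only: q times_divide_times_eq diff_divide_distrib[symmetric])
qed

lemma L_ops:
  "lin_ext {..n} (L_act s n E) x = (\<lambda>j. if j < n then
     sval s * qint (int j + 1) * qint (int n - int j) * x (Suc j) else 0)"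
  "lin_ext {..n} (L_act s n F) x = (\<lambda>j. if 0 < j \<and> j \<le> n then x (j - 1) else 0)"
  "lin_ext {..n} (L_act s n K) x =
     (\<lambda>j. if j \<le> n then sval s * vv powi (int n - 2 * int j) * x j else 0)"
  "lin_ext {..n} (L_act s n Kinv) x =
     (\<lambda>j. if j \<le> n then inverse (sval s * vv powi (int n - 2 * int j)) * x j else 0)"
proof -
  have "(\<Sum>b\<le>n. x b * L_act s n E b j) = (\<Sum>b\<le>n. if b = Suc j then
    sval s * qint (int j + 1) * qint (int n - int j) * x b else 0)" for j
  proof (rule sum.cong)
    fix b show "x b * L_act s n E b j = (if b = Suc j then
      sval s * qint (int j + 1) * qint (int n - int j) * x b else 0)" if "b \<in> {..n}"
      using that by (cases b) (auto simp: vscale_def bvec_def algebra_simps)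
  qed simp
  then show "lin_ext {..n} (L_act s n E) x = (\<lambda>j. if j < n then
     sval s * qint (int j + 1) * qint (int n - int j) * x (Suc j) else 0)"
    by (auto simp: lin_ext_def fun_eq_iff Suc_le_eq)
  have "(\<Sum>b\<le>n. x b * L_act s n F b j) = (\<Sum>b\<le>n. if b = j - 1 then
    (if 0 < j \<and> j \<le> n then x b else 0) else 0)" for j
    by (rule sum.cong) (auto simp: bvec_def)
  then show "lin_ext {..n} (L_act s n F) x = (\<lambda>j. if 0 < j \<and> j \<le> n then x (j - 1) else 0)"
    by (auto simp: lin_ext_def fun_eq_iff)
  have "(\<Sum>b\<le>n. x b * L_act s n K b j) = (\<Sum>b\<le>n. if b = j then
    sval s * vv powi (int n - 2 * int j) * x j else 0)" for j
    by (rule sum.cong) (auto simp: vscale_def bvec_def)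
  then show "lin_ext {..n} (L_act s n K) x =
     (\<lambda>j. if j \<le> n then sval s * vv powi (int n - 2 * int j) * x j else 0)"
    by (auto simp: lin_ext_def fun_eq_iff)
  have "(\<Sum>b\<le>n. x b * L_act s n Kinv b j) = (\<Sum>b\<le>n. if b = j then
    inverse (sval s * vv powi (int n - 2 * int j)) * x j else 0)" for j
    by (rule sum.cong) (auto simp: vscale_def bvec_def)
  then show "lin_ext {..n} (L_act s n Kinv) x =
     (\<lambda>j. if j \<le> n then inverse (sval s * vv powi (int n - 2 * int j)) * x j else 0)"
    by (auto simp: lin_ext_def fun_eq_iff)
qed

lemma L_rep: "gen_rep {..n} (L_act s n) U_rels"
proof
  show "L_act s n g b \<in> car {..n}" for g b
    by (cases g) (auto simp: vscale_def bvec_def)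
  fix r :: "sl2_gen free_alg" and x :: "nat \<Rightarrow> ratfun"
  assume r: "r \<in> U_rels" and x: "x \<in> car {..n}"
  let ?ops = "\<lambda>g. lin_ext {..n} (L_act s n g)"
  interpret gen_ops ?ops by (rule gen_ops_lin_ext)
  note ops = free_act_simps L_ops vscale_def
  have x0: "x j = 0" if "n < j" for j using x that by auto
  have w: "vv powi (int n - 2 * int j) = vv\<^sup>2 * vv powi (int n - 2 * int (Suc j))" for j
    using vv_nz power_int_add[of vv 2 "int n - 2 * int (Suc j)"] by (simp add: algebra_simps)
  have wnz: "vv powi k \<noteq> 0" for k using vv_nz by simp
  have key: "sval s * W * (c * (inverse (sval s * a) * y)) = t * (c * y)"
    if "W = t * a" "a \<noteq> 0" for W a c y t
    using that by (simp add: field_simps del: sval_inverse)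
  have inv: "sval s * vv powi k * (inverse (sval s * vv powi k) * y) = y"
    "inverse (sval s * vv powi k) * (sval s * vv powi k * y) = y" for k y
    using wnz[of k] by (simp_all add: field_simps del: sval_inverse)
  have "free_act ?ops r x j = 0" for j
  proof -
    from r consider "r = gen K * gen Kinv - 1" | "r = gen Kinv * gen K - 1"
      | "r = gen K * gen E * gen Kinv - scal (vv\<^sup>2) * gen E"
      | "r = gen K * gen F * gen Kinv - scal (inverse vv ^ 2) * gen F"
      | "r = (gen E * gen F - gen F * gen E) - scal (1 / (vv - inverse vv)) * (gen K - gen Kinv)"
      unfolding U_rels_def sl2_relators_def Let_def by blast
    then show ?thesis
    proof cases
      case 1
      show ?thesis unfolding 1 ops
        by (cases "j \<le> n") (simp_all only: if_True inv diff_self, simp add: x0)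
    next
      case 2
      show ?thesis unfolding 2 ops
        by (cases "j \<le> n") (simp_all only: if_True inv diff_self, simp add: x0)
    next
      case 3
      show ?thesis
      proof (cases "j < n")
        case True
        then have "j \<le> n" "Suc j \<le> n" by auto
        with True show ?thesis unfolding 3 ops
          by (simp only: if_True key[OF w wnz] diff_self)
      qed (simp add: 3 ops)
    next
      case 4
      show ?thesis
      proof (cases "0 < j \<and> j \<le> n")
        case True
        then obtain i where i: "j = Suc i" by (cases j) auto
        have "vv powi (int n - 2 * int j) = inverse vv ^ 2 * vv powi (int n - 2 * int i)"
          using w[of i] vv_nz unfolding i by (simp add: power_inverse)
        note k = key[OF this wnz, of 1 "x i"]
        from True have "j - 1 = i" "j \<le> n" "i \<le> n" by (auto simp: i)
        with True show ?thesis unfolding 4 ops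
          by (simp only: if_True k[unfolded mult_1_left] diff_self simp_thms)
      qed (auto simp: 4 ops)
    next
      case 5
      let ?W = "vv powi (int n - 2 * int j)"
      show ?thesis
      proof (cases "j \<le> n")
        case False
        then show ?thesis by (simp add: 5 ops x0)
      next
        case True
        have EF: "?ops E (?ops F x) j = sval s * qint (int j + 1) * qint (int n - int j) * x j"
          using True by (cases "j = n") (auto simp: L_ops)
        have FE: "?ops F (?ops E x) j = sval s * qint (int j) * qint (int n + 1 - int j) * x j"
          using True by (cases j) (auto simp: L_ops algebra_simps)
        have KK: "?ops K x j = sval s * ?W * x j" "?ops Kinv x j = sval s * inverse ?W * x j"
          using True by (auto simp: L_ops)
        have q: "qint (int n - 2 * int j) = (?W - inverse ?W) / (vv - inverse vv)"
          unfolding qint_def by (simp only: power_int_minus)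
        have "free_act ?ops r x j = sval s * x j * ((qint (int j + 1) * qint (int n - int j) -
          qint (int j) * qint (int n + 1 - int j)) - (?W - inverse ?W) / (vv - inverse vv))"
          unfolding 5 free_act_simps vscale_def EF FE KK
          by (simp add: ring_distribs diff_divide_distrib mult_ac)
        then show ?thesis unfolding qint_identity q by simp
      qed
    qed
  qed
  then show "free_act ?ops r x = (\<lambda>_. 0)" by (simp add: fun_eq_iff)
qed simp

theorem L_simple: "simple_module U (L s n)"
proof -
  interpret gen_rep "{..n}" "L_act s n" U_rels by (rule L_rep)
  have "N = {\<zero>\<^bsub>L s n\<^esub>} \<or> N = carrier (L s n)" if N: "Module.submodule N U (L s n)" for N
  proof -
    interpret N: Module.submodule N U "L s n" by (rule N)
    have sub: "N \<subseteq> car {..n}" using N.subset by (simp add: L_def)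
    have z: "(\<lambda>_. 0) \<in> N" using N.one_closed by (simp add: L_def)
    have add: "vadd x y \<in> N" if "x \<in> N" "y \<in> N" for x y
      using N.m_closed[OF that] by (simp add: L_def)
    have act: "free_act ops p x \<in> N" if "x \<in> N" for p x
    proof -
      have "cls U_rels p \<odot>\<^bsub>L s n\<^esub> x \<in> N"
        using that by (intro N.smult_closed) (auto simp: presented_simps)
      then show ?thesis using that sub by (simp add: L_def rep_smult subset_iff)
    qed
    have scale: "vscale c x \<in> N" if "x \<in> N" for c x
      using act[OF that, of "scal c"] by (simp add: free_act_scal)
    have op: "ops g x \<in> N" if "x \<in> N" for g x
      using act[OF that, of "gen g"] by (simp add: free_act_gen)
    have low: "bvec {..n} 0 \<in> N" if "x \<in> N" "x m \<noteq> 0" "\<forall>j>m. x j = 0" "m \<le> n" for x m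
      using that
    proof (induction m arbitrary: x)
      case 0
      have "vscale (1 / x 0) x = bvec {..n} 0"
        using 0 by (auto simp: vscale_def bvec_def)
      with scale[OF 0(1)] show ?case by metis
    next
      case (Suc m)
      have "ops E x m \<noteq> 0"
        using Suc.prems qint_nz[of "int m + 1"] qint_nz[of "int n - int m"] by (simp add: L_ops)
      moreover have "\<forall>j>m. ops E x j = 0" using Suc.prems by (simp add: L_ops)
      ultimately show ?case using Suc.IH[OF op[OF Suc.prems(1)]] Suc.prems(4) by simp
    qed
    show ?thesis
    proof (cases "N = {\<lambda>_. 0}")
      case False
      then obtain x where x: "x \<in> N" "x \<noteq> (\<lambda>_. 0)" using z by blast
      define S where "S = {j. x j \<noteq> 0}"
      have "S \<subseteq> {..n}" using x(1) sub by (auto simp: S_def)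
      moreover from this have S: "finite S" by (rule finite_subset) simp
      moreover have ne: "S \<noteq> {}" using x(2) by (auto simp: S_def)
      ultimately have "Max S \<le> n" "x (Max S) \<noteq> 0"
        using Max_in[OF S ne] by (auto simp: S_def)
      moreover have "\<forall>j>Max S. x j = 0"
      proof (intro allI impI)
        fix j assume "Max S < j"
        then have "j \<notin> S" using Max_ge[OF S, of j] by linarith
        then show "x j = 0" by (simp add: S_def)
      qed
      ultimately      have b0: "bvec {..n} 0 \<in> N" using low x(1) by blast
      have b: "bvec {..n} j \<in> N" for j
      proof (induction j)
        case (Suc j)
        have "bvec {..n} (Suc j) = (if Suc j \<le> n then ops F (bvec {..n} j) else (\<lambda>_. 0))"
          by (auto simp: L_ops bvec_def fun_eq_iff)
        then show ?case using op[OF Suc] z by metis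
      qed (rule b0)
      have "y \<in> N" if y: "y \<in> car {..n}" for y
      proof -
        have "(\<lambda>j. if j < m then y j else 0) \<in> N" for m
        proof (induction m)
          case (Suc m)
          have "(\<lambda>j. if j < Suc m then y j else 0) =
            vadd (\<lambda>j. if j < m then y j else 0) (vscale (y m) (bvec {..n} m))"
            using y by (auto simp: vadd_def vscale_def bvec_def fun_eq_iff less_Suc_eq)
          then show ?case by (simp only: add[OF Suc scale[OF b]])
        qed (use z in simp)
        from this[of "Suc n"] have "(\<lambda>j. if j < Suc n then y j else 0) \<in> N" .
        moreover have "(\<lambda>j. if j < Suc n then y j else 0) = y" using y by (auto simp: fun_eq_iff)
        ultimately show ?thesis by simp
      qed
      then show ?thesis using sub by (auto simp: L_def)
    qed (simp add: L_def)
  qed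
  moreover have "bvec {..n} 0 \<in> carrier (L s n)" "bvec {..n} 0 \<noteq> \<zero>\<^bsub>L s n\<^esub>"
    by (auto simp: L_def bvec_def fun_eq_iff)
  ultimately show ?thesis
    using left_module_rep unfolding simple_module_def by (auto simp: L_def)
qed

theorem L_dim:
  "vectorspace ground (underlying_vs U_rels (L s n))"
  "vectorspace.fin_dim ground (underlying_vs U_rels (L s n))"
  "vectorspace.dim ground (underlying_vs U_rels (L s n)) = n + 1"
proof -
  interpret gen_rep "{..n}" "L_act s n" U_rels by (rule L_rep)
  show "vectorspace ground (underlying_vs U_rels (L s n))"
    "vectorspace.fin_dim ground (underlying_vs U_rels (L s n))"
    "vectorspace.dim ground (underlying_vs U_rels (L s n)) = n + 1"
    using vectorspace_rep fin_dim_rep dim_rep by (simp_all add: L_def)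
qed

theorem L_highest_weight:
  "\<exists>x\<in>carrier (L s n). x \<noteq> \<zero>\<^bsub>L s n\<^esub> \<and>
     cls U_rels (gen E) \<odot>\<^bsub>L s n\<^esub> x = \<zero>\<^bsub>L s n\<^esub> \<and>
     cls U_rels (gen K) \<odot>\<^bsub>L s n\<^esub> x = cls U_rels (scal (sval s * vv ^ n)) \<odot>\<^bsub>L s n\<^esub> x"
proof -
  interpret gen_rep "{..n}" "L_act s n" U_rels by (rule L_rep)
  have c: "bvec {..n} 0 \<in> car {..n}" by (rule car_closed)
  have "ops E (bvec {..n} 0) = (\<lambda>_. 0)"
    "ops K (bvec {..n} 0) = vscale (sval s * vv ^ n) (bvec {..n} 0)"
    by (auto simp: L_ops vscale_def bvec_def fun_eq_iff)
  moreover have "bvec {..n} 0 \<noteq> (\<lambda>_. 0)" by (auto simp: bvec_def fun_eq_iff)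
  ultimately show ?thesis
    using rep_smult[OF c, of "gen E"] rep_smult[OF c, of "gen K"]
      rep_smult[OF c, of "scal (sval s * vv ^ n)"] c
    unfolding L_def free_act_gen free_act_scal by (intro bexI[of _ "bvec {..n} 0"] conjI) simp_all
qed

end

theory Submission
  imports Defs "HOL-Library.Function_Algebras"
begin

text \<open>Let \<open>V\<close> be a finite-dimensional simple module.  The idempotent \<open>l\<close> splits \<open>V\<close> into
\<open>V\<^sub>0 = ker l\<close> and \<open>V\<^sub>1 = im l\<close>; the relations say that \<open>V\<^sub>0\<close> is stable under \<open>e\<close> and \<open>V\<^sub>1\<close> under
\<open>f\<close>, and both under \<open>k\<close>.

The ground field is not algebraically closed, so eigenvectors have to be found by hand.  First, \<open>e\<close> and
\<open>f\<close> are nilpotent (\<open>q_commuting_nilpotent\<close>).  Then every nonzero space of vectors killed by \<open>e\<close> and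
stable under \<open>k\<close> contains an eigenvector of \<open>k\<close> with eigenvalue \<open>\<plusminus>v\<^sup>n\<close> (\<open>exists_primitive\<close>).

If \<open>V\<^sub>0 = 0\<close>, a highest weight vector generates \<open>L\<^sup>\<plusminus>(n,1)\<close>.  Otherwise take a highest weight vector
\<open>x\<close> in \<open>V\<^sub>0\<close>.  The relation for \<open>f l f\<close> expresses \<open>f l f\<^sup>i x\<close> through \<open>l f\<^sup>i\<^sup>+\<^sup>1 x\<close>, so everything is
determined by how \<open>e\<close> acts on the vectors \<open>l f\<^sup>i x\<close>, and this in turn by \<open>T x = e l f x\<close>.  The relation
for \<open>e l e\<close> makes \<open>T x\<close> again a highest weight vector in \<open>V\<^sub>0\<close> of the same weight.  The string of \<open>x\<close>
ends after \<open>n + 1\<close> steps, and from this follows \<open>T (T x) = \<plusminus>v\<^sup>1\<^sup>-\<^sup>n T x\<close> (\<open>T_T\<close>).  So either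
\<open>T x = 0\<close>, in which case the vectors \<open>l f\<^sup>i x\<close> span a proper submodule, vanish, and \<open>x\<close> generates
\<open>L\<^sup>\<plusminus>(n,0)\<close>; or \<open>x\<close> may be replaced by \<open>T x\<close>, and the vectors \<open>(1 - l) f\<^sup>i x\<close>, \<open>l f\<^sup>i x\<close> satisfy the
formulas that define \<open>L\<^sup>\<plusminus>(n,01)\<close> (\<open>generating_vector\<close>, \<open>P_F_l_action\<close>).  In each case this gives a nonzero
homomorphism from a model to \<open>V\<close>, which is bijective by Schur's lemma.

Conversely, the models are modules (\<open>L01_rep\<close>) and simple, and they are told apart by the weight of a highest
weight vector that is an eigenvector of \<open>l\<close>, and by whether \<open>l\<close> acts as a scalar.

All calculations take place in the locale \<open>MU_action\<close>, for operators on a type with addition.  A module on an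
arbitrary carrier is brought into this form by coordinates with respect to a basis (\<open>fin_dim_iso_rep\<close>).\<close>

section \<open>Operators that commute up to a scalar\<close>

text \<open>A linear operator \<open>g\<close> makes its space a module over the polynomial ring; \<open>poly_act p\<close> below is
the operator \<open>p(g)\<close>.\<close>

locale linear_operator = vector_space scale
  for scale :: "'k :: field \<Rightarrow> 'b :: ab_group_add \<Rightarrow> 'b" (infixr \<open>*s\<close> 75) +
  fixes g :: "'b \<Rightarrow> 'b"
  assumes add: "g (x + y) = g x + g y" and scale: "g (c *s x) = c *s g x"
begin

lemma zero: "g 0 = 0"
  using scale[of 0 0] by simp

lemma diff: "g (x - y) = g x - g y"
  using add[of "x - y" y] by simp

lemma sum: "g (sum h A) = (\<Sum>a\<in>A. g (h a))"
  by (induction A rule: infinite_finite_induct) (auto simp: add zero)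

lemma pow: "linear_operator scale (g ^^ n)"
proof
  show "(g ^^ n) (x + y) = (g ^^ n) x + (g ^^ n) y" for x y by (induction n) (auto simp: add)
  show "(g ^^ n) (c *s x) = c *s (g ^^ n) x" for c x by (induction n) (auto simp: scale)
qed

definition poly_act :: "'k poly \<Rightarrow> 'b \<Rightarrow> 'b" where
  "poly_act p x = (\<Sum>i\<le>degree p. coeff p i *s (g ^^ i) x)"

lemma poly_act_upto: "degree p \<le> n \<Longrightarrow> poly_act p x = (\<Sum>i\<le>n. coeff p i *s (g ^^ i) x)"
  unfolding poly_act_def by (rule sum.mono_neutral_left) (auto simp: coeff_eq_0)

lemma poly_act_add: "poly_act (p + r) x = poly_act p x + poly_act r x"
proof -
  let ?n = "max (degree p) (degree r)"
  have "degree (p + r) \<le> ?n" by (rule degree_add_le_max)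
  then show ?thesis
    by (simp add: poly_act_upto[of _ ?n] sum.distrib scale_left_distrib)
qed

lemma poly_act_smult: "poly_act (smult c p) x = c *s poly_act p x"
  by (simp add: poly_act_upto[of _ "degree p"] poly_act_def scale_sum_right degree_smult_le)

lemma poly_act_diff: "poly_act (p - r) x = poly_act p x - poly_act r x"
  using poly_act_add[of "p - r" r x] by simp

lemma poly_act_monom: "poly_act (monom c i) x = c *s (g ^^ i) x"
proof -
  have "poly_act (monom c i) x = (\<Sum>j\<le>i. if j = i then c *s (g ^^ i) x else 0)"
    unfolding poly_act_upto[OF degree_monom_le] by (intro sum.cong) auto
  then show ?thesis by simp
qed

lemma poly_act_sum: "poly_act (Groups_Big.sum p A) x = (\<Sum>a\<in>A. poly_act (p a) x)"
  by (induction A rule: infinite_finite_induct) (auto simp: poly_act_add, simp_all add: poly_act_def)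

lemma poly_act_linear: "linear_operator scale (poly_act p)"
proof
  show "poly_act p (x + y) = poly_act p x + poly_act p y" for x y
    by (simp add: poly_act_def linear_operator.add[OF pow] scale_right_distrib sum.distrib)
  show "poly_act p (c *s x) = c *s poly_act p x" for c x
    by (simp add: poly_act_def linear_operator.scale[OF pow] scale_sum_right mult_ac)
qed

lemma poly_act_pCons: "poly_act (pCons a p) x = a *s x + g (poly_act p x)"
proof -
  have "degree (pCons a p) \<le> Suc (degree p)" by (rule degree_pCons_le)
  then have "poly_act (pCons a p) x = (\<Sum>i\<le>Suc (degree p). coeff (pCons a p) i *s (g ^^ i) x)"
    by (rule poly_act_upto)
  also have "\<dots> = a *s x + (\<Sum>i\<le>degree p. coeff p i *s g ((g ^^ i) x))"
    by (subst sum.atMost_Suc_shift) simp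
  finally show ?thesis by (simp add: poly_act_def sum scale)
qed

lemma poly_act_0: "poly_act 0 x = 0"
  by (simp add: poly_act_def)

lemma poly_act_mult: "poly_act (p * r) x = poly_act p (poly_act r x)"
  by (induction p) (simp_all add: poly_act_0 poly_act_pCons poly_act_add poly_act_smult)

text \<open>The powers of \<open>g\<close> applied to \<open>x\<close> are more vectors than a finite spanning set has elements, so a
linear relation between them exists; its coefficients are a polynomial.\<close>

lemma annihilating_poly_vector:
  assumes "finite S" and S: "\<And>i. (g ^^ i) x \<in> span S"
  shows "\<exists>p. p \<noteq> 0 \<and> poly_act p x = 0"
proof (cases "inj_on (\<lambda>i. (g ^^ i) x) {..card S}")
  case False
  then obtain i j where "i \<noteq> j" "(g ^^ i) x = (g ^^ j) x" by (auto simp: inj_on_def)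
  then show ?thesis
    by (intro exI[of _ "monom 1 i - monom 1 j"]) (simp add: poly_act_diff poly_act_monom monom_eq_iff')
next
  case True
  let ?P = "(\<lambda>i. (g ^^ i) x) ` {..card S}"
  have "card ?P = Suc (card S)" using card_image[OF True] by simp
  then have "dependent ?P" using independent_span_bound[OF assms(1), of ?P] S by force
  then obtain u i where u: "(\<Sum>v\<in>?P. u v *s v) = 0" and i: "i \<le> card S" "u ((g ^^ i) x) \<noteq> 0"
    by (subst (asm) dependent_finite) auto
  define p where "p = (\<Sum>i\<le>card S. monom (u ((g ^^ i) x)) i)"
  have "coeff p i = (\<Sum>j\<le>card S. if j = i then u ((g ^^ i) x) else 0)"
    unfolding p_def coeff_sum by (intro sum.cong) auto
  also have "\<dots> \<noteq> 0" using i by simp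
  finally have "p \<noteq> 0" by auto
  moreover have "poly_act p x = 0"
    using u by (simp add: p_def poly_act_sum poly_act_monom sum.reindex[OF True])
  ultimately show ?thesis by blast
qed

text \<open>The product of annihilating polynomials of the spanning vectors annihilates everything, because
polynomials in one operator commute.\<close>

lemma annihilating_poly:
  assumes "finite S" and S: "\<And>x. x \<in> span S \<Longrightarrow> g x \<in> span S"
  shows "\<exists>p. p \<noteq> 0 \<and> (\<forall>x\<in>span S. poly_act p x = 0)"
proof -
  have pow_closed: "(g ^^ i) x \<in> span S" if "x \<in> span S" for i x
    by (induction i) (simp_all add: that S)
  have "\<exists>p. p \<noteq> 0 \<and> (\<forall>x\<in>T. poly_act p x = 0)" if "finite T" "T \<subseteq> S" for T
    using that
  proof (induction T rule: finite_induct)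
    case empty
    show ?case by (intro exI[of _ 1]) simp
  next
    case (insert a T)
    then obtain p where p: "p \<noteq> 0" "\<forall>x\<in>T. poly_act p x = 0" by auto
    have "a \<in> span S" using insert.prems by (intro span_base) simp
    from annihilating_poly_vector[OF assms(1) pow_closed[OF this]]
    obtain r where r: "r \<noteq> 0" "poly_act r a = 0" by blast
    have "poly_act (r * p) a = poly_act (p * r) a" by (simp only: mult.commute)
    then have "\<forall>x\<in>insert a T. poly_act (r * p) x = 0"
      using p r by (auto simp: poly_act_mult linear_operator.zero[OF poly_act_linear])
    then show ?case using p r by (intro exI[of _ "r * p"]) auto
  qed
  from this[OF assms(1) order.refl]
  obtain p where p: "p \<noteq> 0" "\<And>x. x \<in> S \<Longrightarrow> poly_act p x = 0" by auto
  have "poly_act p x = 0" if "x \<in> span S" for x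
    using that
  proof (induction rule: span_induct)
    case base
    interpret P: linear_operator scale "poly_act p" by (rule poly_act_linear)
    show ?case by (rule subspaceI) (auto simp: P.add P.scale P.zero)
  qed (rule p)
  with p(1) show ?thesis by blast
qed

end

text \<open>The reason why \<open>e\<close> and \<open>f\<close> are nilpotent on every finite-dimensional module, over a field that
need not contain the eigenvalues of \<open>k\<close>.  Consider the polynomials \<open>p\<close> for which some
\<open>g\<^sup>s p(k)\<close> vanishes.  Together with \<open>p(X)\<close> they contain \<open>p(q X)\<close>, since \<open>p(k) g = g p(q k)\<close>.
For a nonzero one of minimal degree \<open>d\<close> the difference \<open>p(q X) - q\<^sup>d p(X)\<close> has smaller degree, hence
is zero, and its constant term shows \<open>d = 0\<close> or \<open>p(0) = 0\<close>.  In the second case \<open>X\<close> could be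
cancelled because \<open>k\<close> is injective; so \<open>p\<close> is constant and \<open>g\<^sup>s = 0\<close>.\<close>

lemma (in vector_space) q_commuting_nilpotent:
  assumes k: "linear_operator scale k" and g: "linear_operator scale g"
    and S: "finite S"
    and closed: "\<And>x. x \<in> span S \<Longrightarrow> k x \<in> span S" "\<And>x. x \<in> span S \<Longrightarrow> g x \<in> span S"
    and inj: "\<And>x. x \<in> span S \<Longrightarrow> k x = 0 \<Longrightarrow> x = 0"
    and comm: "\<And>x. x \<in> span S \<Longrightarrow> k (g x) = q *s g (k x)"
    and q: "q \<noteq> 0" "\<And>m. q ^ m = 1 \<Longrightarrow> m = 0"
  shows "\<exists>s. \<forall>x\<in>span S. (g ^^ s) x = 0"
proof -
  interpret k: linear_operator scale k by (rule k)
  interpret g: linear_operator scale g by (rule g)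
  interpret gp: linear_operator scale "g ^^ s" for s by (rule g.pow)
  have kp: "(k ^^ i) x \<in> span S" if "x \<in> span S" for i x
    using that closed by (induction i) auto
  have gps: "(g ^^ i) x \<in> span S" if "x \<in> span S" for i x
    using that closed by (induction i) auto
  have pc: "k.poly_act p x \<in> span S" if "x \<in> span S" for p x
    unfolding k.poly_act_def by (intro span_sum span_scale kp that)
  define I where "I p \<longleftrightarrow> (\<exists>s. \<forall>x\<in>span S. (g ^^ s) (k.poly_act p x) = 0)" for p
  from k.annihilating_poly[OF S closed(1)] obtain p0
    where "p0 \<noteq> 0" "\<forall>x\<in>span S. k.poly_act p0 x = 0" by blast
  then have "p0 \<noteq> 0 \<and> I p0" by (auto simp: I_def gp.zero)
  then obtain p where p: "p \<noteq> 0" "I p" and min: "\<And>r. r \<noteq> 0 \<Longrightarrow> I r \<Longrightarrow> degree p \<le> degree r"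
    using ex_has_least_nat[of "\<lambda>r. r \<noteq> 0 \<and> I r" p0 degree] by blast
  obtain s where s: "(g ^^ s) (k.poly_act p x) = 0" if "x \<in> span S" for x
    using p(2) by (auto simp: I_def)
  define r where "r = pcompose p [:0, q:]"
  have shift: "k.poly_act t (g x) = g (k.poly_act (pcompose t [:0, q:]) x)" if "x \<in> span S" for t x
    using that
  proof (induction t)
    case 0
    then show ?case by (simp add: k.poly_act_0 g.zero)
  next
    case (pCons a t)
    have "k.poly_act (pcompose (pCons a t) [:0, q:]) x =
      a *s x + q *s k (k.poly_act (pcompose t [:0, q:]) x)"
      by (simp add: pcompose_pCons k.poly_act_add k.poly_act_smult k.poly_act_pCons k.poly_act_0 k.zero k.scale)
    then show ?case using pCons
      by (simp add: k.poly_act_pCons g.add g.scale comm pc)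
  qed
  have gs: "(g ^^ Suc s) y = (g ^^ s) (g y)" for y by (simp add: funpow_swap1)
  define d where "d = degree p"
  define t where "t = r - smult (q ^ d) p"
  have ct: "coeff t i = (q ^ i - q ^ d) * coeff p i" for i
    by (simp add: t_def r_def coeff_pcompose_linear algebra_simps)
  have "I t"
    unfolding I_def
  proof (intro exI[of _ "Suc s"] ballI)
    fix x assume x: "x \<in> span S"
    have "(g ^^ Suc s) (k.poly_act r x) = (g ^^ s) (k.poly_act p (g x))"
      using x by (simp only: gs r_def shift)
    also have "\<dots> = 0" using s closed(2)[OF x] by blast
    finally have 1: "(g ^^ Suc s) (k.poly_act r x) = 0" .
    have "(g ^^ Suc s) (k.poly_act p x) = 0" using s[OF x] by (simp add: g.zero)
    with 1 show "(g ^^ Suc s) (k.poly_act t x) = 0"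
      unfolding t_def by (simp only: k.poly_act_diff k.poly_act_smult gp.diff gp.scale) simp
  qed
  have "t = 0"
  proof (rule ccontr)
    assume "t \<noteq> 0"
    then have "d \<le> degree t" "coeff t (degree t) \<noteq> 0" using min[OF _ \<open>I t\<close>] by (auto simp: d_def)
    then show False using ct[of "degree t"] coeff_eq_0[of p "degree t"] by (cases "degree t = d") (auto simp: d_def)
  qed
  then have "(1 - q ^ d) * coeff p 0 = 0" using ct[of 0] by simp
  then consider "d = 0" | "coeff p 0 = 0" using q(2)[of d] by auto
  then show ?thesis
  proof cases
    case 1
    then obtain c where c: "p = [:c:]" unfolding d_def by (metis degree_0_id)
    have "(g ^^ s) x = 0" if "x \<in> span S" for x
      using s[OF that] p(1) by (simp add: c k.poly_act_pCons k.poly_act_0 k.zero gp.scale)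
    then show ?thesis by blast
  next
    case 2
    then obtain p1 where p1: "p = pCons 0 p1" by (cases p) auto
    with p(1) have "p1 \<noteq> 0" by auto
    have kgp: "k ((g ^^ i) x) = q ^ i *s (g ^^ i) (k x)" if "x \<in> span S" for i x
    proof (induction i)
      case (Suc i)
      have "k ((g ^^ Suc i) x) = q *s g (k ((g ^^ i) x))" by (simp add: comm gps that)
      also have "\<dots> = q ^ Suc i *s (g ^^ Suc i) (k x)" by (simp add: Suc.IH g.scale)
      finally show ?case .
    qed simp
    have "(g ^^ s) (k.poly_act p1 x) = 0" if x: "x \<in> span S" for x
    proof -
      have "k ((g ^^ s) (k.poly_act p1 x)) = 0"
        using s[OF x] by (simp add: kgp[OF pc[OF x]] p1 k.poly_act_pCons)
      then show ?thesis by (rule inj[OF gps[OF pc[OF x]]])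
    qed
    then have "I p1" unfolding I_def by (intro exI[of _ s] ballI)
    from min[OF \<open>p1 \<noteq> 0\<close> this] have False using \<open>p1 \<noteq> 0\<close> by (simp add: p1)
    then show ?thesis ..
  qed
qed

section \<open>Highest weight vectors\<close>

lemma qint_Suc: "qint (m + 1) = vv * qint m + vv powi (- m)"
  and qint_Suc': "qint (m + 1) = inverse vv * qint m + vv powi m"
proof -
  define a where "a = vv powi m"
  have nz: "a \<noteq> 0" "vv \<noteq> 0" "vv * vv - 1 \<noteq> 0"
    using vv_nz vv_diff_nz by (auto simp: a_def field_simps)
  have p: "vv powi (m + 1) = a * vv" "vv powi (- (m + 1)) = 1 / (a * vv)"
    "vv powi (- m) = 1 / a" "vv powi m = a"
    using vv_nz by (simp_all add: a_def power_int_add power_int_minus power_int_diff field_simps)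
  show "qint (m + 1) = vv * qint m + vv powi (- m)"
    and "qint (m + 1) = inverse vv * qint m + vv powi m"
    using nz vv_diff_nz unfolding qint_def p by (simp_all add: field_simps)
qed

lemma qint_1: "qint 1 = 1"
  using qint_Suc[of 0] by simp

lemma qint_2: "qint 2 = vv + inverse vv"
  using qint_Suc[of 1] by (simp add: qint_1 power_int_minus)


lemma vv_pow_eq_1_nat: "(vv ^ 2) ^ m = 1 \<Longrightarrow> m = 0" "(inverse vv ^ 2) ^ m = 1 \<Longrightarrow> m = 0"
  using vv_power_eq_1[of "2 * m"] by (simp_all add: power_mult[symmetric] power_inverse)

text \<open>The relations of \<open>MU\<^sub>v(2)\<close> for concrete operators on a finite-dimensional space.  They are required
only on the span of \<open>S\<close>, because the operators that arise from a module with basis \<open>B\<close> are defined on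
all functions but satisfy \<open>k k' = 1\<close> only on functions vanishing outside \<open>B\<close>.\<close>

locale MU_action = vector_space scale
  for scale :: "ratfun \<Rightarrow> 'a :: ab_group_add \<Rightarrow> 'a" (infixr \<open>*s\<close> 75) +
  fixes S :: "'a set" and op :: "mu_gen \<Rightarrow> 'a \<Rightarrow> 'a"
  assumes finite_S: "finite S"
    and op_linear: "linear_operator scale (op g)"
    and op_closed: "x \<in> span S \<Longrightarrow> op g x \<in> span S"
    and K_Kinv: "x \<in> span S \<Longrightarrow> op (Sl2 K) (op (Sl2 Kinv) x) = x"
    and Kinv_K: "x \<in> span S \<Longrightarrow> op (Sl2 Kinv) (op (Sl2 K) x) = x"
    and K_E_Kinv: "x \<in> span S \<Longrightarrow>
      op (Sl2 K) (op (Sl2 E) (op (Sl2 Kinv) x)) = vv\<^sup>2 *s op (Sl2 E) x"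
    and K_F_Kinv: "x \<in> span S \<Longrightarrow>
      op (Sl2 K) (op (Sl2 F) (op (Sl2 Kinv) x)) = inverse vv ^ 2 *s op (Sl2 F) x"
    and E_F: "x \<in> span S \<Longrightarrow> op (Sl2 E) (op (Sl2 F) x) =
      op (Sl2 F) (op (Sl2 E) x) + (1 / (vv - inverse vv)) *s (op (Sl2 K) x - op (Sl2 Kinv) x)"
    and l_l: "x \<in> span S \<Longrightarrow> op Ell (op Ell x) = op Ell x"
    and K_l: "x \<in> span S \<Longrightarrow> op (Sl2 K) (op Ell x) = op Ell (op (Sl2 K) x)"
    and l_E_l: "x \<in> span S \<Longrightarrow> op Ell (op (Sl2 E) (op Ell x)) = op Ell (op (Sl2 E) x)"
    and l_F_l: "x \<in> span S \<Longrightarrow> op Ell (op (Sl2 F) (op Ell x)) = op (Sl2 F) (op Ell x)"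
    and E_l_E: "x \<in> span S \<Longrightarrow> qint 2 *s op (Sl2 E) (op Ell (op (Sl2 E) x)) =
      inverse vv *s op (Sl2 E) (op (Sl2 E) (op Ell x)) + vv *s op Ell (op (Sl2 E) (op (Sl2 E) x))"
    and F_l_F: "x \<in> span S \<Longrightarrow> qint 2 *s op (Sl2 F) (op Ell (op (Sl2 F) x)) =
      inverse vv *s op Ell (op (Sl2 F) (op (Sl2 F) x)) + vv *s op (Sl2 F) (op (Sl2 F) (op Ell x))"
begin

abbreviation "C \<equiv> span S"
abbreviation "e \<equiv> op (Sl2 E)"
abbreviation "f \<equiv> op (Sl2 F)"
abbreviation "k \<equiv> op (Sl2 K)"
abbreviation "k' \<equiv> op (Sl2 Kinv)"
abbreviation "l \<equiv> op Ell"

sublocale op: linear_operator scale "op g" for g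
  by (rule op_linear)
sublocale fp: linear_operator scale "f ^^ i" for i
  by (rule op.pow)

lemmas lin = op.add op.scale op.diff op.zero fp.add fp.scale fp.diff fp.zero

lemma fp_closed: "x \<in> C \<Longrightarrow> (f ^^ i) x \<in> C"
  by (induction i) (simp_all add: op_closed)

lemmas closed = op_closed fp_closed span_add span_diff span_scale span_zero

lemma K_E: "x \<in> C \<Longrightarrow> k (e x) = vv\<^sup>2 *s e (k x)"
  using K_E_Kinv[of "k x"] by (simp add: Kinv_K op_closed)

lemma K_F: "x \<in> C \<Longrightarrow> k (f x) = inverse vv ^ 2 *s f (k x)"
  using K_F_Kinv[of "k x"] by (simp add: Kinv_K op_closed)

lemma k_inj: "x \<in> C \<Longrightarrow> k x = 0 \<Longrightarrow> x = 0"
  using Kinv_K[of x] by (simp add: lin)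

text \<open>Rewriting rules for \<open>k'\<close> follow from those for \<open>k\<close> by cancelling \<open>k\<close>.\<close>

lemma Kinv_conj:
  assumes "x \<in> C" "g (k (k' x)) = c *s k (g (k' x))" "c \<noteq> 0" "g x \<in> C" "g (k' x) \<in> C"
  shows "k' (g x) = c *s g (k' x)"
  using assms Kinv_K[of "g (k' x)"] by (simp add: K_Kinv lin)

lemma Kinv_F: "x \<in> C \<Longrightarrow> k' (f x) = vv ^ 2 *s f (k' x)"
  using vv_nz by (intro Kinv_conj) (simp_all add: K_F closed power_inverse)

lemma Kinv_l: "x \<in> C \<Longrightarrow> k' (l x) = l (k' x)"
  using Kinv_conj[of x l 1] by (simp add: K_l closed)

lemma K_F_power: "x \<in> C \<Longrightarrow> k ((f ^^ i) x) = vv powi (- 2 * int i) *s (f ^^ i) (k x)"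
proof (induction i)
  case (Suc i)
  have "vv powi (- 2 * int (Suc i)) = inverse vv ^ 2 * vv powi (- 2 * int i)"
    using vv_nz power_int_add[of vv "- 2" "- 2 * int i"] by (simp add: power_int_minus power_inverse)
  then show ?case using Suc by (simp add: K_F closed lin del: of_nat_Suc)
qed simp

lemma Kinv_F_power: "x \<in> C \<Longrightarrow> k' ((f ^^ i) x) = vv powi (2 * int i) *s (f ^^ i) (k' x)"
proof (induction i)
  case (Suc i)
  have "vv powi (2 * int (Suc i)) = vv ^ 2 * vv powi (2 * int i)"
    using vv_nz power_int_add[of vv 2 "2 * int i"] by simp
  then show ?case using Suc by (simp add: Kinv_F closed lin del: of_nat_Suc)
qed simp

lemma e_nilpotent: "\<exists>s. \<forall>x\<in>C. (e ^^ s) x = 0"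
  by (rule q_commuting_nilpotent[OF op_linear op_linear finite_S])
    (auto simp: op_closed K_E vv_nz dest: k_inj vv_pow_eq_1_nat)

lemma f_nilpotent: "\<exists>s. \<forall>x\<in>C. (f ^^ s) x = 0"
  by (rule q_commuting_nilpotent[OF op_linear op_linear finite_S])
    (auto simp: op_closed K_F vv_nz dest: k_inj vv_pow_eq_1_nat)

text \<open>The \<open>sl\<^sub>2\<close> commutation formula on vectors killed by \<open>e\<close>.  It is stated before \<open>k\<close> is known
to have eigenvectors, because their existence is deduced from it.\<close>

lemma E_F_power:
  assumes x: "x \<in> C" and e: "e x = 0"
  shows "e ((f ^^ Suc i) x) = (qint (int i + 1) / (vv - inverse vv)) *s
    (f ^^ i) (vv powi (- int i) *s k x - vv powi (int i) *s k' x)"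
proof (induction i)
  case 0
  show ?case using x e by (simp add: E_F lin qint_1)
next
  case (Suc i)
  let ?d = "vv - inverse vv" and ?a = "(f ^^ Suc i) (k x)" and ?b = "(f ^^ Suc i) (k' x)"
  have v: "vv powi (- 2 * int (Suc i)) = vv powi (- (int i + 1)) * vv powi (- (int i + 1))"
    "vv powi (2 * int (Suc i)) = vv powi (int i + 1) * vv powi (int i + 1)"
    using vv_nz by (simp_all add: algebra_simps flip: power_int_add)
  have w: "vv powi (- int i) = vv * vv powi (- (int i + 1))"
    "vv powi (int i) = inverse vv * vv powi (int i + 1)"
    using vv_nz power_int_add[of vv 1 "- (int i + 1)"] power_int_add[of vv "- 1" "int i + 1"]
    by (simp_all add: power_int_minus)
  have q: "qint (int i + 1 + 1) * vv powi (- (int i + 1)) =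
      qint (int i + 1) * vv powi (- int i) + vv powi (- 2 * int (Suc i))"
    unfolding qint_Suc[of "int i + 1"] v w(1) by (simp add: algebra_simps)
  have q': "qint (int i + 1 + 1) * vv powi (int i + 1) =
      qint (int i + 1) * vv powi (int i) + vv powi (2 * int (Suc i))"
    unfolding qint_Suc'[of "int i + 1"] v w(2) by (simp add: algebra_simps)
  have "e ((f ^^ Suc (Suc i)) x) = f (e ((f ^^ Suc i) x)) +
      (1 / ?d) *s (k ((f ^^ Suc i) x) - k' ((f ^^ Suc i) x))"
    using E_F[of "(f ^^ Suc i) x"] x by (simp add: closed)
  also have "f (e ((f ^^ Suc i) x)) =
      (qint (int i + 1) / ?d) *s (vv powi (- int i) *s ?a - vv powi (int i) *s ?b)"
    unfolding Suc.IH by (simp add: lin)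
  also have "k ((f ^^ Suc i) x) = vv powi (- 2 * int (Suc i)) *s ?a"
    by (rule K_F_power[OF x])
  also have "k' ((f ^^ Suc i) x) = vv powi (2 * int (Suc i)) *s ?b"
    by (rule Kinv_F_power[OF x])
  also have "(qint (int i + 1) / ?d) *s (vv powi (- int i) *s ?a - vv powi (int i) *s ?b) +
      (1 / ?d) *s (vv powi (- 2 * int (Suc i)) *s ?a - vv powi (2 * int (Suc i)) *s ?b) =
      (1 / ?d) *s ((qint (int i + 1) * vv powi (- int i) + vv powi (- 2 * int (Suc i))) *s ?a -
        (qint (int i + 1) * vv powi (int i) + vv powi (2 * int (Suc i))) *s ?b)"
    by (simp add: scale_left_distrib scale_right_distrib scale_right_diff_distrib algebra_simps)
  also have "\<dots> = (qint (int (Suc i) + 1) / ?d) *s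
      (f ^^ Suc i) (vv powi (- int (Suc i)) *s k x - vv powi (int (Suc i)) *s k' x)"
    unfolding q[symmetric] q'[symmetric]
    by (simp add: lin scale_right_diff_distrib algebra_simps)
  finally show ?case .
qed


text \<open>Vectors killed by \<open>e\<close>, of weight \<open>\<plusminus>v\<^sup>n\<close> with \<open>n\<close> natural; the zero vector is admitted so that these
vectors form a subspace.\<close>

definition primitive :: "sign \<Rightarrow> nat \<Rightarrow> 'a \<Rightarrow> bool" where
  "primitive s n x \<longleftrightarrow> x \<in> C \<and> e x = 0 \<and> k x = (sval s * vv ^ n) *s x"

lemma primitiveD:
  assumes "primitive s n x"
  shows "x \<in> C" "e x = 0" "k x = (sval s * vv ^ n) *s x"
    and "k' x = (inverse (sval s * vv ^ n)) *s x"
proof -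
  show *: "x \<in> C" "e x = 0" "k x = (sval s * vv ^ n) *s x"
    using assms by (auto simp: primitive_def)
  have "(sval s * vv ^ n) *s k' x = x" using Kinv_K[OF *(1)] by (simp add: * lin)
  then have "(inverse (sval s * vv ^ n)) *s ((sval s * vv ^ n) *s k' x) = (inverse (sval s * vv ^ n)) *s x"
    by simp
  then show "k' x = (inverse (sval s * vv ^ n)) *s x"
    using vv_nz by (simp del: sval_inverse inverse_mult_distrib)
qed

lemma primitive_E_F:
  assumes "primitive s n x"
  shows "e ((f ^^ Suc i) x) = (sval s * qint (int i + 1) * qint (int n - int i)) *s (f ^^ i) x"
proof -
  note x = primitiveD[OF assms]
  define a where "a = vv powi (int n - int i)"
  have a: "a \<noteq> 0" "vv powi (- int i) * vv ^ n = a" "vv powi (int i) * inverse (vv ^ n) = inverse a"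
    using vv_nz by (simp_all add: a_def power_int_diff power_int_minus field_simps)
  have q: "qint (int n - int i) = (a - inverse a) / (vv - inverse vv)"
    by (simp add: a_def qint_def power_int_minus[symmetric])
  have "e ((f ^^ Suc i) x) = (qint (int i + 1) / (vv - inverse vv)) *s
    (f ^^ i) ((sval s * (vv powi (- int i) * vv ^ n)) *s x -
      (sval s * (vv powi (int i) * inverse (vv ^ n))) *s x)"
    unfolding E_F_power[OF x(1,2)] x(3,4) by (simp add: mult_ac)
  also have "\<dots> = (qint (int i + 1) / (vv - inverse vv)) *s
    (f ^^ i) ((sval s * (a - inverse a)) *s x)"
    unfolding a by (simp add: right_diff_distrib scale_left_diff_distrib)
  finally show ?thesis unfolding q by (simp add: lin mult_ac)
qed

text \<open>If \<open>m\<close> is the first exponent with \<open>f\<^sup>m x = 0\<close>, applying \<open>e\<close> to this equation forces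
\<open>[m] [n + 1 - m] = 0\<close>.\<close>

lemma primitive_F_string:
  assumes "primitive s n x" "x \<noteq> 0"
  shows "(f ^^ Suc n) x = 0" and "i \<le> n \<Longrightarrow> (f ^^ i) x \<noteq> 0"
proof -
  note x = primitiveD[OF assms(1)]
  obtain t where "(f ^^ t) x = 0" using f_nilpotent x(1) by blast
  define m where "m = (LEAST t. (f ^^ t) x = 0)"
  have m: "(f ^^ m) x = 0" "\<And>t. t < m \<Longrightarrow> (f ^^ t) x \<noteq> 0"
    unfolding m_def by (rule LeastI, fact) (rule not_less_Least)
  have "m \<noteq> 0" using m(1) assms(2) by (intro notI) simp
  then obtain r where r: "m = Suc r" by (cases m) auto
  have "(sval s * qint (int r + 1) * qint (int n - int r)) *s (f ^^ r) x = 0"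
    using primitive_E_F[OF assms(1), of r] m(1) unfolding r by (simp only: lin)
  then have "qint (int n - int r) = 0" using m(2)[of r] r qint_nz[of "int r + 1"] by simp
  then have "int n - int r = 0" using qint_nz by blast
  then have "r = n" by simp
  then show "(f ^^ Suc n) x = 0" "i \<le> n \<Longrightarrow> (f ^^ i) x \<noteq> 0" using m r by auto
qed

text \<open>Among all nonzero vectors of \<open>H\<close> take one, \<open>x\<close>, for which the exponent \<open>n + 1\<close> with
\<open>f\<^sup>n\<^sup>+\<^sup>1 x = 0\<close> is least.  Applying \<open>e\<close> gives \<open>f\<^sup>n y = 0\<close> for
\<open>y = v\<^sup>-\<^sup>n k x - v\<^sup>n k' x\<close>, and \<open>y\<close> lies in \<open>H\<close> again; so \<open>y = 0\<close> by minimality, that is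
\<open>(k - v\<^sup>n) (k + v\<^sup>n) x = 0\<close>.  One of the two factors has an eigenvector.  Thus the weights lie in the
ground field and are dominant, although that field is not algebraically closed.\<close>

lemma exists_primitive:
  assumes H: "subspace H" "H \<subseteq> C" "H \<noteq> {0}"
    and stable: "\<And>x. x \<in> H \<Longrightarrow> e x = 0" "\<And>x. x \<in> H \<Longrightarrow> k x \<in> H" "\<And>x. x \<in> H \<Longrightarrow> k' x \<in> H"
  shows "\<exists>x\<in>H. \<exists>s n. x \<noteq> 0 \<and> primitive s n x"
proof -
  note sub = subspace_add[OF H(1)] subspace_diff[OF H(1)] subspace_scale[OF H(1)] subspace_0[OF H(1)]
  define P where "P t \<longleftrightarrow> (\<exists>x\<in>H. x \<noteq> 0 \<and> (f ^^ t) x = 0)" for t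
  from H(3) sub(4) obtain x0 where x0: "x0 \<in> H" "x0 \<noteq> 0" by blast
  obtain t where "(f ^^ t) x0 = 0" using f_nilpotent x0 H(2) by blast
  then have "P t" using x0 by (auto simp: P_def)
  define m where "m = (LEAST t. P t)"
  have m: "P m" "\<And>t. t < m \<Longrightarrow> \<not> P t"
    unfolding m_def by (rule LeastI, fact) (rule not_less_Least)
  from m(1) obtain x where x: "x \<in> H" "x \<noteq> 0" "(f ^^ m) x = 0" by (auto simp: P_def)
  have "m \<noteq> 0" using x by (intro notI) simp
  then obtain n where n: "m = Suc n" by (cases m) auto
  define y where "y = vv powi (- int n) *s k x - vv powi (int n) *s k' x"
  have xC: "x \<in> C" "k x \<in> H" "k x \<in> C" using x(1) H(2) stable by auto
  have "(qint (int n + 1) / (vv - inverse vv)) *s (f ^^ n) y = 0"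
    using E_F_power[OF xC(1) stable(1)[OF x(1)], of n] x(3)
    unfolding n y_def by (simp only: lin)
  then have "(f ^^ n) y = 0" using qint_nz[of "int n + 1"] vv_diff_nz by simp
  moreover have "y \<in> H" unfolding y_def by (intro sub stable x)
  ultimately have "y = 0" using m(2)[of n] unfolding n P_def by auto
  then have "k (vv powi (- int n) *s k x - vv powi (int n) *s k' x) = 0"
    by (simp add: y_def lin)
  then have "vv powi (- int n) *s k (k x) = vv powi (int n) *s x"
    using xC by (simp add: lin K_Kinv)
  then have "vv powi (int n) *s (vv powi (- int n) *s k (k x)) = vv powi (int n) *s (vv powi (int n) *s x)"
    by simp
  then have kk: "k (k x) = (vv ^ n * vv ^ n) *s x"
    using vv_nz by (simp add: power_int_minus)
  show ?thesis
  proof (cases "k x + (vv ^ n) *s x = 0")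
    case True
    then have "k x = (sval Minus * vv ^ n) *s x" by (simp add: add_eq_0_iff)
    then have "primitive Minus n x" using stable(1) x xC by (simp add: primitive_def)
    then show ?thesis using x by blast
  next
    case False
    define z where "z = k x + (vv ^ n) *s x"
    have "z \<in> H" unfolding z_def by (intro sub stable x)
    moreover have "k z = (sval Plus * vv ^ n) *s z"
      by (simp add: z_def lin kk algebra_simps)
    ultimately have "primitive Plus n z" using stable(1) H(2) by (auto simp: primitive_def)
    then show ?thesis using False \<open>z \<in> H\<close> z_def by blast
  qed
qed

lemma ker_e_nonzero:
  assumes "subspace W" "W \<subseteq> C" "W \<noteq> {0}" "\<And>x. x \<in> W \<Longrightarrow> e x \<in> W"
  shows "{x \<in> W. e x = 0} \<noteq> {0}"
proof -
  obtain x where x: "x \<in> W" "x \<noteq> 0" using assms(3) subspace_0[OF assms(1)] by blast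
  obtain t where "(e ^^ t) x = 0" using e_nilpotent x assms(2) by blast
  define m where "m = (LEAST t. (e ^^ t) x = 0)"
  have m: "(e ^^ m) x = 0" "\<And>t. t < m \<Longrightarrow> (e ^^ t) x \<noteq> 0"
    unfolding m_def by (rule LeastI, fact) (rule not_less_Least)
  have "m \<noteq> 0" using m(1) x(2) by (intro notI) simp
  then obtain r where r: "m = Suc r" by (cases m) auto
  have "(e ^^ r) x \<in> W" using x(1) assms(4) by (induction r) auto
  moreover have "e ((e ^^ r) x) = 0" "(e ^^ r) x \<noteq> 0" using m(1) m(2)[of r] r by auto
  ultimately show ?thesis by blast
qed

text \<open>The eigenspace \<open>W\<close> of \<open>l\<close> contains vectors killed by \<open>e\<close> because \<open>e\<close> is nilpotent, and they form
a space stable under \<open>k\<close>, because \<open>l\<close> commutes with \<open>k\<close>.\<close>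

lemma exists_primitive_eigenvector:
  assumes W: "W = {x \<in> C. l x = c *s x}" "W \<noteq> {0}" "\<And>x. x \<in> W \<Longrightarrow> e x \<in> W"
  shows "\<exists>x s n. x \<noteq> 0 \<and> primitive s n x \<and> l x = c *s x"
proof -
  have sub: "subspace W" unfolding W(1)
    by (rule subspaceI) (auto simp: closed lin algebra_simps)
  have "\<exists>x\<in>{x \<in> W. e x = 0}. \<exists>s n. x \<noteq> 0 \<and> primitive s n x"
  proof (rule exists_primitive)
    show "subspace {x \<in> W. e x = 0}"
      by (rule subspaceI)
        (auto simp: lin subspace_add[OF sub] subspace_scale[OF sub] subspace_0[OF sub])
    show "{x \<in> W. e x = 0} \<noteq> {0}" using sub W by (intro ker_e_nonzero) auto
    fix x assume x: "x \<in> {x \<in> W. e x = 0}"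
    then have xC: "x \<in> C" by (auto simp: W(1))
    have "e (k x) = 0" using K_E[OF xC] x vv_nz by (auto simp: lin)
    then show "k x \<in> {x \<in> W. e x = 0}" using x by (auto simp: W(1) closed K_l[symmetric] lin)
    have "k (e (k' x)) = 0" using K_E_Kinv[OF xC] x by (simp add: lin)
    then have "e (k' x) = 0" by (rule k_inj[rotated]) (intro op_closed xC)
    then show "k' x \<in> {x \<in> W. e x = 0}" using x by (auto simp: W(1) closed Kinv_l[symmetric] lin)
  qed (auto simp: W(1))
  then show ?thesis by (auto simp: W(1))
qed

end

section \<open>The idempotent and the operator \<open>e l f\<close>\<close>

context MU_action
begin

text \<open>The Serre type relation for \<open>f l f\<close> determines \<open>f l\<close> on the \<open>f\<close>-string of a vector killed by
\<open>l\<close>: it is a two term recursion with solution \<open>v\<^sup>-\<^sup>1 [i] / [i + 1]\<close>, because \<open>[2] [i + 1] - [i] = [i + 2]\<close>.\<close>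

lemma F_l_power:
  assumes x: "x \<in> C" "l x = 0"
  shows "f (l ((f ^^ i) x)) = (inverse vv * (qint (int i) / qint (int i + 1))) *s l ((f ^^ Suc i) x)"
proof (induction i)
  case 0
  show ?case using x by (simp add: lin)
next
  case (Suc i)
  let ?y = "f (l ((f ^^ Suc i) x))" and ?z = "l ((f ^^ Suc (Suc i)) x)"
  define c where "c = qint (int i) / qint (int i + 1)"
  have nz: "qint (int i + 1) \<noteq> 0" "qint (int i + 1 + 1) \<noteq> 0" using qint_nz by simp_all
  have "qint 2 *s ?y = inverse vv *s ?z + vv *s f (f (l ((f ^^ i) x)))"
    using F_l_F[of "(f ^^ i) x"] x by (simp add: closed)
  also have "\<dots> = inverse vv *s ?z + c *s ?y"
    unfolding Suc.IH using vv_nz by (simp add: lin c_def)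
  finally have "(qint 2 - c) *s ?y = inverse vv *s ?z"
    by (simp add: scale_left_diff_distrib)
  moreover have "qint 2 - c = qint (int i + 1 + 1) / qint (int i + 1)"
  proof -
    have Q: "qint (int i + 1) = vv * qint (int i) + vv powi (- int i)" by (rule qint_Suc)
    have v: "vv powi (- (int i + 1)) = inverse vv * vv powi (- int i)"
      using power_int_add[of vv "- 1" "- int i"] vv_nz by (simp add: power_int_minus algebra_simps)
    have "qint 2 * qint (int i + 1) - qint (int i) = qint (int i + 1 + 1)"
      unfolding qint_Suc[of "int i + 1"] v qint_2 unfolding Q using vv_nz by (simp add: algebra_simps)
    then show ?thesis using nz by (simp add: c_def field_simps)
  qed
  ultimately have "(qint (int i + 1 + 1) / qint (int i + 1)) *s ?y = inverse vv *s ?z" by simp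
  then have "(qint (int i + 1) / qint (int i + 1 + 1)) *s ((qint (int i + 1 + 1) / qint (int i + 1)) *s ?y) =
    (qint (int i + 1) / qint (int i + 1 + 1)) *s (inverse vv *s ?z)" by simp
  then show ?case using nz by (simp add: mult_ac add_ac)
qed

text \<open>The projection to the kernel of the idempotent \<open>l\<close>.\<close>

definition P :: "'a \<Rightarrow> 'a" where
  "P x = x - l x"

text \<open>On vectors killed by \<open>e\<close> and \<open>l\<close> of a fixed weight this operator plays the role of a Casimir
element.  Its eigenvalues separate the modules \<open>L\<^sup>\<plusminus>(n,0)\<close>, where it vanishes, from \<open>L\<^sup>\<plusminus>(n,01)\<close>, where
it is \<open>\<plusminus>v\<^sup>1\<^sup>-\<^sup>n\<close>.\<close>

definition T :: "'a \<Rightarrow> 'a" where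
  "T x = e (l (f x))"

lemma P_linear: "linear_operator scale P"
  by unfold_locales (simp_all add: P_def lin scale_right_diff_distrib)

lemma T_linear: "linear_operator scale T"
  by unfold_locales (simp_all add: T_def lin)

sublocale P: linear_operator scale P by (rule P_linear)
sublocale T: linear_operator scale T by (rule T_linear)

lemma PT_closed: "x \<in> C \<Longrightarrow> P x \<in> C" "x \<in> C \<Longrightarrow> T x \<in> C"
  by (simp_all add: P_def T_def closed)

text \<open>The kernel of \<open>l\<close> is stable under \<open>e\<close> and the image of \<open>l\<close> is stable under \<open>f\<close>, so modulo the
image of \<open>l\<close> the operator \<open>f\<close> is not changed by inserting \<open>P\<close> before it, whereas \<open>e\<close> acquires a
correction term.\<close>

lemma P_l: "x \<in> C \<Longrightarrow> P (l x) = 0"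
  by (simp add: P_def l_l)

lemma P_F_l: "x \<in> C \<Longrightarrow> P (f (l x)) = 0"
  by (simp add: P_def l_F_l)

lemma P_F_P: "x \<in> C \<Longrightarrow> P (f (P x)) = P (f x)"
  using P_F_l[of x] by (simp add: P_def[of x] lin P.diff)

lemma P_E_P: "x \<in> C \<Longrightarrow> P (e (P x)) = P (e x) - P (e (l x))"
  by (simp add: P_def[of x] lin P.diff)

text \<open>The primitive vectors in the kernel of \<open>l\<close>.\<close>

definition null_primitive :: "sign \<Rightarrow> nat \<Rightarrow> 'a \<Rightarrow> bool" where
  "null_primitive s n x \<longleftrightarrow> primitive s n x \<and> l x = 0"

lemma null_primitiveD:
  assumes "null_primitive s n x"
  shows "primitive s n x" "l x = 0" "x \<in> C" "e x = 0" "k x = (sval s * vv ^ n) *s x"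
    "k' x = (inverse (sval s * vv ^ n)) *s x" "P x = x"
  using assms primitiveD[of s n x] by (auto simp: null_primitive_def P_def)

lemma null_primitive_diff_scale:
  assumes "null_primitive s n x" "null_primitive s n y"
  shows "null_primitive s n (c *s x - d *s y)"
  using null_primitiveD[OF assms(1)] null_primitiveD[OF assms(2)]
  by (simp add: null_primitive_def primitive_def closed lin scale_right_diff_distrib mult_ac)

text \<open>The relation for \<open>e l e\<close>, applied to \<open>f x\<close>, shows that \<open>e\<close> kills \<open>e l f x\<close>, because \<open>e f x\<close> is a
multiple of \<open>x\<close>.\<close>

lemma null_primitive_T:
  assumes "null_primitive s n x"
  shows "null_primitive s n (T x)"
proof -
  note x = null_primitiveD[OF assms]
  obtain \<mu> where ef: "e (f x) = \<mu> *s x"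
    using primitive_E_F[OF x(1), of 0] by auto
  have "l (T x) = l (e (f x))" using x by (simp add: T_def l_E_l closed)
  then have "l (T x) = 0" by (simp add: ef lin x)
  moreover have "inverse vv *s e (T x) = 0"
    using E_l_E[of "f x"] x by (simp add: ef lin T_def closed)
  then have "e (T x) = 0" using vv_nz by simp
  moreover have "k (T x) = (sval s * vv ^ n) *s T x"
    using x vv_nz by (simp add: T_def K_E K_l K_F closed lin power_inverse)
  ultimately show ?thesis
    using x by (simp add: null_primitive_def primitive_def PT_closed)
qed

text \<open>Induction along the \<open>f\<close>-string: \<open>l f\<^sup>i\<^sup>+\<^sup>1 x\<close> is a multiple of \<open>f l f\<^sup>i x\<close>, and \<open>e\<close> moves past that
\<open>f\<close> up to a term in the image of \<open>l\<close>, which \<open>P\<close> removes.\<close>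

lemma P_E_l_power:
  assumes "null_primitive s n x"
  shows "P (e (l ((f ^^ Suc i) x))) = (vv powi (int i) * qint (int i + 1)) *s P ((f ^^ i) (T x))"
proof (induction i)
  case 0
  then show ?case by (simp add: T_def qint_1)
next
  case (Suc i)
  note x = null_primitiveD[OF assms]
  let ?y = "l ((f ^^ Suc i) x)"
  have yC: "?y \<in> C" "(f ^^ Suc i) x \<in> C" using x by (simp_all add: closed)
  have nz: "qint (int i + 1) \<noteq> 0" "qint (int i + 1 + 1) \<noteq> 0" using qint_nz by simp_all
  define c where "c = vv * (qint (int i + 1 + 1) / qint (int i + 1))"
  have fy: "c *s f ?y = l ((f ^^ Suc (Suc i)) x)"
    using F_l_power[OF x(3,2), of "Suc i"] nz vv_nz by (simp add: c_def add_ac)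
  have "P (e (f ?y)) = P (f (e ?y)) + (1 / (vv - inverse vv)) *s (P (k ?y) - P (k' ?y))"
    using E_F[OF yC(1)] by (simp add: P.add P.scale P.diff)
  also have "\<dots> = P (f (e ?y))"
    by (simp only: K_l[OF yC(2)] Kinv_l[OF yC(2)] P_l[OF op_closed[OF yC(2)]] diff_self
      scale_zero_right add_0_right)
  also have "P (f (e ?y)) = P (f (P (e ?y)))"
    using yC by (simp only: P_F_P op_closed)
  also have "\<dots> = (vv powi (int i) * qint (int i + 1)) *s P (f ((f ^^ i) (T x)))"
    unfolding Suc.IH using x by (simp add: lin P.scale P_F_P closed PT_closed)
  finally have "P (e (f ?y)) = (vv powi (int i) * qint (int i + 1)) *s P ((f ^^ Suc i) (T x))"
    by simp
  moreover have "P (e (l ((f ^^ Suc (Suc i)) x))) = c *s P (e (f ?y))"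
    by (simp only: fy[symmetric] lin P.scale)
  ultimately show ?case
    using nz vv_nz by (simp add: c_def power_int_add algebra_simps)
qed

lemma E_l_power:
  assumes "null_primitive s n x"
  shows "e (l ((f ^^ Suc i) x)) =
    (sval s * qint (int i + 1) * qint (int n - int i)) *s l ((f ^^ i) x) +
    (vv powi (int i) * qint (int i + 1)) *s P ((f ^^ i) (T x))"
proof -
  note x = null_primitiveD[OF assms]
  have "l (e (l ((f ^^ Suc i) x))) = l (e ((f ^^ Suc i) x))" using x by (simp add: l_E_l closed)
  also have "\<dots> = (sval s * qint (int i + 1) * qint (int n - int i)) *s l ((f ^^ i) x)"
    unfolding primitive_E_F[OF x(1)] by (simp add: lin)
  finally show ?thesis
    using P_E_l_power[OF assms, of i] P_def[of "e (l ((f ^^ Suc i) x))"] by (simp add: diff_eq_eq add.commute del: funpow.simps)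
qed

text \<open>If \<open>P f\<^sup>j y = 0\<close> then \<open>f\<^sup>j y\<close> is fixed by \<open>l\<close>, and so is \<open>f\<^sup>j\<^sup>+\<^sup>1 y\<close>.  The value of
\<open>f l f\<^sup>j y\<close> then makes \<open>f\<^sup>j\<^sup>+\<^sup>1 y\<close> equal to \<open>v\<^sup>-\<^sup>1 [j] / [j + 1]\<close> times itself, so it is zero;
but for \<open>j < n\<close> the string of a nonzero \<open>y\<close> has not ended yet.\<close>

lemma P_F_power_inj:
  assumes "null_primitive s n y" "j < n" "P ((f ^^ j) y) = 0"
  shows "y = 0"
proof (rule ccontr)
  assume "y \<noteq> 0"
  note y = null_primitiveD[OF assms(1)]
  have l: "l ((f ^^ j) y) = (f ^^ j) y" using assms(3) by (simp add: P_def)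
  have "l ((f ^^ Suc j) y) = (f ^^ Suc j) y"
    using l_F_l[of "(f ^^ j) y"] y l by (simp add: closed)
  then have "(f ^^ Suc j) y = (inverse vv * (qint (int j) / qint (int j + 1))) *s (f ^^ Suc j) y"
    using F_l_power[OF y(3,2), of j] l by simp
  then have "(inverse vv * (qint (int j) / qint (int j + 1))) *s (f ^^ Suc j) y = 1 *s (f ^^ Suc j) y"
    by (simp only: scale_one)
  then have "inverse vv * (qint (int j) / qint (int j + 1)) = 1"
    using primitive_F_string(2)[OF y(1) \<open>y \<noteq> 0\<close>, of "Suc j"] assms(2)
    unfolding scale_cancel_right by (simp only: Suc_leI simp_thms)
  then have "inverse vv * qint (int j) = qint (int j + 1)"
    using qint_nz[of "int j + 1"] by (simp add: field_simps)
  then show False using qint_Suc'[of "int j"] vv_nz by simp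
qed

text \<open>This is \<open>e l f\<^sup>n\<^sup>+\<^sup>1 x = 0\<close> at the end of the string.\<close>

lemma P_F_power_T:
  assumes "null_primitive s n x"
  shows "P ((f ^^ n) (T x)) = 0"
proof (cases "x = 0")
  case False
  note x = null_primitiveD[OF assms]
  have "(vv powi (int n) * qint (int n + 1)) *s P ((f ^^ n) (T x)) = 0"
    using P_E_l_power[OF assms, of n] primitive_F_string(1)[OF x(1) False] by (simp only: lin P.zero)
  then show ?thesis using qint_nz[of "int n + 1"] vv_nz by simp
qed (simp add: lin P.zero T.zero)

text \<open>Apply \<open>P e\<close> to \<open>P f\<^sup>n T x = 0\<close>.  The result is \<open>P f\<^sup>n\<^sup>-\<^sup>1\<close> of a multiple of
\<open>w = \<plusminus>T x - v\<^sup>n\<^sup>-\<^sup>1 T (T x)\<close>, so \<open>w = 0\<close> by injectivity.  Hence \<open>T\<close> is, up to a scalar,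
idempotent, and has an eigenvector in the ground field.\<close>

lemma T_T:
  assumes x: "null_primitive s n x"
  shows "T (T x) = (sval s * vv powi (1 - int n)) *s T x"
proof (cases n)
  case 0
  have "T x = 0"
    using P_F_power_T[OF x] null_primitiveD(7)[OF null_primitive_T[OF x]] 0 by simp
  then show ?thesis by (simp add: T.zero)
next
  case (Suc m)
  note y = null_primitive_T[OF x]
  note yD = null_primitiveD[OF y]
  define w where "w = sval s *s T x - vv powi (int m) *s T (T x)"
  have w: "null_primitive s n w"
    unfolding w_def by (intro null_primitive_diff_scale y null_primitive_T)
  have "P (e (P ((f ^^ Suc m) (T x)))) = 0"
    using P_F_power_T[OF x] unfolding Suc by (simp only: lin P.zero)
  also have "P (e (P ((f ^^ Suc m) (T x)))) = P (e ((f ^^ Suc m) (T x))) - P (e (l ((f ^^ Suc m) (T x))))"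
    using yD by (intro P_E_P closed)
  also have "\<dots> = (sval s * qint (int m + 1)) *s P ((f ^^ m) (T x)) -
      (vv powi (int m) * qint (int m + 1)) *s P ((f ^^ m) (T (T x)))"
    unfolding primitive_E_F[OF yD(1)] P_E_l_power[OF y] by (simp add: P.scale Suc qint_1)
  also have "\<dots> = qint (int m + 1) *s P ((f ^^ m) w)"
    by (simp add: w_def lin P.scale P.diff scale_right_diff_distrib mult_ac)
  finally have "P ((f ^^ m) w) = 0" using qint_nz[of "int m + 1"] by simp
  then have "w = 0" by (intro P_F_power_inj[OF w, of m]) (simp_all add: Suc)
  then have "vv powi (int m) *s T (T x) = sval s *s T x" by (simp add: w_def)
  then have "vv powi (- int m) *s (vv powi (int m) *s T (T x)) = vv powi (- int m) *s (sval s *s T x)"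
    by simp
  then show ?thesis using vv_nz by (simp add: Suc power_int_minus mult_ac)
qed

end

locale irreducible_MU_action = MU_action +
  assumes nonzero: "span S \<noteq> {0}"
    and irreducible: "\<And>N. subspace N \<Longrightarrow> N \<subseteq> span S \<Longrightarrow>
      (\<And>g x. x \<in> N \<Longrightarrow> op g x \<in> N) \<Longrightarrow> N = {0} \<or> N = span S"
begin

text \<open>If \<open>T x = 0\<close>, the vectors \<open>l f\<^sup>i x\<close> span a submodule inside the image of \<open>l\<close>; it does not contain
\<open>x\<close>, so it is zero by irreducibility.\<close>

lemma l_F_power_zero:
  assumes x: "null_primitive s n x" "x \<noteq> 0" and T: "T x = 0"
  shows "l ((f ^^ i) x) = 0"
proof -
  note xD = null_primitiveD[OF x(1)]
  define G where "G = range (\<lambda>i. l ((f ^^ i) x))"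
  define N where "N = span G"
  have GN: "l ((f ^^ i) x) \<in> N" for i unfolding N_def G_def by (intro span_base) simp
  note sN = span_add[of _ G, folded N_def] span_scale[of _ G, folded N_def] span_zero[of G, folded N_def]
  have gen: "op g (l ((f ^^ i) x)) \<in> N" for g i
  proof (cases g)
    case (Sl2 h)
    show ?thesis
    proof (cases h)
      case E
      show ?thesis
      proof (cases i)
        case 0
        then show ?thesis using sN(3) by (simp add: xD lin)
      next
        case (Suc j)
        show ?thesis unfolding Sl2 E Suc E_l_power[OF x(1)] T
          by (simp only: lin P.zero scale_zero_right add_0_right) (intro sN GN)
      qed
    next
      case F
      show ?thesis unfolding Sl2 F F_l_power[OF xD(3,2)] by (intro sN GN)
    next
      case K
      have "k (l ((f ^^ i) x)) = (vv powi (- 2 * int i) * (sval s * vv ^ n)) *s l ((f ^^ i) x)"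
        using xD(3) by (simp only: K_l closed K_F_power xD(5) lin scale_scale)
      then show ?thesis unfolding Sl2 K by (simp only:) (intro sN GN)
    next
      case Kinv
      have "k' (l ((f ^^ i) x)) = (vv powi (2 * int i) * inverse (sval s * vv ^ n)) *s l ((f ^^ i) x)"
        using xD(3) by (simp only: Kinv_l closed Kinv_F_power xD(6) lin scale_scale)
      then show ?thesis unfolding Sl2 Kinv by (simp only:) (intro sN GN)
    qed
  next
    case Ell
    show ?thesis using xD(3) GN by (simp add: Ell l_l closed)
  qed
  have stable: "op g y \<in> N" if "y \<in> N" for g y
    using that unfolding N_def
  proof (induction rule: span_induct)
    case base
    show ?case by (rule subspaceI) (auto simp: lin intro: span_add span_scale span_zero)
  next
    case (step y)
    then show ?case using gen by (auto simp: G_def N_def)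
  qed
  have NC: "N \<subseteq> C" unfolding N_def
    by (rule span_minimal) (auto simp: G_def xD closed)
  have Nl: "N \<subseteq> {y. l y = y}" unfolding N_def
    by (rule span_minimal) (auto simp: G_def xD closed l_l lin intro!: subspaceI)
  have "N \<noteq> C" using Nl xD(2,3) x(2) by auto
  then have "N = {0}" using irreducible[OF _ NC stable] by (simp add: N_def)
  then show ?thesis using GN by blast
qed

text \<open>Either \<open>l\<close> is the identity, or its kernel contains a primitive vector \<open>x\<close>.  In the latter case
\<open>T x\<close> is zero or is itself an eigenvector of \<open>T\<close> with eigenvalue \<open>\<plusminus>v\<^sup>1\<^sup>-\<^sup>n\<close>.  The three
possibilities are the three families of the classification.\<close>

theorem generating_vector:
  "(\<exists>s n c x. x \<noteq> 0 \<and> primitive s n x \<and> (\<forall>i. l ((f ^^ i) x) = of_bool c *s (f ^^ i) x)) \<or>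
   (\<exists>s n x. n \<ge> 1 \<and> x \<noteq> 0 \<and> null_primitive s n x \<and> T x = (sval s * vv powi (1 - int n)) *s x)"
proof (cases "{x \<in> C. l x = 0 *s x} = {0}")
  case True
  have ll: "l x = x" if "x \<in> C" for x
  proof -
    have "P x \<in> {x \<in> C. l x = 0 *s x}" using that by (simp add: PT_closed) (simp add: P_def lin l_l)
    then have "P x = 0" unfolding True by simp
    then show ?thesis by (simp add: P_def)
  qed
  have C1: "C = {x \<in> C. l x = 1 *s x}" using ll by auto
  obtain x s n where x: "x \<noteq> 0" "primitive s n x"
    using exists_primitive_eigenvector[OF C1 nonzero op_closed] by blast
  have "l ((f ^^ i) x) = of_bool True *s (f ^^ i) x" for i
    using primitiveD(1)[OF x(2)] by (simp add: ll closed)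
  with x show ?thesis by (intro disjI1 exI[of _ s] exI[of _ n] exI[of _ True] exI[of _ x]) simp
next
  case False
  have "\<exists>x s n. x \<noteq> 0 \<and> primitive s n x \<and> l x = 0 *s x"
  proof (rule exists_primitive_eigenvector[OF refl False])
    fix x assume x: "x \<in> {x \<in> C. l x = 0 *s x}"
    then have "l (e x) = 0" using l_E_l[of x] by (simp add: lin)
    then show "e x \<in> {x \<in> C. l x = 0 *s x}" using x by (simp add: closed)
  qed
  then obtain x s n where x: "x \<noteq> 0" "null_primitive s n x" by (auto simp: null_primitive_def)
  show ?thesis
  proof (cases "T x = 0")
    case True
    then have "\<forall>i. l ((f ^^ i) x) = of_bool False *s (f ^^ i) x"
      using l_F_power_zero[OF x(2,1)] by simp
    with x(1) null_primitiveD(1)[OF x(2)]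
    show ?thesis by (intro disjI1 exI[of _ s] exI[of _ n] exI[of _ False] exI[of _ x] conjI)
  next
    case False
    have "n \<noteq> 0"
    proof
      assume "n = 0"
      then have "P (T x) = 0" using P_F_power_T[OF x(2)] by simp
      then show False using False null_primitiveD(7)[OF null_primitive_T[OF x(2)]] by simp
    qed
    then have "n \<ge> 1" by simp
    then show ?thesis using False null_primitive_T[OF x(2)] T_T[OF x(2)]
      by (intro disjI2 exI[of _ s] exI[of _ n] exI[of _ "T x"] conjI)
  qed
qed

end

section \<open>Modules over noncommutative rings and presented algebras\<close>

lemma (in left_module) lsmult_zero: "x \<in> carrier M \<Longrightarrow> \<zero>\<^bsub>R\<^esub> \<odot>\<^bsub>M\<^esub> x = \<zero>\<^bsub>M\<^esub>"
proof -
  assume x: "x \<in> carrier M"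
  have "\<zero>\<^bsub>R\<^esub> \<odot>\<^bsub>M\<^esub> x \<oplus>\<^bsub>M\<^esub> \<zero>\<^bsub>R\<^esub> \<odot>\<^bsub>M\<^esub> x = \<zero>\<^bsub>R\<^esub> \<odot>\<^bsub>M\<^esub> x"
    using lsmult_l_distr[of "\<zero>\<^bsub>R\<^esub>" "\<zero>\<^bsub>R\<^esub>" x] x by simp
  then show ?thesis using lsmult_closed[of "\<zero>\<^bsub>R\<^esub>" x] x
    by (metis M.add.r_cancel_one' R.zero_closed)
qed

lemma (in left_module) lsmult_zero_right: "a \<in> carrier R \<Longrightarrow> a \<odot>\<^bsub>M\<^esub> \<zero>\<^bsub>M\<^esub> = \<zero>\<^bsub>M\<^esub>"
  using lsmult_r_distr[of a "\<zero>\<^bsub>M\<^esub>" "\<zero>\<^bsub>M\<^esub>"] lsmult_closed[of a "\<zero>\<^bsub>M\<^esub>"]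
  by (metis M.add.r_cancel_one' M.r_zero M.zero_closed)

lemma (in left_module) submoduleI:
  assumes "H \<subseteq> carrier M" "\<zero>\<^bsub>M\<^esub> \<in> H" "\<And>x y. x \<in> H \<Longrightarrow> y \<in> H \<Longrightarrow> x \<oplus>\<^bsub>M\<^esub> y \<in> H"
    and smult: "\<And>a x. a \<in> carrier R \<Longrightarrow> x \<in> H \<Longrightarrow> a \<odot>\<^bsub>M\<^esub> x \<in> H"
  shows "Module.submodule H R M"
proof -
  have "\<ominus>\<^bsub>M\<^esub> x \<in> H" if x: "x \<in> H" for x
  proof -
    have xM: "x \<in> carrier M" using x assms(1) by blast
    have "(\<ominus>\<^bsub>R\<^esub> \<one>\<^bsub>R\<^esub>) \<odot>\<^bsub>M\<^esub> x \<oplus>\<^bsub>M\<^esub> x = \<zero>\<^bsub>M\<^esub>"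
      using lsmult_l_distr[of "\<ominus>\<^bsub>R\<^esub> \<one>\<^bsub>R\<^esub>" "\<one>\<^bsub>R\<^esub>" x] xM
      by (simp add: lsmult_one lsmult_zero R.l_neg)
    then have "\<ominus>\<^bsub>M\<^esub> x = (\<ominus>\<^bsub>R\<^esub> \<one>\<^bsub>R\<^esub>) \<odot>\<^bsub>M\<^esub> x"
      using xM lsmult_closed by (intro M.minus_equality) auto
    then show ?thesis using smult[OF _ x, of "\<ominus>\<^bsub>R\<^esub> \<one>\<^bsub>R\<^esub>"] by simp
  qed
  then show ?thesis
    using assms by (intro Module.submodule.intro subgroup.intro Module.submodule_axioms.intro)
      (auto simp: a_inv_def)
qed

lemma submoduleD:
  assumes "Module.submodule N R M"
  shows "N \<subseteq> carrier M" "\<zero>\<^bsub>M\<^esub> \<in> N" "x \<in> N \<Longrightarrow> y \<in> N \<Longrightarrow> x \<oplus>\<^bsub>M\<^esub> y \<in> N"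
    "a \<in> carrier R \<Longrightarrow> x \<in> N \<Longrightarrow> a \<odot>\<^bsub>M\<^esub> x \<in> N"
proof -
  interpret N: Module.submodule N R M by (rule assms)
  show "N \<subseteq> carrier M" "\<zero>\<^bsub>M\<^esub> \<in> N" "x \<in> N \<Longrightarrow> y \<in> N \<Longrightarrow> x \<oplus>\<^bsub>M\<^esub> y \<in> N"
    "a \<in> carrier R \<Longrightarrow> x \<in> N \<Longrightarrow> a \<odot>\<^bsub>M\<^esub> x \<in> N"
    using N.subset N.one_closed N.m_closed N.smult_closed by auto
qed

lemma module_hom_zero:
  assumes "left_module R M" "left_module R N" "h \<in> module_hom R M N"
  shows "h \<zero>\<^bsub>M\<^esub> = \<zero>\<^bsub>N\<^esub>"
proof -
  interpret M: left_module R M by fact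
  interpret N: left_module R N by fact
  have "h (\<zero>\<^bsub>R\<^esub> \<odot>\<^bsub>M\<^esub> \<zero>\<^bsub>M\<^esub>) = \<zero>\<^bsub>R\<^esub> \<odot>\<^bsub>N\<^esub> h \<zero>\<^bsub>M\<^esub>" by (rule module_hom_smult[OF assms(3)]) auto
  moreover have "h \<zero>\<^bsub>M\<^esub> \<in> carrier N" using module_hom_closed[OF assms(3)] by auto
  ultimately show ?thesis by (simp add: M.lsmult_zero N.lsmult_zero)
qed

text \<open>Schur's lemma: kernel and image are submodules.\<close>

lemma simple_module_hom_bij:
  assumes M: "simple_module R M" and N: "simple_module R N" and h: "h \<in> module_hom R M N"
    and nz: "x \<in> carrier M" "h x \<noteq> \<zero>\<^bsub>N\<^esub>"
  shows "bij_betw h (carrier M) (carrier N)"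
proof -
  have lm: "left_module R M" "left_module R N" using M N by (auto simp: simple_module_def)
  interpret M: left_module R M by (rule lm)
  interpret N: left_module R N by (rule lm)
  note hD = module_hom_closed[OF h, THEN funcset_mem] module_hom_add[OF h] module_hom_smult[OF h]
    module_hom_zero[OF lm h]
  have "Module.submodule {y \<in> carrier M. h y = \<zero>\<^bsub>N\<^esub>} R M"
    by (rule M.submoduleI) (auto simp: hD N.lsmult_zero_right M.lsmult_closed)
  then have ker: "{y \<in> carrier M. h y = \<zero>\<^bsub>N\<^esub>} = {\<zero>\<^bsub>M\<^esub>}" using M nz unfolding simple_module_def by blast
  have "Module.submodule (h ` carrier M) R N"
  proof (rule N.submoduleI)
    show "h ` carrier M \<subseteq> carrier N" using hD(1) by auto
    show "\<zero>\<^bsub>N\<^esub> \<in> h ` carrier M" using hD(4) by (metis M.M.zero_closed imageI)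
    show "y \<oplus>\<^bsub>N\<^esub> z \<in> h ` carrier M" if "y \<in> h ` carrier M" "z \<in> h ` carrier M" for y z
      using that by (auto simp flip: hD(2))
    show "a \<odot>\<^bsub>N\<^esub> y \<in> h ` carrier M" if "a \<in> carrier R" "y \<in> h ` carrier M" for a y
      using that by (auto simp: M.lsmult_closed simp flip: hD(3))
  qed
  then have im: "h ` carrier M = carrier N" using N nz unfolding simple_module_def by blast
  have "inj_on h (carrier M)"
  proof (rule inj_onI)
    fix y z assume yz: "y \<in> carrier M" "z \<in> carrier M" "h y = h z"
    have "h (y \<ominus>\<^bsub>M\<^esub> z) \<oplus>\<^bsub>N\<^esub> h z = h z"
      using yz hD(2)[of "y \<ominus>\<^bsub>M\<^esub> z" z] by (simp add: M.M.minus_eq M.M.a_assoc M.M.l_neg)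
    then have "h (y \<ominus>\<^bsub>M\<^esub> z) = \<zero>\<^bsub>N\<^esub>" using yz hD(1) by (simp add: N.M.add.r_cancel_one)
    then have "y \<ominus>\<^bsub>M\<^esub> z \<in> {y \<in> carrier M. h y = \<zero>\<^bsub>N\<^esub>}" using yz by simp
    then show "y = z" using yz unfolding ker by simp
  qed
  with im show ?thesis by (simp add: bij_betw_def)
qed

lemma module_iso_sym:
  assumes "module_iso R M N" "left_module R M"
  shows "module_iso R N M"
proof -
  interpret M: left_module R M by fact
  obtain h where h: "h \<in> module_hom R M N" "bij_betw h (carrier M) (carrier N)"
    using assms(1) by (auto simp: module_iso_def)
  note hD = module_hom_closed[OF h(1), THEN funcset_mem] module_hom_add[OF h(1)] module_hom_smult[OF h(1)]
  let ?g = "inv_into (carrier M) h"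
  have g: "bij_betw ?g (carrier N) (carrier M)" by (rule bij_betw_inv_into[OF h(2)])
  have gc: "?g y \<in> carrier M" "h (?g y) = y" if "y \<in> carrier N" for y
    using that g h(2) by (auto simp: bij_betw_def f_inv_into_f)
  have gh: "?g (h x) = x" if "x \<in> carrier M" for x
    using that h(2) by (auto simp: bij_betw_def)
  have "?g \<in> module_hom R N M"
    unfolding module_hom_def
  proof (intro CollectI conjI allI impI funcsetI)
    fix x y assume "x \<in> carrier N \<and> y \<in> carrier N"
    then have xy: "x \<in> carrier N" "y \<in> carrier N" by auto
    have "h (?g x \<oplus>\<^bsub>M\<^esub> ?g y) = x \<oplus>\<^bsub>N\<^esub> y" using xy by (simp add: hD gc)
    then show "?g (x \<oplus>\<^bsub>N\<^esub> y) = ?g x \<oplus>\<^bsub>M\<^esub> ?g y" using gh[of "?g x \<oplus>\<^bsub>M\<^esub> ?g y"] xy by (simp add: gc)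
  next
    fix a x assume "a \<in> carrier R \<and> x \<in> carrier N"
    then have ax: "a \<in> carrier R" "x \<in> carrier N" by auto
    have "h (a \<odot>\<^bsub>M\<^esub> ?g x) = a \<odot>\<^bsub>N\<^esub> x" using ax by (simp add: hD gc)
    then show "?g (a \<odot>\<^bsub>N\<^esub> x) = a \<odot>\<^bsub>M\<^esub> ?g x"
      using gh[of "a \<odot>\<^bsub>M\<^esub> ?g x"] ax by (simp add: gc M.lsmult_closed)
  qed (simp add: gc)
  with g show ?thesis by (auto simp: module_iso_def)
qed

lemma abelian_group_pullback:
  assumes "abelian_group M"
  shows "abelian_group (pullback h M)"
proof -
  interpret M: abelian_group M by fact
  show ?thesis
  proof (rule abelian_groupI)
    fix x assume "x \<in> carrier (pullback h M)"
    then show "\<exists>y\<in>carrier (pullback h M). y \<oplus>\<^bsub>pullback h M\<^esub> x = \<zero>\<^bsub>pullback h M\<^esub>"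
      by (intro bexI[of _ "\<ominus>\<^bsub>M\<^esub> x"]) (simp_all add: pullback_def M.l_neg)
  qed (simp_all add: pullback_def M.a_ac)
qed

text \<open>Along a surjection the submodules of a pullback are the submodules of the original module.\<close>

lemma simple_module_pullback:
  assumes R': "ring R'" and h: "h \<in> ring_hom R' R" "h ` carrier R' = carrier R"
    and M: "simple_module R M"
  shows "simple_module R' (pullback h M)"
proof -
  interpret M: left_module R M using M by (simp add: simple_module_def)
  interpret R': ring R' by fact
  note hD = ring_hom_closed[OF h(1)] ring_hom_mult[OF h(1)] ring_hom_add[OF h(1)] ring_hom_one[OF h(1)]
  have p: "carrier (pullback h M) = carrier M" "add (pullback h M) = add M"
    "ring.zero (pullback h M) = ring.zero M" "module.smult (pullback h M) = (\<lambda>a x. h a \<odot>\<^bsub>M\<^esub> x)"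
    by (simp_all add: pullback_def)
  have "abelian_group (pullback h M)" by (rule abelian_group_pullback[OF M.M.abelian_group_axioms])
  then have "left_module R' (pullback h M)"
    using R' unfolding left_module_def left_module_axioms_def p
    by (simp add: hD M.lsmult_closed M.lsmult_l_distr M.lsmult_r_distr M.lsmult_assoc M.lsmult_one)
  moreover have "Module.submodule N R M" if "Module.submodule N R' (pullback h M)" for N
  proof (rule M.submoduleI)
    fix a x assume a: "a \<in> carrier R" and x: "x \<in> N"
    obtain b where b: "b \<in> carrier R'" "a = h b" using a h(2) by blast
    show "a \<odot>\<^bsub>M\<^esub> x \<in> N" using submoduleD(4)[OF that b(1) x] by (simp only: p b(2))
  next
    fix x y assume "x \<in> N" "y \<in> N"
    then show "x \<oplus>\<^bsub>M\<^esub> y \<in> N" using submoduleD(3)[OF that, of x y] by (simp only: p)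
  qed (use submoduleD(1,2)[OF that] in \<open>simp_all only: p\<close>)
  ultimately show ?thesis using M unfolding simple_module_def p by blast
qed

text \<open>Elements of a presented algebra are cosets of noncommutative polynomials; \<open>pact\<close> lets the
polynomials themselves act.\<close>

locale presented_module = left_module "presented rels" M
  for rels :: "'g free_alg set" and M :: "('g free_alg set, 'b, 'm) module_scheme"
begin

abbreviation pact :: "'g free_alg \<Rightarrow> 'b \<Rightarrow> 'b" where
  "pact p x \<equiv> cls rels p \<odot>\<^bsub>M\<^esub> x"

lemma pact_closed: "x \<in> carrier M \<Longrightarrow> pact p x \<in> carrier M"
  by (rule lsmult_closed) (simp_all add: presented_simps)

lemma pact_add: "x \<in> carrier M \<Longrightarrow> pact (p + q) x = pact p x \<oplus>\<^bsub>M\<^esub> pact q x"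
  using lsmult_l_distr[of "cls rels p" "cls rels q" x] by (simp add: presented_simps)

lemma pact_mult: "x \<in> carrier M \<Longrightarrow> pact (p * q) x = pact p (pact q x)"
  using lsmult_assoc[of "cls rels p" "cls rels q" x] by (simp add: presented_simps)

lemma pact_1: "x \<in> carrier M \<Longrightarrow> pact 1 x = x"
  using lsmult_one[of x] by (simp add: presented_simps)

lemma pact_distrib:
  "x \<in> carrier M \<Longrightarrow> y \<in> carrier M \<Longrightarrow> pact p (x \<oplus>\<^bsub>M\<^esub> y) = pact p x \<oplus>\<^bsub>M\<^esub> pact p y"
  by (rule lsmult_r_distr) (simp_all add: presented_simps)

lemma pact_zero_right: "pact p \<zero>\<^bsub>M\<^esub> = \<zero>\<^bsub>M\<^esub>"
  by (rule lsmult_zero_right) (simp_all add: presented_simps)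

lemma pact_0: "x \<in> carrier M \<Longrightarrow> pact 0 x = \<zero>\<^bsub>M\<^esub>"
  using pact_add[of x 0 0] pact_closed[of x 0] by (simp add: M.add.r_cancel_one')

lemma pact_relator: "r \<in> rels \<Longrightarrow> x \<in> carrier M \<Longrightarrow> pact r x = \<zero>\<^bsub>M\<^esub>"
proof -
  assume "r \<in> rels" "x \<in> carrier M"
  then have "r - 0 \<in> relators_ideal rels" using relators_subset[of rels] by (simp add: subset_iff)
  then have "cls rels r = cls rels 0" by (rule cls_cong)
  then show "pact r x = \<zero>\<^bsub>M\<^esub>" using \<open>x \<in> carrier M\<close> by (simp only: pact_0)
qed

lemma pact_scal_commute: "x \<in> carrier M \<Longrightarrow> pact (scal c) (pact p x) = pact p (pact (scal c) x)"
  by (simp only: pact_mult[symmetric] scal_commute)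

lemma vectorspace_underlying: "vectorspace ground (underlying_vs rels M)"
proof -
  have "module ground (underlying_vs rels M)"
  proof (rule moduleI)
    show "cring ground" by (rule cring_from_type_algebra)
    show "abelian_group (underlying_vs rels M)"
      unfolding underlying_vs_def by (rule abelian_group_pullback[OF M.abelian_group_axioms])
  qed (simp_all add: underlying_vs_def pullback_def scal_simps(2,3) pact_closed pact_add pact_distrib
      pact_1 pact_mult flip: scal_simps(4))
  then show ?thesis by (simp add: vectorspace_def field_from_type_algebra)
qed

end

lemma single_Nil: "Poly_Mapping.single (Word []) 1 = (1 :: 'g free_alg)"
  by (simp flip: zero_word_def)

lemma single_Cons: "Poly_Mapping.single (Word (g # w)) 1 = gen g * Poly_Mapping.single (Word w) 1"
  by (simp add: gen_def mult_single plus_word_def)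

lemma single_scal: "Poly_Mapping.single w c = scal c * Poly_Mapping.single w 1"
  by (simp add: scal_def mult_single)

text \<open>Commutation with the generators propagates to words, and by additivity to all noncommutative
polynomials.\<close>

lemma module_hom_presentedI:
  fixes rels :: "'g free_alg set"
  assumes M: "left_module (presented rels) M" and N: "left_module (presented rels) N"
    and h: "\<And>x. x \<in> carrier M \<Longrightarrow> h x \<in> carrier N"
    and add: "\<And>x y. x \<in> carrier M \<Longrightarrow> y \<in> carrier M \<Longrightarrow> h (x \<oplus>\<^bsub>M\<^esub> y) = h x \<oplus>\<^bsub>N\<^esub> h y"
    and scal: "\<And>c x. x \<in> carrier M \<Longrightarrow>
      h (cls rels (scal c) \<odot>\<^bsub>M\<^esub> x) = cls rels (scal c) \<odot>\<^bsub>N\<^esub> h x"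
    and gen: "\<And>g x. x \<in> carrier M \<Longrightarrow>
      h (cls rels (gen g) \<odot>\<^bsub>M\<^esub> x) = cls rels (gen g) \<odot>\<^bsub>N\<^esub> h x"
  shows "h \<in> module_hom (presented rels) M N"
proof -
  interpret M: presented_module rels M using M by (simp add: presented_module_def)
  interpret N: presented_module rels N using N by (simp add: presented_module_def)
  have word: "h (M.pact (Poly_Mapping.single (Word w) 1) x) = N.pact (Poly_Mapping.single (Word w) 1) (h x)"
    if "x \<in> carrier M" for w x
    by (induction w) (simp_all add: that single_Nil single_Cons M.pact_1 N.pact_1 h
      M.pact_mult N.pact_mult gen M.pact_closed)
  have "h (M.pact p x) = N.pact p (h x)" if "x \<in> carrier M" for p x
  proof (induction p rule: free_alg_induct)
    case 1
    show ?case using scal[OF that, of 0] by (simp add: scal_simps)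
  next
    case (2 w c)
    show ?case unfolding single_scal[of w c] using that word[OF that, of "letters w"]
      by (simp add: M.pact_mult N.pact_mult h scal M.pact_closed)
  next
    case (3 p q)
    then show ?case using that by (simp add: M.pact_add N.pact_add h add M.pact_closed)
  qed
  then show ?thesis using h add by (auto simp: module_hom_def presented_simps(1))
qed

section \<open>Coordinates\<close>

interpretation fun_space: vector_space "vscale :: ratfun \<Rightarrow> ('b \<Rightarrow> ratfun) \<Rightarrow> 'b \<Rightarrow> ratfun"
  by unfold_locales (auto simp: vscale_def fun_eq_iff algebra_simps)

lemma vadd_eq_plus: "vadd = (+)"
  by (auto simp: vadd_def fun_eq_iff)

lemma zero_fun: "(\<lambda>_. 0) = 0"
  by (simp add: fun_eq_iff)

lemma sum_fun_apply: "sum h A j = (\<Sum>a\<in>A. h a j :: ratfun)"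
  by (induction A rule: infinite_finite_induct) auto

lemma car_expand:
  assumes "finite B" "x \<in> car B"
  shows "x = (\<Sum>b\<in>B. vscale (x b) (bvec B b))"
proof
  fix j
  have "(\<Sum>b\<in>B. vscale (x b) (bvec B b)) j = (\<Sum>b\<in>B. if b = j then x j else 0)"
    unfolding sum_fun_apply by (rule sum.cong) (auto simp: vscale_def bvec_def)
  then show "x j = (\<Sum>b\<in>B. vscale (x b) (bvec B b)) j" using assms by auto
qed

lemma span_bvec:
  assumes "finite B"
  shows "fun_space.span (bvec B ` B) = car B"
proof
  have "fun_space.subspace (car B)"
    by (rule fun_space.subspaceI) (auto simp: vscale_def)
  then show "fun_space.span (bvec B ` B) \<subseteq> car B"
    by (intro fun_space.span_minimal) (auto simp: bvec_def)
  show "car B \<subseteq> fun_space.span (bvec B ` B)"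
  proof
    fix x :: "'a \<Rightarrow> ratfun" assume "x \<in> car B"
    then have "x = (\<Sum>b\<in>B. vscale (x b) (bvec B b))" by (rule car_expand[OF assms])
    also have "\<dots> \<in> fun_space.span (bvec B ` B)"
      by (intro fun_space.span_sum fun_space.span_scale fun_space.span_base) simp
    finally show "x \<in> fun_space.span (bvec B ` B)" .
  qed
qed

text \<open>The form in which two linear maps are compared on basis vectors only.\<close>

lemma car_induct [consumes 2, case_names zero add]:
  assumes "finite B" "x \<in> car B"
    and "P (\<lambda>_. 0)"
    and "\<And>x c b. x \<in> car B \<Longrightarrow> b \<in> B \<Longrightarrow> P x \<Longrightarrow> P (vadd x (vscale c (bvec B b)))"
  shows "P x"
proof -
  have "P (\<Sum>b\<in>A. vscale (x b) (bvec B b)) \<and> (\<Sum>b\<in>A. vscale (x b) (bvec B b)) \<in> car B"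
    if "finite A" "A \<subseteq> B" for A
    using that
  proof (induction A rule: finite_induct)
    case (insert a A)
    let ?y = "\<Sum>b\<in>A. vscale (x b) (bvec B b)"
    have y: "P ?y" "?y \<in> car B" using insert by auto
    have "sum (\<lambda>b. vscale (x b) (bvec B b)) (insert a A) = vadd ?y (vscale (x a) (bvec B a))"
      using insert by (simp add: vadd_eq_plus add.commute)
    moreover have "a \<in> B" using insert by simp
    ultimately show ?case
      using assms(4)[OF y(2) _ y(1), of a "x a"] car_closed(2)[OF y(2) car_closed(3)[OF car_closed(4)]]
      by (simp only: simp_thms)
  qed (use assms(3) in \<open>simp add: zero_fun\<close>)
  from this[OF assms(1) order.refl] show ?thesis using car_expand[OF assms(1,2)] by simp
qed

lemma lin_ext_zero: "lin_ext B t (\<lambda>_. 0) = (\<lambda>_. 0)"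
  by (simp add: lin_ext_def)

lemma lin_ext_bvec:
  assumes "finite B" "b \<in> B"
  shows "lin_ext B t (bvec B b) = t b"
proof
  fix j
  have "lin_ext B t (bvec B b) j = (\<Sum>a\<in>B. if a = b then t b j else 0)"
    unfolding lin_ext_def using assms by (intro sum.cong) (auto simp: bvec_def)
  then show "lin_ext B t (bvec B b) j = t b j" using assms by simp
qed

lemma lin_ext_scalar:
  assumes "finite B" "x \<in> car B"
  shows "lin_ext B (\<lambda>b. vscale c (bvec B b)) x = vscale c x"
proof
  fix j
  have "lin_ext B (\<lambda>b. vscale c (bvec B b)) x j = (\<Sum>b\<in>B. if b = j then c * x j else 0)"
    unfolding lin_ext_def by (rule sum.cong) (auto simp: vscale_def bvec_def)
  then show "lin_ext B (\<lambda>b. vscale c (bvec B b)) x j = vscale c x j"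
    using assms by (auto simp: vscale_def)
qed

lemma (in gen_ops) free_act_diff': "free_act ops (p - q) x = free_act ops p x - free_act ops q x"
  by (simp add: free_act_diff fun_eq_iff)

text \<open>The relators act as zero, and each of them unfolds to one of the identities of \<open>MU_action\<close>.\<close>

lemma MU_action_rep:
  assumes "gen_rep B act MU_rels"
  shows "MU_action vscale (bvec B ` B) (\<lambda>g. lin_ext B (act g))"
proof -
  interpret gen_rep B act MU_rels by fact
  note sp = span_bvec[OF fin]
  have r: "free_act ops p x = free_act ops q x" if "p - q \<in> MU_rels" "x \<in> fun_space.span (bvec B ` B)" for p q x
    using act_rels[OF that(1), of x] that(2) unfolding sp free_act_diff' by (simp add: zero_fun)
  note fa = free_act_add[unfolded vadd_eq_plus] free_act_mult free_act_gen free_act_scal free_act_1 free_act_diff'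
  have mem: "gen (Sl2 K) * gen (Sl2 Kinv) - 1 \<in> MU_rels"
     "gen (Sl2 Kinv) * gen (Sl2 K) - 1 \<in> MU_rels"
     "gen (Sl2 K) * gen (Sl2 E) * gen (Sl2 Kinv) - scal (vv\<^sup>2) * gen (Sl2 E) \<in> MU_rels"
     "gen (Sl2 K) * gen (Sl2 F) * gen (Sl2 Kinv) - scal (inverse vv ^ 2) * gen (Sl2 F) \<in> MU_rels"
     "(gen (Sl2 E) * gen (Sl2 F) - gen (Sl2 F) * gen (Sl2 E)) -
        scal (1 / (vv - inverse vv)) * (gen (Sl2 K) - gen (Sl2 Kinv)) \<in> MU_rels"
     "gen Ell * gen Ell - gen Ell \<in> MU_rels"
     "gen (Sl2 K) * gen Ell - gen Ell * gen (Sl2 K) \<in> MU_rels"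
     "gen Ell * gen (Sl2 E) * gen Ell - gen Ell * gen (Sl2 E) \<in> MU_rels"
     "gen Ell * gen (Sl2 F) * gen Ell - gen (Sl2 F) * gen Ell \<in> MU_rels"
     "scal (qint 2) * (gen (Sl2 E) * gen Ell * gen (Sl2 E)) -
        (scal (inverse vv) * (gen (Sl2 E) * gen (Sl2 E) * gen Ell) + scal vv * (gen Ell * gen (Sl2 E) * gen (Sl2 E)))
        \<in> MU_rels"
     "scal (qint 2) * (gen (Sl2 F) * gen Ell * gen (Sl2 F)) -
        (scal (inverse vv) * (gen Ell * gen (Sl2 F) * gen (Sl2 F)) + scal vv * (gen (Sl2 F) * gen (Sl2 F) * gen Ell))
        \<in> MU_rels"
    by (simp_all only: MU_rels_def sl2_relators_def Let_def Un_iff insert_iff simp_thms)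
  note rr = mem[THEN r, unfolded fa]
  show ?thesis
  proof unfold_locales
    show "finite (bvec B ` B)" using fin by simp
    show "ops g (x + y) = ops g x + ops g y" "ops g (vscale c x) = vscale c (ops g x)" for g x y c
      using ops_add ops_scale by (simp_all add: vadd_eq_plus)
    show "ops g x \<in> fun_space.span (bvec B ` B)" if "x \<in> fun_space.span (bvec B ` B)" for g x
      using free_act_car[of x "gen g"] that unfolding sp free_act_gen .
    fix x assume x: "x \<in> fun_space.span (bvec B ` B)"
    show "ops (Sl2 E) (ops (Sl2 F) x) = ops (Sl2 F) (ops (Sl2 E) x) +
        vscale (1 / (vv - inverse vv)) (ops (Sl2 K) x - ops (Sl2 Kinv) x)"
      using rr(5)[OF x] by (simp add: diff_eq_eq add.commute)
  qed (fact rr)+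
qed

context presented_module
begin

text \<open>An abstract module has an arbitrary carrier and arbitrary operations.  Its coordinate functions with
respect to a finite basis form an isomorphic module whose addition is that of a type class, so that the
calculations in \<open>MU_action\<close> apply to it.\<close>

theorem fin_dim_iso_rep:
  assumes fd: "vectorspace.fin_dim ground (underlying_vs rels M)"
  shows "\<exists>B act h. gen_rep B act rels \<and> h \<in> module_hom (presented rels) (rep_module (B :: 'b set) act) M \<and>
    bij_betw h (car B) (carrier M)"
proof -
  interpret V: vectorspace ground "underlying_vs rels M" by (rule vectorspace_underlying)
  have us: "carrier (underlying_vs rels M) = carrier M" "add (underlying_vs rels M) = add M"
    "ring.zero (underlying_vs rels M) = \<zero>\<^bsub>M\<^esub>"
    "module.smult (underlying_vs rels M) = (\<lambda>c x. pact (scal c) x)"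
    by (simp_all add: underlying_vs_def pullback_def)
  obtain B where B: "finite B" "V.basis B" using V.finite_basis_exists[OF fd] by blast
  have BM: "B \<subseteq> carrier M" using B(2) by (auto simp: V.basis_def us)
  define h where "h x = V.lincomb x B" for x :: "'b \<Rightarrow> ratfun"
  have crit: "\<exists>!a. a \<in> B \<rightarrow>\<^sub>E UNIV \<and> h a = v" if "v \<in> carrier M" for v
    using V.basis_criterion[OF B(1)] B(2) BM that unfolding us ground_simps h_def by blast
  have h_cong: "h x = h y" if "\<And>b. b \<in> B \<Longrightarrow> x b = y b" for x y
    unfolding h_def V.lincomb_def using that BM
    by (intro V.M.finsum_cong2) (auto simp: us B(1) Pi_iff pact_closed)
  have h_closed: "h x \<in> carrier M" for x
    using V.lincomb_closed[of B x] BM by (simp add: h_def us)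
  have h_add: "h (vadd x y) = h x \<oplus>\<^bsub>M\<^esub> h y" for x y
    using V.lincomb_sum[of B x y] B(1) BM by (simp add: h_def us vadd_def)
  have h_scale: "h (vscale c x) = pact (scal c) (h x)" for c x
    using V.lincomb_smult[of B x c] B(1) BM by (simp add: h_def us vscale_def)
  have inj: "inj_on h (car B)"
  proof (rule inj_onI)
    fix x y assume xy: "x \<in> car B" "y \<in> car B" "h x = h y"
    have hr: "h (restrict x B) = h x" "h (restrict y B) = h x"
      using h_cong[of "restrict x B" x] h_cong[of "restrict y B" y] xy(3) by auto
    have "\<exists>a. \<forall>y. y \<in> B \<rightarrow>\<^sub>E UNIV \<and> h y = h x \<longrightarrow> y = a"
      using crit[OF h_closed[of x]] by (rule ex1E) blast
    then obtain a where a: "\<And>y. y \<in> B \<rightarrow>\<^sub>E UNIV \<Longrightarrow> h y = h x \<Longrightarrow> y = a" by blast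
    have "restrict x B = a" "restrict y B = a" by (rule a; simp add: hr)+
    then have "restrict x B b = restrict y B b" for b by simp
    then have "x b = y b" if "b \<in> B" for b using that by (metis restrict_apply')
    moreover have "x b = y b" if "b \<notin> B" for b using that xy by simp
    ultimately show "x = y" by blast
  qed
  have "v \<in> h ` car B" if v: "v \<in> carrier M" for v
  proof -
    obtain a where "h a = v" using ex1_implies_ex[OF crit[OF v]] by blast
    define y where "y = (\<lambda>b. if b \<in> B then a b else 0)"
    have "h y = h a" by (rule h_cong) (simp add: y_def)
    then have "v = h y" using \<open>h a = v\<close> by simp
    moreover have "y \<in> car B" by (simp add: y_def)
    ultimately show ?thesis by (intro image_eqI[of v h y "car B"])
  qed
  then have bij: "bij_betw h (car B) (carrier M)"
    using inj h_closed by (auto simp: bij_betw_def)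
  \<comment> \<open>The matrix columns of the generators, read off through the coordinate map.\<close>
  define act where "act g b = inv_into (car B) h (pact (gen g) (h (bvec B b)))" for g b
  have act: "act g b \<in> car B" "h (act g b) = pact (gen g) (h (bvec B b))" for g b
  proof -
    have "pact (gen g) (h (bvec B b)) \<in> h ` car B"
      using bij h_closed pact_closed by (simp add: bij_betw_def)
    then show "act g b \<in> car B" "h (act g b) = pact (gen g) (h (bvec B b))"
      unfolding act_def by (rule inv_into_into, rule f_inv_into_f)
  qed
  let ?ops = "\<lambda>g. lin_ext B (act g)"
  interpret gen_ops ?ops by (rule gen_ops_lin_ext)
  have h0: "h (\<lambda>_. 0) = \<zero>\<^bsub>M\<^esub>"
    using h_scale[of 0 "\<lambda>_. 0"] h_closed by (simp add: scal_simps pact_0 vscale_def)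
  have ops_car: "?ops g x \<in> car B" for g x
    using act(1) by (simp add: lin_ext_def)
  have hops: "h (?ops g x) = pact (gen g) (h x)" if "x \<in> car B" for g x
    using B(1) that
  proof (induction x rule: car_induct)
    case zero
    then show ?case by (simp add: lin_ext_zero h0 pact_zero_right)
  next
    case (add x c b)
    have "h (?ops g (vadd x (vscale c (bvec B b)))) = h (?ops g x) \<oplus>\<^bsub>M\<^esub> pact (scal c) (h (act g b))"
      using add(2) by (simp only: ops_add ops_scale h_add h_scale lin_ext_bvec[OF B(1)])
    then show ?case
      using h_closed by (simp add: add.IH act(2) h_add h_scale pact_distrib pact_closed pact_scal_commute)
  qed
  have hfree: "h (free_act ?ops p x) = pact p (h x) \<and> free_act ?ops p x \<in> car B" if x: "x \<in> car B" for p x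
  proof (induction p rule: free_alg_induct)
    case 1
    show ?case using x h_closed by (simp add: free_act_0 h0 pact_0)
  next
    case (2 w c)
    have "h (foldr ?ops w x) = pact (Poly_Mapping.single (Word w) 1) (h x) \<and> foldr ?ops w x \<in> car B" for w
    proof (induction w)
      case Nil
      show ?case using x h_closed by (simp add: pact_1 single_Nil)
    next
      case (Cons g w)
      then show ?case using h_closed hops ops_car by (simp del: mem_Collect_eq add: single_Cons pact_mult)
    qed
    from this[of "letters w"]
    have w: "h (foldr ?ops (letters w) x) = pact (Poly_Mapping.single w 1) (h x)"
      "foldr ?ops (letters w) x \<in> car B" by auto
    show ?case using w car_closed(3)[OF w(2)] h_closed[of x]
      by (simp only: single_scal[of w c] free_act_mult free_act_scal pact_mult h_scale
        free_act_single[of w 1] fun_space.scale_one simp_thms)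
  next
    case (3 p q)
    then have "h (free_act ?ops (p + q) x) = pact (p + q) (h x)"
      using h_closed by (simp add: free_act_add h_add pact_add)
    moreover have "free_act ?ops (p + q) x \<in> car B"
      unfolding free_act_add using 3 by (intro car_closed(2)) blast+
    ultimately show ?case ..
  qed
  have rep: "gen_rep B act rels"
  proof
    show "finite B" by fact
    show "act g b \<in> car B" for g b by (rule act)
    fix r x assume r: "r \<in> rels" and x: "x \<in> car B"
    have "h (free_act ?ops r x) = h (\<lambda>_. 0)"
      unfolding h0 hfree[OF x, THEN conjunct1] by (rule pact_relator[OF r h_closed])
    then show "free_act ?ops r x = (\<lambda>_. 0)"
      by (rule inj_onD[OF inj _ hfree[OF x, THEN conjunct2] car_closed(1)])
  qed
  interpret gen_rep B act rels by (rule rep)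
  have "h \<in> module_hom (presented rels) (rep_module B act) M"
    unfolding module_hom_def
  proof (intro CollectI conjI allI impI funcsetI)
    show "h x \<in> carrier M" for x by (rule h_closed)
    show "h (x \<oplus>\<^bsub>rep_module B act\<^esub> y) = h x \<oplus>\<^bsub>M\<^esub> h y" for x y by (simp add: h_add)
    fix a x assume ax: "a \<in> carrier (presented rels) \<and> x \<in> carrier (rep_module B act)"
    then obtain p where p: "a = cls rels p" by (auto simp: presented_simps(1))
    have x: "x \<in> car B" using ax by simp
    show "h (a \<odot>\<^bsub>rep_module B act\<^esub> x) = a \<odot>\<^bsub>M\<^esub> h x"
      unfolding p rep_smult[OF x] using hfree[OF x] by (rule conjunct1)
  qed
  with rep bij show ?thesis by blast
qed

end

section \<open>The relations hold on \<open>L\<^sup>\<plusminus>(n,01)\<close>\<close>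

lemma mem_B01: "(i, \<epsilon>) \<in> B01 n \<longleftrightarrow> (if \<epsilon> then 0 < i \<and> i \<le> n else i < n)"
  by (auto simp: B01_def)

lemma sum_B01: "(\<Sum>b\<in>B01 n. h b) = (\<Sum>i<n. h (i, False)) + (\<Sum>i=1..n. h (i, True))"
proof -
  have "(\<Sum>b\<in>B01 n. h b) = sum h ((\<lambda>i. (i, False)) ` {..<n}) + sum h ((\<lambda>i. (i, True)) ` {1..n})"
    unfolding B01_def by (subst sum.union_disjoint[symmetric]) (auto intro!: sum.cong)
  then show ?thesis by (simp add: sum.reindex inj_on_def)
qed

text \<open>The generators in coordinates.  Values of \<open>x\<close> at indices outside the basis appear at the two ends of the
strings, always with a coefficient \<open>[0] = 0\<close>.\<close>

lemma L01_ops: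
  fixes x :: "nat \<times> bool \<Rightarrow> ratfun"
  shows "lin_ext (B01 n) (L01_act s n (Sl2 E)) x (j, False) = (if j < n then
      sval s * vv * qint (int j + 1) * qint (int n - int j - 1) * x (Suc j, False) +
      sval s * vv powi (int j + 1 - int n) * qint (int j + 1) * x (Suc j, True) else 0)"
    and "lin_ext (B01 n) (L01_act s n (Sl2 E)) x (j, True) = (if 0 < j \<and> j < n then
      sval s * qint (int j + 1) * qint (int n - int j) * x (Suc j, True) else 0)"
    and "lin_ext (B01 n) (L01_act s n (Sl2 F)) x (j, False) =
      (if 0 < j \<and> j < n then x (j - 1, False) else 0)"
    and "lin_ext (B01 n) (L01_act s n (Sl2 F)) x (j, True) = (if 0 < j \<and> j \<le> n then
      vv powi (int j - 1) / qint (int j) * x (j - 1, False) +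
      inverse vv * (qint (int j - 1) / qint (int j)) * x (j - 1, True) else 0)"
    and "lin_ext (B01 n) (L01_act s n (Sl2 K)) x (j, \<epsilon>) = (if (j, \<epsilon>) \<in> B01 n then
      sval s * vv powi (int n - 2 * int j) * x (j, \<epsilon>) else 0)"
    and "lin_ext (B01 n) (L01_act s n (Sl2 Kinv)) x (j, \<epsilon>) = (if (j, \<epsilon>) \<in> B01 n then
      inverse (sval s * vv powi (int n - 2 * int j)) * x (j, \<epsilon>) else 0)"
    and "lin_ext (B01 n) (L01_act s n Ell) x (j, \<epsilon>) = (if \<epsilon> \<and> (j, \<epsilon>) \<in> B01 n then x (j, \<epsilon>) else 0)"
proof -
  note defs = vscale_def vadd_def bvec_def mem_B01
  have "(\<Sum>i<n. x (i, False) * L01_act s n (Sl2 E) (i, False) (j, False)) =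
    (\<Sum>i<n. if i = Suc j then sval s * vv * qint (int j + 1) * qint (int n - int j - 1) * x (Suc j, False) else 0)"
    (is "_ = sum ?h _")
  proof (rule sum.cong)
    fix i show "x (i, False) * L01_act s n (Sl2 E) (i, False) (j, False) = ?h i" if "i \<in> {..<n}"
      using that by (cases i) (auto simp: defs algebra_simps)
  qed simp
  moreover have "(\<Sum>i=1..n. x (i, True) * L01_act s n (Sl2 E) (i, True) (j, False)) =
    (\<Sum>i=1..n. if i = Suc j then sval s * vv powi (int j + 1 - int n) * qint (int j + 1) * x (Suc j, True) else 0)"
    by (rule sum.cong) (auto simp: defs gr0_conv_Suc algebra_simps)
  moreover have "qint (int n - int j - 1) = 0" if "n = Suc j" using that by simp
  ultimately show "lin_ext (B01 n) (L01_act s n (Sl2 E)) x (j, False) = (if j < n then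
      sval s * vv * qint (int j + 1) * qint (int n - int j - 1) * x (Suc j, False) +
      sval s * vv powi (int j + 1 - int n) * qint (int j + 1) * x (Suc j, True) else 0)"
    by (cases "n = Suc j") (auto simp: lin_ext_def sum_B01)
  have "(\<Sum>i<n. x (i, False) * L01_act s n (Sl2 E) (i, False) (j, True)) = 0"
    by (rule sum.neutral) (auto simp: defs)
  moreover have "(\<Sum>i=1..n. x (i, True) * L01_act s n (Sl2 E) (i, True) (j, True)) =
    (\<Sum>i=1..n. if i = Suc j then if 0 < j then sval s * qint (int j + 1) * qint (int n - int j) * x (Suc j, True) else 0 else 0)"
    by (rule sum.cong) (auto simp: defs gr0_conv_Suc algebra_simps)
  ultimately show "lin_ext (B01 n) (L01_act s n (Sl2 E)) x (j, True) = (if 0 < j \<and> j < n then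
      sval s * qint (int j + 1) * qint (int n - int j) * x (Suc j, True) else 0)"
    by (auto simp: lin_ext_def sum_B01)
  have "(\<Sum>i<n. x (i, False) * L01_act s n (Sl2 F) (i, False) (j, False)) =
    (\<Sum>i<n. if i = j - 1 then if 0 < j \<and> j < n then x (i, False) else 0 else 0)"
    by (rule sum.cong) (auto simp: defs)
  moreover have "(\<Sum>i=1..n. x (i, True) * L01_act s n (Sl2 F) (i, True) (j, False)) = 0"
    by (rule sum.neutral) (auto simp: defs)
  ultimately show "lin_ext (B01 n) (L01_act s n (Sl2 F)) x (j, False) =
      (if 0 < j \<and> j < n then x (j - 1, False) else 0)"
    by (auto simp: lin_ext_def sum_B01)
  have "(\<Sum>i<n. x (i, False) * L01_act s n (Sl2 F) (i, False) (j, True)) =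
    (\<Sum>i<n. if i = j - 1 then if 0 < j \<and> j \<le> n then
      vv powi (int j - 1) / qint (int j) * x (j - 1, False) else 0 else 0)"
    by (rule sum.cong) (auto simp: defs gr0_conv_Suc algebra_simps)
  moreover have "(\<Sum>i=1..n. x (i, True) * L01_act s n (Sl2 F) (i, True) (j, True)) =
    (\<Sum>i=1..n. if i = j - 1 then if 0 < j \<and> j \<le> n then
      inverse vv * (qint (int j - 1) / qint (int j)) * x (j - 1, True) else 0 else 0)"
    by (rule sum.cong) (auto simp: defs gr0_conv_Suc algebra_simps)
  ultimately show "lin_ext (B01 n) (L01_act s n (Sl2 F)) x (j, True) = (if 0 < j \<and> j \<le> n then
      vv powi (int j - 1) / qint (int j) * x (j - 1, False) +
      inverse vv * (qint (int j - 1) / qint (int j)) * x (j - 1, True) else 0)"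
    by (cases "j = 1") (auto simp: lin_ext_def sum_B01)
  have diag: "lin_ext (B01 n) t x (j, \<epsilon>) = (if (j, \<epsilon>) \<in> B01 n then c j \<epsilon> * x (j, \<epsilon>) else 0)"
    if "\<And>i \<delta>. t (i, \<delta>) = vscale (c i \<delta>) (bvec (B01 n) (i, \<delta>))" for t c
  proof -
    have "lin_ext (B01 n) t x (j, \<epsilon>) = (\<Sum>b\<in>B01 n. if b = (j, \<epsilon>) then c j \<epsilon> * x (j, \<epsilon>) else 0)"
      unfolding lin_ext_def by (rule sum.cong) (auto simp: that vscale_def bvec_def split: if_splits)
    moreover have "finite (B01 n)" by (simp add: B01_def)
    ultimately show ?thesis by simp
  qed
  show "lin_ext (B01 n) (L01_act s n (Sl2 K)) x (j, \<epsilon>) = (if (j, \<epsilon>) \<in> B01 n then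
      sval s * vv powi (int n - 2 * int j) * x (j, \<epsilon>) else 0)"
    by (rule diag) simp
  show "lin_ext (B01 n) (L01_act s n (Sl2 Kinv)) x (j, \<epsilon>) = (if (j, \<epsilon>) \<in> B01 n then
      inverse (sval s * vv powi (int n - 2 * int j)) * x (j, \<epsilon>) else 0)"
    by (rule diag) simp
  show "lin_ext (B01 n) (L01_act s n Ell) x (j, \<epsilon>) = (if \<epsilon> \<and> (j, \<epsilon>) \<in> B01 n then x (j, \<epsilon>) else 0)"
    by (subst diag[where c = "\<lambda>_ \<epsilon>. of_bool \<epsilon>"]) auto
qed

text \<open>The two \<open>q\<close>-number identities behind \<open>e f - f e\<close> on \<open>m\<^sub>j\<^sub>,\<^sub>0\<close> and \<open>m\<^sub>j\<^sub>,\<^sub>1\<close>; for both, the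
commutator is the same scalar \<open>\<plusminus>[n - 2 j]\<close>.\<close>

lemma qint_identity_False:
  "vv * qint (j + 1) * qint (n - j - 1) + vv powi (j + 1 - n) * vv powi j - vv * qint j * qint (n - j) =
    qint (n - 2 * j)"
  and qint_identity_True:
  "inverse vv * qint j * qint (n - j) - vv powi (j - 1) * vv powi (j - n)
    - inverse vv * qint (j - 1) * qint (n - j + 1) = qint (n - 2 * j)"
proof -
  \<comment> \<open>With these abbreviations both sides are rational functions in independent variables \<open>a, b, c\<close>.\<close>
  define a b c d where "a = vv powi j" and "b = vv powi n" and "c = vv" and "d = vv - inverse vv"
  have nz: "a \<noteq> 0" "b \<noteq> 0" "c \<noteq> 0" "d \<noteq> 0"
    using vv_nz vv_diff_nz by (auto simp: a_def b_def c_def d_def)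
  have a2: "vv powi (2 * j) = a * a" using vv_nz power_int_add[of vv j j] by (simp add: a_def)
  have p: "vv powi (j + 1) = a * c" "vv powi (n - j - 1) = b / (a * c)" "vv powi (j + 1 - n) = a * c / b"
     "vv powi (n - j) = b / a" "vv powi (n - 2 * j) = b / (a * a)" "vv powi (j - 1) = a / c"
     "vv powi (j - n) = a / b" "vv powi (n - j + 1) = b * c / a"
    using vv_nz a2 by (auto simp: a_def b_def c_def power_int_diff power_int_add)
  have q: "qint (j + 1) = (a * c - 1 / (a * c)) / d" "qint (n - j - 1) = (b / (a * c) - a * c / b) / d"
    "qint (n - j) = (b / a - a / b) / d" "qint (n - 2 * j) = (b / (a * a) - a * a / b) / d"
    "qint (j - 1) = (a / c - c / a) / d" "qint (n - j + 1) = (b * c / a - a / (b * c)) / d"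
    "qint j = (a - 1 / a) / d"
    unfolding qint_def power_int_minus p d_def[symmetric]
    by (simp_all add: a_def inverse_eq_divide)
  have d: "d = c - 1 / c" by (simp add: d_def c_def inverse_eq_divide)
  have clear: "u * (p / d) * (q / d) + y - u * (r / d) * (t / d) = w / d"
    if "u * (p * q) + d * d * y - u * (r * t) = d * w" for u p q r t w y
  proof -
    have "u * (p / d) * (q / d) + y - u * (r / d) * (t / d) = (u * (p * q) + d * d * y - u * (r * t)) / (d * d)"
      using nz(4) by (simp add: field_simps)
    then show ?thesis using nz(4) by (simp add: that)
  qed
  have 1: "c * ((a * c - 1 / (a * c)) * (b / (a * c) - a * c / b)) + d * d * (a * c / b * a) -
      c * ((a - 1 / a) * (b / a - a / b)) = d * (b / (a * a) - a * a / b)"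
    unfolding d using nz(1-3) by (simp add: divide_simps) (simp add: algebra_simps)
  have 2: "1 / c * ((a - 1 / a) * (b / a - a / b)) + d * d * (- (a / c * (a / b))) -
      1 / c * ((a / c - c / a) * (b * c / a - a / (b * c))) = d * (b / (a * a) - a * a / b)"
    unfolding d using nz(1-3) by (simp add: divide_simps) (simp add: algebra_simps)
  show "vv * qint (j + 1) * qint (n - j - 1) + vv powi (j + 1 - n) * vv powi j - vv * qint j * qint (n - j) =
    qint (n - 2 * j)"
    unfolding q p unfolding a_def[symmetric] unfolding c_def[symmetric] by (rule clear[OF 1])
  show "inverse vv * qint j * qint (n - j) - vv powi (j - 1) * vv powi (j - n)
    - inverse vv * qint (j - 1) * qint (n - j + 1) = qint (n - 2 * j)"
    unfolding q p unfolding a_def[symmetric] unfolding c_def[symmetric] inverse_eq_divide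
    using clear[OF 2] by simp
qed


text \<open>Every relator is evaluated at every coordinate.  Only the commutator of \<open>e\<close> and \<open>f\<close> and the two
Serre type relations need more than a comparison of weights.\<close>

lemma L01_rep: "gen_rep (B01 n) (L01_act s n) MU_rels"
proof
  show "finite (B01 n)" by (simp add: B01_def)
  show "L01_act s n g b \<in> car (B01 n)" for g b
    by (induction s n g b rule: L01_act.induct) (auto simp: vscale_def vadd_def bvec_def)
  fix r :: "mu_gen free_alg" and x :: "nat \<times> bool \<Rightarrow> ratfun"
  assume r: "r \<in> MU_rels" and x: "x \<in> car (B01 n)"
  let ?ops = "\<lambda>g. lin_ext (B01 n) (L01_act s n g)"
  interpret gen_ops ?ops by (rule gen_ops_lin_ext)
  define W where "W j = sval s * vv powi (int n - 2 * int j)" for j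
  have W: "W j \<noteq> 0" "W j = vv\<^sup>2 * W (Suc j)" for j
    using vv_nz power_int_add[of vv 2 "int n - 2 * int (Suc j)"]
    by (simp_all add: W_def algebra_simps)
  have Winv: "inverse (W j) = sval s * vv powi - (int n - 2 * int j)" for j
    unfolding W_def inverse_mult_distrib sval_inverse power_int_minus ..
  note ops = free_act_simps vscale_def vadd_def L01_ops[of n s, folded W_def] mem_B01
  have x0: "x (j, \<epsilon>) = 0" if "(j, \<epsilon>) \<notin> B01 n" for j \<epsilon> using x that by blast
  have q: "qint (int j + 1) \<noteq> 0" "qint (int j + 2) \<noteq> 0" for j using qint_nz by simp_all
  have s: "sval s * sval s = 1" by (cases s) auto
  have "free_act ?ops r x (j, \<epsilon>) = 0" for j \<epsilon>
  proof -
    from r consider "r = gen (Sl2 K) * gen (Sl2 Kinv) - 1" | "r = gen (Sl2 Kinv) * gen (Sl2 K) - 1"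
      | "r = gen (Sl2 K) * gen (Sl2 E) * gen (Sl2 Kinv) - scal (vv\<^sup>2) * gen (Sl2 E)"
      | "r = gen (Sl2 K) * gen (Sl2 F) * gen (Sl2 Kinv) - scal (inverse vv ^ 2) * gen (Sl2 F)"
      | "r = (gen (Sl2 E) * gen (Sl2 F) - gen (Sl2 F) * gen (Sl2 E)) -
          scal (1 / (vv - inverse vv)) * (gen (Sl2 K) - gen (Sl2 Kinv))"
      | "r = gen Ell * gen Ell - gen Ell"
      | "r = gen (Sl2 K) * gen Ell - gen Ell * gen (Sl2 K)"
      | "r = gen Ell * gen (Sl2 E) * gen Ell - gen Ell * gen (Sl2 E)"
      | "r = gen Ell * gen (Sl2 F) * gen Ell - gen (Sl2 F) * gen Ell"
      | "r = scal (qint 2) * (gen (Sl2 E) * gen Ell * gen (Sl2 E)) -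
        (scal (inverse vv) * (gen (Sl2 E) * gen (Sl2 E) * gen Ell) + scal vv * (gen Ell * gen (Sl2 E) * gen (Sl2 E)))"
      | "r = scal (qint 2) * (gen (Sl2 F) * gen Ell * gen (Sl2 F)) -
        (scal (inverse vv) * (gen Ell * gen (Sl2 F) * gen (Sl2 F)) + scal vv * (gen (Sl2 F) * gen (Sl2 F) * gen Ell))"
      unfolding MU_rels_def sl2_relators_def Let_def by blast
    then show ?thesis
    proof cases
      case 1
      show ?thesis unfolding 1 ops using x0[of j \<epsilon>] W(1)[of j] by (auto simp: mem_B01)
    next
      case 2
      show ?thesis unfolding 2 ops using x0[of j \<epsilon>] W(1)[of j] by (auto simp: mem_B01)
    next
      case 3
      have w: "W j * (c * (inverse (W (Suc j)) * y)) = vv\<^sup>2 * (c * y)" for c y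
        unfolding W(2)[of j] using W(1)[of "Suc j"] by simp
      have w0: "W j * inverse (W (Suc j)) = vv\<^sup>2"
        using w[of 1 1] by simp
      have n: "qint (int n - int j - 1) = 0" if "j < n" "\<not> Suc j < n"
      proof -
        have "n = Suc j" using that by simp
        then show ?thesis by simp
      qed
      show ?thesis
      proof (cases "\<epsilon> = False")
        case eps: True
        show ?thesis unfolding 3 eps by (auto simp: ops n w w0 distrib_left)
      next
        case False
        then have eps: "\<epsilon> = True" by simp
        show ?thesis unfolding 3 eps by (auto simp: ops w)
      qed
    next
      case 4
      show ?thesis
      proof (cases j)
        case 0
        then show ?thesis by (cases \<epsilon>) (auto simp: 4 ops)
      next
        case (Suc i)
        have w: "W (Suc i) * (c * (inverse (W i) * y)) = inverse vv ^ 2 * (c * y)" for c y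
          unfolding W(2)[of i] using W(1)[of "Suc i"] vv_nz by (simp add: power_inverse)
        have w1: "W (Suc i) * (inverse (W i) * y) = inverse vv ^ 2 * y" for y
          using w[of 1] by simp
        have w0: "W (Suc i) * inverse (W i) = inverse vv ^ 2" using w[of 1 1] by simp
        show ?thesis
        proof (cases "\<epsilon> = False")
          case eps: True
          show ?thesis unfolding 4 eps Suc by (auto simp: ops w1)
        next
          case False
          then have eps: "\<epsilon> = True" by simp
          show ?thesis unfolding 4 eps Suc by (cases "i = 0") (use w0 in \<open>auto simp: ops w w1 distrib_left\<close>)
        qed
      qed
    next
      case 5
      have wt: "(1 / (vv - inverse vv)) * (W j * y - inverse (W j) * y) = sval s * qint (int n - 2 * int j) * y" for y
        unfolding Winv unfolding W_def qint_def by (simp add: algebra_simps diff_divide_distrib)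
      show ?thesis
      proof (cases \<epsilon>)
        case False
        show ?thesis
        proof (cases "j < n")
          case True
          have EF: "?ops (Sl2 E) (?ops (Sl2 F) x) (j, False) = sval s *
            ((vv * qint (int j + 1) * qint (int n - int j - 1) + vv powi (int j + 1 - int n) * vv powi int j) * x (j, False) +
              vv powi (int j + 1 - int n) * inverse vv * qint (int j) * x (j, True))"
            using True q(1)[of j] by (cases "n = Suc j") (auto simp: L01_ops algebra_simps)
          have FE: "?ops (Sl2 F) (?ops (Sl2 E) x) (j, False) = sval s *
            (vv * qint (int j) * qint (int n - int j) * x (j, False) +
              vv powi (int j - int n) * qint (int j) * x (j, True))"
            using True by (cases j) (auto simp: L01_ops algebra_simps)
          have v: "vv powi (int j + 1 - int n) * inverse vv = vv powi (int j - int n)"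
            using vv_nz by (simp add: power_int_add power_int_diff)
          have KK: "?ops (Sl2 K) x (j, False) = W j * x (j, False)" 
            "?ops (Sl2 Kinv) x (j, False) = inverse (W j) * x (j, False)"
            using True by (simp_all add: L01_ops[of n s, folded W_def] mem_B01)
          have "free_act ?ops r x (j, False) = sval s * x (j, False) *
            ((vv * qint (int j + 1) * qint (int n - int j - 1) + vv powi (int j + 1 - int n) * vv powi int j -
              vv * qint (int j) * qint (int n - int j)) - qint (int n - 2 * int j))"
            unfolding 5 free_act_simps vscale_def EF FE KK wt v by (simp only: ring_distribs mult_ac) simp
          then show ?thesis unfolding qint_identity_False using False by simp
        qed (auto simp: 5 ops False)
      next
        case True
        show ?thesis
        proof (cases "0 < j \<and> j \<le> n")
          case j: True
          have "\<epsilon>" by fact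
          from j obtain i where i: "j = Suc i" by (cases j) auto
          have EF: "?ops (Sl2 E) (?ops (Sl2 F) x) (j, True) = sval s *
            (qint (int n - int j) * vv powi int j * x (j, False) +
              inverse vv * qint (int j) * qint (int n - int j) * x (j, True))"
            using j q(1)[of j] by (cases "n = j") (auto simp: L01_ops algebra_simps)
          have FE: "?ops (Sl2 F) (?ops (Sl2 E) x) (j, True) = sval s *
            (vv powi (int j - 1) * vv * qint (int n - int j) * x (j, False) +
              (vv powi (int j - 1) * vv powi (int j - int n)
                + inverse vv * qint (int j - 1) * qint (int n - int j + 1)) * x (j, True))"
            using j q(1)[of i] by (cases "i = 0") (auto simp: L01_ops i algebra_simps)
          have v: "vv powi (int j - 1) * vv = vv powi int j"
            using vv_nz by (simp add: power_int_diff)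
          have KK: "?ops (Sl2 K) x (j, True) = W j * x (j, True)" 
            "?ops (Sl2 Kinv) x (j, True) = inverse (W j) * x (j, True)"
            using j by (simp_all add: L01_ops[of n s, folded W_def] mem_B01)
          have "free_act ?ops r x (j, True) = sval s * x (j, True) *
            ((inverse vv * qint (int j) * qint (int n - int j) - vv powi (int j - 1) * vv powi (int j - int n)
              - inverse vv * qint (int j - 1) * qint (int n - int j + 1)) - qint (int n - 2 * int j))"
            unfolding 5 free_act_simps vscale_def EF FE KK wt v by (simp only: ring_distribs mult_ac) simp
          then show ?thesis unfolding qint_identity_True using \<open>\<epsilon>\<close> by simp
        qed (auto simp: 5 ops True)
      qed
    next
      case 6
      show ?thesis unfolding 6 ops by simp
    next
      case 7
      show ?thesis unfolding 7 ops by simp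
    next
      case 8
      show ?thesis unfolding 8 by (cases \<epsilon>) (auto simp: ops)
    next
      case 9
      show ?thesis unfolding 9 by (cases \<epsilon>) (auto simp: ops)
    next
      case 10
      show ?thesis
      proof (cases "\<epsilon> = False")
        case eps: True
        define u where "u = vv powi (int j + 1 - int n)"
        have u: "vv powi (1 + int j - int n) = u" "vv powi (int j + 2 - int n) = vv * u"
          using vv_nz power_int_add[of vv 1 "int j + 1 - int n"] by (simp_all add: u_def algebra_simps)
        show ?thesis unfolding 10 eps
          using vv_nz s by (auto simp: ops qint_2 algebra_simps u)
      next
        case False
        then have eps: "\<epsilon> = True" by simp
        show ?thesis unfolding 10 eps by (auto simp: ops qint_2 algebra_simps)
      qed
    next
      case 11
      show ?thesis
      proof (cases "\<epsilon> \<and> j \<ge> 2")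
        case False
        then show ?thesis unfolding 11 by (cases \<epsilon>; cases j) (auto simp: ops)
      next
        case True
        then obtain i where i: "j = Suc (Suc i)" by (cases j; cases "j - 1") auto
        have v: "vv powi (1 + int i) = vv * vv ^ i"
          using vv_nz by (simp add: power_int_add)
        show ?thesis using True q[of i] vv_nz unfolding 11 i
          by (auto simp: ops qint_2 v field_simps)
      qed
    qed
  qed
  then show "free_act ?ops r x = (\<lambda>_. 0)" by (auto simp: fun_eq_iff)
qed

section \<open>Simplicity of the models\<close>

lemma (in gen_ops) free_act_stable:
  assumes "(\<lambda>_. 0) \<in> N" "\<And>x y. x \<in> N \<Longrightarrow> y \<in> N \<Longrightarrow> vadd x y \<in> N" "\<And>c x. x \<in> N \<Longrightarrow> vscale c x \<in> N"
    and ops: "\<And>g x. x \<in> N \<Longrightarrow> ops g x \<in> N" and x: "x \<in> N"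
  shows "free_act ops p x \<in> N"
proof (induction p rule: free_alg_induct)
  case (2 w c)
  have "foldr ops u x \<in> N" for u using x by (induction u) (simp_all add: ops)
  then show ?case by (simp add: free_act_single assms(3))
qed (simp_all add: free_act_0 free_act_add assms)

lemma (in gen_rep) submodule_repD:
  assumes N: "Module.submodule N (presented rels) (rep_module B act)"
  shows "N \<subseteq> car B" "(\<lambda>_. 0) \<in> N" "x \<in> N \<Longrightarrow> y \<in> N \<Longrightarrow> vadd x y \<in> N"
    "x \<in> N \<Longrightarrow> vscale c x \<in> N" "x \<in> N \<Longrightarrow> ops g x \<in> N"
proof -
  show sub: "N \<subseteq> car B" "(\<lambda>_. 0) \<in> N" "x \<in> N \<Longrightarrow> y \<in> N \<Longrightarrow> vadd x y \<in> N"
    using submoduleD(1,2,3)[OF N] by simp_all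
  have act: "free_act ops p x \<in> N" if "x \<in> N" for p
    using submoduleD(4)[OF N _ that, of "cls rels p"] rep_smult[of x p] that sub(1)
    by (simp add: presented_simps(1) subset_iff)
  show "x \<in> N \<Longrightarrow> vscale c x \<in> N" using act[of "scal c"] by (simp add: free_act_scal)
  show "x \<in> N \<Longrightarrow> ops g x \<in> N" using act[of "gen g"] by (simp add: free_act_gen)
qed

text \<open>From a nonzero vector of a submodule one first gets a nonzero vector \<open>y\<close> in the span of the
\<open>m\<^sub>i\<^sub>,\<^sub>0\<close>: if a component \<open>m\<^sub>i\<^sub>,\<^sub>1\<close> occurs, \<open>e\<close> maps it to a vector with a component
\<open>m\<^sub>i\<^sub>-\<^sub>1\<^sub>,\<^sub>0\<close>.  Applying \<open>e\<close> repeatedly to \<open>y\<close> gives \<open>m\<^sub>0\<^sub>,\<^sub>0\<close>, from which \<open>f\<close> and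
\<open>l\<close> produce all basis vectors.\<close>

theorem L01_simple:
  assumes n: "n \<ge> 1"
  shows "simple_module MU (L01 s n)"
proof -
  interpret gen_rep "B01 n" "L01_act s n" MU_rels by (rule L01_rep)
  have "N = {\<lambda>_. 0} \<or> N = car (B01 n)" if N: "Module.submodule N MU (rep_module (B01 n) (L01_act s n))" for N
  proof (cases "N = {\<lambda>_. 0}")
    case False
    note ND = submodule_repD[OF N]
    let ?b = "bvec (B01 n)"
    obtain x where x: "x \<in> N" "x \<noteq> (\<lambda>_. 0)" using False ND(2) by blast
    have low: "?b (0, False) \<in> N"
      if "y \<in> N" "\<forall>j. y (j, True) = 0" "y (m, False) \<noteq> 0" "\<forall>j>m. y (j, False) = 0" "m < n" for y m
      using that
    proof (induction m arbitrary: y)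
      case 0
      have "y (i, \<epsilon>) = 0" if "(i, \<epsilon>) \<noteq> (0, False)" for i \<epsilon>
        using that 0(2,4) by (cases \<epsilon>; cases i) auto
      then have "vscale (1 / y (0, False)) y = ?b (0, False)"
        using 0(3,5) by (auto simp: vscale_def bvec_def mem_B01 fun_eq_iff)
      with ND(4)[OF 0(1)] show ?case by metis
    next
      case (Suc m)
      have "int n - int m - 1 \<noteq> 0" using Suc.prems(5) by simp
      then have "ops (Sl2 E) y (m, False) \<noteq> 0"
        using Suc.prems qint_nz[of "int m + 1"] qint_nz[of "int n - int m - 1"] vv_nz
        by (simp add: L01_ops)
      moreover have "\<forall>j>m. ops (Sl2 E) y (j, False) = 0" "\<forall>j. ops (Sl2 E) y (j, True) = 0"
        using Suc.prems by (simp_all add: L01_ops)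
      ultimately show ?case using Suc.IH[OF ND(5)[OF Suc.prems(1)]] Suc.prems(5) by simp
    qed
    have "\<exists>y\<in>N. y \<noteq> (\<lambda>_. 0) \<and> (\<forall>j. y (j, True) = 0)"
    proof (cases "\<forall>j. x (j, True) = 0")
      case False
      then obtain m where m: "x (m, True) \<noteq> 0" by blast
      have "(m, True) \<in> B01 n" using m x(1) ND(1) by blast
      then have "m \<noteq> 0" "m \<le> n" by (auto simp: mem_B01)
      then obtain i where i: "m = Suc i" "i < n" by (cases m) auto
      define z where "z = ops (Sl2 E) (ops Ell x)"
      define y where "y = vadd z (vscale (- 1) (ops Ell z))"
      have "y \<in> N" unfolding y_def z_def by (intro ND(3-5) x(1))
      moreover have "y (j, True) = 0" for j
        by (simp add: y_def z_def vadd_def vscale_def L01_ops mem_B01)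
      moreover have "y (i, False) \<noteq> 0"
        using m i qint_nz[of "int i + 1"] vv_nz
        by (simp add: y_def z_def vadd_def vscale_def L01_ops mem_B01)
      then have "y \<noteq> (\<lambda>_. 0)" by auto
      ultimately show ?thesis by blast
    qed (use x in blast)
    then obtain y where y: "y \<in> N" "y \<noteq> (\<lambda>_. 0)" "\<forall>j. y (j, True) = 0" by blast
    define A where "A = {j. y (j, False) \<noteq> 0}"
    have An: "A \<subseteq> {..<n}" using y(1) ND(1) by (force simp: A_def mem_B01)
    then have A: "finite A" by (rule finite_subset) simp
    have "A \<noteq> {}"
    proof
      assume "A = {}"
      then have "y (j, \<epsilon>) = 0" for j \<epsilon> using y(3) by (cases \<epsilon>) (auto simp: A_def)
      then show False using y(2) by (auto simp: fun_eq_iff)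
    qed
    then have max: "Max A \<in> A" "\<And>j. j \<in> A \<Longrightarrow> j \<le> Max A" using A by simp_all
    have b0: "?b (0, False) \<in> N"
    proof (rule low[OF y(1,3)])
      show "y (Max A, False) \<noteq> 0" "Max A < n" using max(1) An by (auto simp: A_def)
      show "\<forall>j>Max A. y (j, False) = 0"
      proof (intro allI impI)
        fix j assume "Max A < j"
        then have "j \<notin> A" using max(2)[of j] by linarith
        then show "y (j, False) = 0" by (simp add: A_def)
      qed
    qed
    have step: "?b (Suc j, \<epsilon>) \<in> N" if j: "?b (j, False) \<in> N" "j < n" for j \<epsilon>
    proof -
      define c where "c = vv ^ j / qint (int j + 1)"
      have c: "c \<noteq> 0" using qint_nz[of "int j + 1"] vv_nz by (simp add: c_def)
      have Fb: "ops (Sl2 F) (?b (j, False)) = vadd (?b (Suc j, False)) (vscale c (?b (Suc j, True)))"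
        using j(2) lin_ext_bvec[OF fin, of "(j, False)" "L01_act s n (Sl2 F)"] by (simp add: mem_B01 c_def)
      have lb: "ops Ell (?b (i, \<delta>)) = vscale (of_bool \<delta>) (?b (i, \<delta>))" for i \<delta>
        by (auto simp: L01_ops bvec_def vscale_def fun_eq_iff mem_B01)
      have "vscale (1 / c) (ops Ell (ops (Sl2 F) (?b (j, False)))) = ?b (Suc j, True)"
        unfolding Fb ops_add ops_scale lb using c by (simp add: vscale_def vadd_def fun_eq_iff)
      moreover have "vscale (1 / c) (ops Ell (ops (Sl2 F) (?b (j, False)))) \<in> N"
        by (intro ND(4,5) j)
      ultimately have T: "?b (Suc j, True) \<in> N" by simp
      have "vadd (ops (Sl2 F) (?b (j, False))) (vscale (- c) (?b (Suc j, True))) = ?b (Suc j, False)"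
        unfolding Fb by (simp add: vscale_def vadd_def fun_eq_iff)
      moreover have "vadd (ops (Sl2 F) (?b (j, False))) (vscale (- c) (?b (Suc j, True))) \<in> N"
        by (intro ND(3-5) j T)
      ultimately have "?b (Suc j, False) \<in> N" by simp
      with T show ?thesis by (cases \<epsilon>) auto
    qed
    have F: "?b (j, False) \<in> N" if "j < n" for j
      using that by (induction j) (auto intro: b0 step)
    have B: "?b b \<in> N" if "b \<in> B01 n" for b
    proof (cases b)
      case (Pair j \<epsilon>)
      with that F step[OF F, of "j - 1" \<epsilon>] show ?thesis by (cases \<epsilon>; cases j) (auto simp: mem_B01)
    qed
    have "y \<in> N" if "y \<in> car (B01 n)" for y
      using fin that by (induction y rule: car_induct) (simp_all add: ND(2-4) B)
    then show ?thesis using ND(1) by blast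
  qed simp
  moreover have "bvec (B01 n) (0, False) \<in> car (B01 n)" "bvec (B01 n) (0, False) \<noteq> (\<lambda>_. 0)"
    using n by (auto simp: bvec_def fun_eq_iff mem_B01)
  ultimately show ?thesis
    using left_module_rep unfolding simple_module_def L01_def rep_module_simps by blast
qed

lemma L01_fd_simple: "n \<ge> 1 \<Longrightarrow> fd_simple MU_rels (L01 s n)"
  using L01_simple gen_rep.fin_dim_rep[OF L01_rep] by (simp add: fd_simple_def L01_def)

lemma L_eps_simple: "simple_module MU (L_eps s n \<epsilon>)"
  unfolding L_eps_def
  by (rule simple_module_pullback[OF presented_ring proj_ring_hom proj_surj L_simple])

lemma L_eps_fd_simple: "fd_simple MU_rels (L_eps s n \<epsilon>)"
proof -
  have "underlying_vs MU_rels (L_eps s n \<epsilon>) = underlying_vs U_rels (L s n)"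
    by (simp add: underlying_vs_def L_eps_def pullback_def proj_generators)
  then show ?thesis using L_eps_simple L_dim(2) by (simp add: fd_simple_def)
qed

lemma L_eps_simps [simp]:
  "carrier (L_eps s n \<epsilon>) = car {..n}" "ring.zero (L_eps s n \<epsilon>) = (\<lambda>_. 0)" "add (L_eps s n \<epsilon>) = vadd"
  by (simp_all add: L_eps_def pullback_def L_def)

lemma L01_simps [simp]:
  "carrier (L01 s n) = car (B01 n)" "ring.zero (L01 s n) = (\<lambda>_. 0)" "add (L01 s n) = vadd"
  by (simp_all add: L01_def)

text \<open>The action of the generators on \<open>L\<^sup>\<plusminus>(n,\<epsilon>)\<close>, which is given as a pullback, in coordinates.\<close>

fun L_eps_act :: "sign \<Rightarrow> nat \<Rightarrow> bool \<Rightarrow> mu_gen \<Rightarrow> nat \<Rightarrow> nat \<Rightarrow> ratfun" where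
  "L_eps_act s n \<epsilon> (Sl2 g) i = L_act s n g i"
| "L_eps_act s n \<epsilon> Ell i = vscale (of_bool \<epsilon>) (bvec {..n} i)"

lemma L_eps_smult:
  assumes "x \<in> car {..n}"
  shows "cls MU_rels (scal c) \<odot>\<^bsub>L_eps s n \<epsilon>\<^esub> x = vscale c x"
    and "cls MU_rels (gen g) \<odot>\<^bsub>L_eps s n \<epsilon>\<^esub> x = lin_ext {..n} (L_eps_act s n \<epsilon> g) x"
proof -
  interpret gen_rep "{..n}" "L_act s n" U_rels by (rule L_rep)
  have *: "cls MU_rels p \<odot>\<^bsub>L_eps s n \<epsilon>\<^esub> x = free_act ops (subst (proj_gen \<epsilon>) p) x" for p
    using rep_smult[OF assms] by (simp add: L_eps_def pullback_def proj_cls L_def)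
  show "cls MU_rels (scal c) \<odot>\<^bsub>L_eps s n \<epsilon>\<^esub> x = vscale c x"
    unfolding * by (simp add: free_act_scal)
  show "cls MU_rels (gen g) \<odot>\<^bsub>L_eps s n \<epsilon>\<^esub> x = lin_ext {..n} (L_eps_act s n \<epsilon> g) x"
  proof (cases g)
    case (Sl2 h)
    then show ?thesis unfolding * by (simp add: free_act_gen lin_ext_def)
  next
    case Ell
    have "L_eps_act s n \<epsilon> Ell = (\<lambda>i. vscale (of_bool \<epsilon>) (bvec {..n} i))" by (rule ext) simp
    then have "lin_ext {..n} (L_eps_act s n \<epsilon> Ell) x = vscale (of_bool \<epsilon>) x"
      by (simp only: lin_ext_scalar[OF finite_atMost assms])
    moreover have "free_act ops (of_bool \<epsilon>) x = vscale (of_bool \<epsilon>) x"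
      by (cases \<epsilon>) (simp_all add: free_act_1 free_act_0 vscale_def)
    ultimately show ?thesis unfolding * Ell by simp
  qed
qed

lemma L01_smult:
  assumes "x \<in> car (B01 n)"
  shows "cls MU_rels (scal c) \<odot>\<^bsub>L01 s n\<^esub> x = vscale c x"
    and "cls MU_rels (gen g) \<odot>\<^bsub>L01 s n\<^esub> x = lin_ext (B01 n) (L01_act s n g) x"
proof -
  interpret gen_rep "B01 n" "L01_act s n" MU_rels by (rule L01_rep)
  show "cls MU_rels (scal c) \<odot>\<^bsub>L01 s n\<^esub> x = vscale c x"
    and "cls MU_rels (gen g) \<odot>\<^bsub>L01 s n\<^esub> x = lin_ext (B01 n) (L01_act s n g) x"
    unfolding L01_def rep_smult[OF assms] free_act_scal free_act_gen by simp_all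
qed

section \<open>Homomorphisms from the models\<close>

text \<open>A linear map \<open>H\<close> out of a module with basis \<open>D\<close> is a homomorphism if on every basis vector it commutes
with every generator.  \<open>M\<close> is described by its operations only, because \<open>L_eps\<close> is a pullback and not
literally a \<open>rep_module\<close>.\<close>

lemma hom_from_basis:
  fixes M :: "('g free_alg set, 'b \<Rightarrow> ratfun, 'm) module_scheme" and w :: "'b \<Rightarrow> 'c \<Rightarrow> ratfun"
  assumes D: "finite D" and M: "left_module (presented rels) M" "carrier M = car D" "add M = vadd"
    and M_scal: "\<And>c y. y \<in> car D \<Longrightarrow> cls rels (scal c) \<odot>\<^bsub>M\<^esub> y = vscale c y"
    and M_gen: "\<And>g y. y \<in> car D \<Longrightarrow> cls rels (gen g) \<odot>\<^bsub>M\<^esub> y = lin_ext D (tact g) y"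
    and tact: "\<And>g b. b \<in> D \<Longrightarrow> tact g b \<in> car D"
    and N: "gen_rep B act rels"
    and w: "\<And>b. b \<in> D \<Longrightarrow> w b \<in> car B"
    and H_def: "H = (\<lambda>y. \<Sum>b\<in>D. vscale (y b) (w b))"
    and comm: "\<And>g b. b \<in> D \<Longrightarrow> H (tact g b) = lin_ext B (act g) (w b)"
  shows "H \<in> module_hom (presented rels) M (rep_module B act)"
proof -
  interpret gen_rep B act rels by (rule N)
  have H_add: "H (vadd x y) = vadd (H x) (H y)" for x y
    by (simp add: H_def vadd_eq_plus sum.distrib fun_space.scale_left_distrib)
  have H_scale: "H (vscale c x) = vscale c (H x)" for c x
    unfolding H_def fun_space.scale_sum_right by (simp add: vscale_def mult.assoc)
  have H_car: "H y \<in> car B" for y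
    using w by (auto simp: H_def sum_fun_apply vscale_def)
  have H0: "H (\<lambda>_. 0) = (\<lambda>_. 0)" using H_scale[of 0 "\<lambda>_. 0"] by (simp add: vscale_def)
  have H_bvec: "H (bvec D b) = w b" if "b \<in> D" for b
  proof -
    have "H (bvec D b) = (\<Sum>a\<in>D. if a = b then w b else 0)"
      unfolding H_def using that by (intro sum.cong) (auto simp: bvec_def)
    then show ?thesis using D that by simp
  qed
  have H_gen: "H (lin_ext D (tact g) y) = ops g (H y)" if "y \<in> car D" for g y
    using D that
  proof (induction y rule: car_induct)
    case zero
    then show ?case by (simp add: lin_ext_zero H0)
  next
    case (add x c b)
    show ?case
      by (simp only: lin_ext_linear H_add H_scale add.IH lin_ext_bvec[OF D add.hyps(2)]
          comm[OF add.hyps(2)] H_bvec[OF add.hyps(2)])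
  qed
  show ?thesis
  proof (rule module_hom_presentedI[OF M(1) left_module_rep])
    show "H x \<in> carrier (rep_module B act)" for x using H_car by simp
    show "H (x \<oplus>\<^bsub>M\<^esub> y) = H x \<oplus>\<^bsub>rep_module B act\<^esub> H y" for x y by (simp add: M H_add)
    fix x assume x: "x \<in> carrier M"
    then have xD: "x \<in> car D" by (simp add: M)
    show "H (cls rels (scal c) \<odot>\<^bsub>M\<^esub> x) = cls rels (scal c) \<odot>\<^bsub>rep_module B act\<^esub> H x" for c
      unfolding M_scal[OF xD] rep_smult[OF H_car] free_act_scal by (rule H_scale)
    show "H (cls rels (gen g) \<odot>\<^bsub>M\<^esub> x) = cls rels (gen g) \<odot>\<^bsub>rep_module B act\<^esub> H x" for g
      unfolding M_gen[OF xD] rep_smult[OF H_car] free_act_gen by (rule H_gen[OF xD])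
  qed
qed

lemma lincomb_bvec:
  assumes "finite D"
  shows "(\<Sum>a\<in>D. vscale (bvec D b a) (w a)) = (if b \<in> D then w b else 0)"
proof -
  have "(\<Sum>a\<in>D. vscale (bvec D b a) (w a)) = (\<Sum>a\<in>D. if a = b then w b else 0)"
    by (intro sum.cong) (auto simp: bvec_def)
  then show ?thesis using assms by simp
qed

lemma lincomb_linear:
  "(\<Sum>a\<in>D. vscale (vadd y z a) (w a)) = (\<Sum>a\<in>D. vscale (y a) (w a)) + (\<Sum>a\<in>D. vscale (z a) (w a))"
  "(\<Sum>a\<in>D. vscale (vscale c y a) (w a)) = vscale c (\<Sum>a\<in>D. vscale (y a) (w a))"
  by (simp_all add: vadd_eq_plus sum.distrib fun_space.scale_left_distrib fun_space.scale_sum_right)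
    (simp add: vscale_def mult.assoc)

lemma left_module_L_eps: "left_module MU (L_eps s n \<epsilon>)" and left_module_L01: "left_module MU (L01 s n)"
  using L_eps_simple gen_rep.left_module_rep[OF L01_rep] by (auto simp: simple_module_def L01_def)

context MU_action
begin

lemma weight_F_power:
  assumes "primitive s n x"
  shows "k ((f ^^ i) x) = (sval s * vv powi (int n - 2 * int i)) *s (f ^^ i) x"
    and "k' ((f ^^ i) x) = inverse (sval s * vv powi (int n - 2 * int i)) *s (f ^^ i) x"
proof -
  note x = primitiveD[OF assms]
  have v: "vv powi (int n - 2 * int i) = vv powi (- 2 * int i) * vv ^ n"
    using vv_nz power_int_add[of vv "- 2 * int i" "int n"] by simp
  have v': "inverse (vv powi (- 2 * int i)) = vv powi (2 * int i)"
    by (simp flip: power_int_minus)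
  show "k ((f ^^ i) x) = (sval s * vv powi (int n - 2 * int i)) *s (f ^^ i) x"
    unfolding K_F_power[OF x(1)] x(3) v by (simp add: lin mult_ac)
  show "k' ((f ^^ i) x) = inverse (sval s * vv powi (int n - 2 * int i)) *s (f ^^ i) x"
    unfolding Kinv_F_power[OF x(1)] x(4) v inverse_mult_distrib v' by (simp add: lin mult_ac)
qed

lemma weight_l:
  assumes "y \<in> C" "k y = a *s y" "k' y = b *s y"
  shows "k (l y) = a *s l y" "k' (l y) = b *s l y" "k (P y) = a *s P y" "k' (P y) = b *s P y"
  using assms by (simp_all add: K_l Kinv_l P_def lin scale_right_diff_distrib)

text \<open>The defining formulas of \<open>L\<^sup>\<plusminus>(n,01)\<close> hold for \<open>m\<^sub>i\<^sub>,\<^sub>0 = P f\<^sup>i x\<close> and \<open>m\<^sub>i\<^sub>,\<^sub>1 = l f\<^sup>i x\<close>; in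
particular \<open>f\<^sup>i x = m\<^sub>i\<^sub>,\<^sub>0 + m\<^sub>i\<^sub>,\<^sub>1\<close>.  The last equation says that \<open>m\<^sub>n\<^sub>,\<^sub>0\<close> is out of range.\<close>

lemma P_F_l_action:
  assumes x: "null_primitive s n x" and T: "T x = (sval s * vv powi (1 - int n)) *s x"
  shows "f (P ((f ^^ i) x)) =
      P ((f ^^ Suc i) x) + (vv powi int i / qint (int i + 1)) *s l ((f ^^ Suc i) x)"
    and "e (P ((f ^^ Suc i) x)) =
      (sval s * vv * qint (int i + 1) * qint (int n - (int i + 1))) *s P ((f ^^ i) x)"
    and "e (l ((f ^^ Suc i) x)) =
      (sval s * qint (int i + 1) * qint (int n - int i)) *s l ((f ^^ i) x) +
      (sval s * vv powi (int i + 1 - int n) * qint (int i + 1)) *s P ((f ^^ i) x)"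
    and "P ((f ^^ n) x) = 0"
proof -
  note xD = null_primitiveD[OF x]
  have q: "qint (int i + 1) \<noteq> 0" by (rule qint_nz) simp
  have "vv powi int i / qint (int i + 1) = 1 - inverse vv * (qint (int i) / qint (int i + 1))"
  proof -
    have "vv powi int i = qint (int i + 1) - inverse vv * qint (int i)"
      using qint_Suc'[of "int i"] by simp
    then show ?thesis using q by (simp only: diff_divide_distrib times_divide_eq_right) simp
  qed
  then show "f (P ((f ^^ i) x)) =
      P ((f ^^ Suc i) x) + (vv powi int i / qint (int i + 1)) *s l ((f ^^ Suc i) x)"
    using F_l_power[OF xD(3,2), of i] by (simp add: P_def lin scale_left_diff_distrib)
  have v: "vv powi int i * vv powi (1 - int n) = vv powi (int i + 1 - int n)"
    using vv_nz power_int_add[of vv "int i" "1 - int n"] by (simp add: algebra_simps)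
  have PT: "P ((f ^^ j) (T x)) = (sval s * vv powi (1 - int n)) *s P ((f ^^ j) x)" for j
    unfolding T by (simp add: lin P.scale)
  show el: "e (l ((f ^^ Suc i) x)) =
      (sval s * qint (int i + 1) * qint (int n - int i)) *s l ((f ^^ i) x) +
      (sval s * vv powi (int i + 1 - int n) * qint (int i + 1)) *s P ((f ^^ i) x)"
    unfolding E_l_power[OF x] PT v[symmetric] by (simp add: mult_ac)
  have "qint (int n - int i) = vv * qint (int n - (int i + 1)) + vv powi (int i + 1 - int n)"
    using qint_Suc[of "int n - (int i + 1)"] by (simp add: algebra_simps)
  then have r: "sval s * qint (int i + 1) * qint (int n - int i) =
    sval s * vv * qint (int i + 1) * qint (int n - (int i + 1)) + sval s * vv powi (int i + 1 - int n) * qint (int i + 1)"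
    by (simp add: algebra_simps)
  have "e (P ((f ^^ Suc i) x)) = e ((f ^^ Suc i) x) - e (l ((f ^^ Suc i) x))"
    unfolding P_def[of "(f ^^ Suc i) x"] by (rule op.diff)
  also have "e ((f ^^ Suc i) x) = (sval s * qint (int i + 1) * qint (int n - int i)) *s (P ((f ^^ i) x) + l ((f ^^ i) x))"
    unfolding primitive_E_F[OF xD(1)] by (simp add: P_def)
  finally show "e (P ((f ^^ Suc i) x)) =
      (sval s * vv * qint (int i + 1) * qint (int n - (int i + 1))) *s P ((f ^^ i) x)"
    unfolding el unfolding r by (simp add: scale_right_distrib scale_left_distrib)
  have "(sval s * vv powi (1 - int n)) *s P ((f ^^ n) x) = 0"
    using P_F_power_T[OF x] by (simp only: PT)
  then show "P ((f ^^ n) x) = 0" using vv_nz by simp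
qed

end

lemma hom_from_L_eps:
  assumes rep: "gen_rep B act MU_rels"
    and x: "MU_action.primitive vscale (bvec B ` B) (\<lambda>g. lin_ext B (act g)) s n x" "x \<noteq> 0"
    and l: "\<And>i. lin_ext B (act Ell) ((lin_ext B (act (Sl2 F)) ^^ i) x) =
      vscale (of_bool \<epsilon>) ((lin_ext B (act (Sl2 F)) ^^ i) x)"
  shows "\<exists>h \<in> module_hom MU (L_eps s n \<epsilon>) (rep_module B act). \<exists>y\<in>carrier (L_eps s n \<epsilon>). h y \<noteq> 0"
proof -
  interpret gen_rep B act MU_rels by (rule rep)
  interpret MU_action vscale "bvec B ` B" ops by (rule MU_action_rep[OF rep])
  note sp = span_bvec[OF fin]
  define w where "w i = (f ^^ i) x" for i
  define H where "H = (\<lambda>y. \<Sum>b\<in>{..n}. vscale (y b) (w b))"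
  have xC: "x \<in> C" using primitiveD(1)[OF x(1)] .
  have Hb: "H (bvec {..n} i) = w i" if "i \<le> Suc n" for i
    unfolding H_def lincomb_bvec[OF finite_atMost] using that primitive_F_string(1)[OF x]
    by (cases "i = Suc n") (auto simp: w_def)
  have Hlin: "H (y + z) = H y + H z" "H (vscale c y) = vscale c (H y)" "H 0 = 0" for y z c
    unfolding H_def by (simp_all add: lincomb_linear flip: vadd_eq_plus)
  have comm: "H (L_eps_act s n \<epsilon> g i) = ops g (w i)" if "i \<le> n" for g i
  proof (cases g)
    case (Sl2 h)
    show ?thesis
    proof (cases h)
      case E
      show ?thesis
      proof (cases i)
        case 0
        then show ?thesis using primitiveD(2)[OF x(1)] by (simp add: Sl2 E Hlin w_def)
      next
        case (Suc j)
        have "ops g (w i) = vscale (sval s * qint (int j + 1) * qint (int n - int j)) (w j)"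
          unfolding Sl2 E w_def Suc by (rule primitive_E_F[OF x(1)])
        then show ?thesis using that by (simp add: Sl2 E Suc Hlin Hb add_ac)
      qed
    next
      case F
      then show ?thesis using that by (simp add: Sl2 Hb w_def)
    next
      case K
      then show ?thesis using that weight_F_power(1)[OF x(1)] by (simp add: Sl2 Hlin Hb w_def)
    next
      case Kinv
      then show ?thesis using that weight_F_power(2)[OF x(1)]
        by (simp add: Sl2 Hlin Hb w_def del: inverse_mult_distrib sval_inverse)
    qed
  next
    case Ell
    then show ?thesis using that l by (simp add: Hlin Hb w_def)
  qed
  have "H \<in> module_hom MU (L_eps s n \<epsilon>) (rep_module B act)"
  proof (rule hom_from_basis[OF finite_atMost left_module_L_eps _ _ L_eps_smult _ rep _ H_def])
    show "L_eps_act s n \<epsilon> g b \<in> car {..n}" for g b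
      by (cases "(s, n, \<epsilon>, g, b)" rule: L_eps_act.cases; cases "(s, n, case g of Sl2 h \<Rightarrow> h, b)" rule: L_act.cases)
        (auto simp: vscale_def bvec_def)
    show "w b \<in> car B" for b unfolding w_def sp[symmetric] by (rule fp_closed[OF xC])
  qed (simp_all add: comm)
  moreover have "H (bvec {..n} 0) \<noteq> 0" using Hb[of 0] x(2) by (simp add: w_def)
  moreover have "bvec {..n} 0 \<in> carrier (L_eps s n \<epsilon>)" by (simp add: bvec_def)
  ultimately show ?thesis by blast
qed

lemma hom_from_L01:
  assumes rep: "gen_rep B act MU_rels" and n: "n \<ge> 1"
    and x: "MU_action.null_primitive vscale (bvec B ` B) (\<lambda>g. lin_ext B (act g)) s n x" "x \<noteq> 0"
    and T: "MU_action.T (\<lambda>g. lin_ext B (act g)) x = vscale (sval s * vv powi (1 - int n)) x"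
  shows "\<exists>h \<in> module_hom MU (L01 s n) (rep_module B act). \<exists>y\<in>carrier (L01 s n). h y \<noteq> 0"
proof -
  interpret gen_rep B act MU_rels by (rule rep)
  interpret MU_action vscale "bvec B ` B" ops by (rule MU_action_rep[OF rep])
  note sp = span_bvec[OF fin]
  note xD = null_primitiveD[OF x(1)]
  define w where "w b = (case b of (i, \<epsilon>) \<Rightarrow> if \<epsilon> then l ((f ^^ i) x) else P ((f ^^ i) x))" for b
  have w: "w (i, True) = l ((f ^^ i) x)" "w (i, False) = P ((f ^^ i) x)" for i
    by (simp_all add: w_def)
  have B01: "finite (B01 n)" by (simp add: B01_def)
  define H where "H = (\<lambda>y. \<Sum>b\<in>B01 n. vscale (y b) (w b))"
  have out: "w (0, True) = 0" "w (n, False) = 0" "w (Suc n, True) = 0"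
    using xD(2) P_F_l_action(4)[OF x(1) T] primitive_F_string(1)[OF xD(1) x(2)]
    by (simp_all add: w lin del: funpow.simps)
  have HbT: "H (bvec (B01 n) (i, True)) = w (i, True)" if "i \<le> Suc n" for i
    unfolding H_def lincomb_bvec[OF B01] using that out
    by (cases "i = Suc n"; cases "i = 0") (auto simp: mem_B01)
  have HbF: "H (bvec (B01 n) (i, False)) = w (i, False)" if "i \<le> n" for i
    unfolding H_def lincomb_bvec[OF B01] using that out
    by (cases "i = n") (auto simp: mem_B01)
  have Hlin: "H (y + z) = H y + H z" "H (vscale c y) = vscale c (H y)" "H 0 = 0" for y z c
    unfolding H_def by (simp_all add: lincomb_linear flip: vadd_eq_plus)
  note act' = P_F_l_action(1-3)[OF x(1) T]
  have fC: "(f ^^ i) x \<in> C" for i using xD(3) by (rule fp_closed)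
  note wt = weight_l[OF fC weight_F_power[OF xD(1)]]
  have comm: "H (L01_act s n g b) = ops g (w b)" if b: "b \<in> B01 n" for g b
  proof (cases b)
    case (Pair i \<epsilon>)
    show ?thesis
    proof (cases \<epsilon>)
      case True
      then have e: "\<epsilon> = True" by simp
      from b have i: "0 < i" "i \<le> n" by (auto simp: Pair e mem_B01)
      then obtain j where j: "i = Suc j" by (cases i) auto
      show ?thesis
      proof (cases g)
        case (Sl2 h)
        show ?thesis
        proof (cases h)
          case E
          show ?thesis using i act'(3)[of j]
            by (simp add: Sl2 E Pair e j Hlin HbT HbF w vadd_eq_plus add_ac del: funpow.simps)
        next
          case F
          show ?thesis using i F_l_power[OF xD(3,2), of i]
            by (simp add: Sl2 F Pair e Hlin HbT w del: funpow.simps)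
        qed (use i wt[of i] in \<open>simp_all add: Sl2 Pair e Hlin HbT w del: inverse_mult_distrib sval_inverse\<close>)
      next
        case Ell
        show ?thesis using i by (simp add: Ell Pair e Hlin HbT w l_l[OF fC])
      qed
    next
      case False
      then have e: "\<epsilon> = False" by simp
      from b have i: "i < n" by (auto simp: Pair e mem_B01)
      show ?thesis
      proof (cases g)
        case (Sl2 h)
        show ?thesis
        proof (cases h)
          case E
          show ?thesis
          proof (cases i)
            case 0
            then show ?thesis using xD by (simp add: Sl2 E Pair e Hlin w P_def lin)
          next
            case (Suc j)
            then show ?thesis using i act'(2)[of j]
              by (simp add: Sl2 E Pair e Hlin HbF w add_ac del: funpow.simps)
          qed
        next
          case F
          show ?thesis using i act'(1)[of i]
            by (simp add: Sl2 F Pair e Hlin HbT HbF w vadd_eq_plus del: funpow.simps)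
        qed (use i wt[of i] in \<open>simp_all add: Sl2 Pair e Hlin HbF w del: inverse_mult_distrib sval_inverse\<close>)
      next
        case Ell
        show ?thesis using i by (simp add: Ell Pair e Hlin HbF w P_def lin l_l[OF fC])
      qed
    qed
  qed
  have "H \<in> module_hom MU (L01 s n) (rep_module B act)"
  proof (rule hom_from_basis[OF B01 left_module_L01 _ _ L01_smult _ rep _ H_def])
    show "L01_act s n g b \<in> car (B01 n)" if "b \<in> B01 n" for g b
      using gen_rep.act_car[OF L01_rep that] .
    show "w b \<in> car B" for b unfolding sp[symmetric]
      by (cases b; cases "snd b") (simp_all add: w op_closed PT_closed fC)
  qed (simp_all add: comm)
  moreover have "H (bvec (B01 n) (0, False)) \<noteq> 0" using HbF[of 0] x(2) xD(7) by (simp add: w)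
  moreover have "bvec (B01 n) (0, False) \<in> carrier (L01 s n)" by (simp add: bvec_def)
  ultimately show ?thesis by blast
qed

section \<open>Isomorphism classes\<close>

text \<open>The isomorphism invariant that separates the modules \<open>L\<^sup>\<plusminus>(n,0)\<close>, \<open>L\<^sup>\<plusminus>(n,1)\<close> from each other, and the
modules \<open>L\<^sup>\<plusminus>(n,01)\<close> from each other.\<close>

definition has_highest_weight :: "(mu_gen free_alg set, 'b, 'm) module_scheme \<Rightarrow> bool \<Rightarrow> sign \<Rightarrow> nat \<Rightarrow> bool" where
  "has_highest_weight M \<epsilon> s n \<longleftrightarrow> (\<exists>x\<in>carrier M. x \<noteq> \<zero>\<^bsub>M\<^esub> \<and>
     cls MU_rels (gen (Sl2 E)) \<odot>\<^bsub>M\<^esub> x = \<zero>\<^bsub>M\<^esub> \<and>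
     cls MU_rels (gen (Sl2 K)) \<odot>\<^bsub>M\<^esub> x = cls MU_rels (scal (sval s * vv ^ n)) \<odot>\<^bsub>M\<^esub> x \<and>
     cls MU_rels (gen Ell) \<odot>\<^bsub>M\<^esub> x = cls MU_rels (scal (of_bool \<epsilon>)) \<odot>\<^bsub>M\<^esub> x)"

lemma has_highest_weight_iso:
  assumes "left_module MU M" "left_module MU N" "module_iso MU M N" "has_highest_weight M \<epsilon> s n"
  shows "has_highest_weight N \<epsilon> s n"
proof -
  interpret M: left_module MU M by fact
  obtain h where h: "h \<in> module_hom MU M N" "bij_betw h (carrier M) (carrier N)"
    using assms(3) by (auto simp: module_iso_def)
  obtain x where x: "x \<in> carrier M" "x \<noteq> \<zero>\<^bsub>M\<^esub>" "cls MU_rels (gen (Sl2 E)) \<odot>\<^bsub>M\<^esub> x = \<zero>\<^bsub>M\<^esub>"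
    "cls MU_rels (gen (Sl2 K)) \<odot>\<^bsub>M\<^esub> x = cls MU_rels (scal (sval s * vv ^ n)) \<odot>\<^bsub>M\<^esub> x"
    "cls MU_rels (gen Ell) \<odot>\<^bsub>M\<^esub> x = cls MU_rels (scal (of_bool \<epsilon>)) \<odot>\<^bsub>M\<^esub> x"
    using assms(4) by (auto simp: has_highest_weight_def)
  have h0: "h \<zero>\<^bsub>M\<^esub> = \<zero>\<^bsub>N\<^esub>" by (rule module_hom_zero[OF assms(1,2) h(1)])
  have sm: "cls MU_rels p \<odot>\<^bsub>N\<^esub> h x = h (cls MU_rels p \<odot>\<^bsub>M\<^esub> x)" for p
    by (rule module_hom_smult[OF h(1) _ x(1), symmetric]) (simp add: presented_simps(1))
  have "h x \<noteq> h \<zero>\<^bsub>M\<^esub>" using h(2) x(1,2) M.M.zero_closed by (auto simp: bij_betw_def dest: inj_onD)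
  then show ?thesis unfolding has_highest_weight_def sm
    using bij_betwE[OF h(2)] x by (intro bexI[of _ "h x"]) (simp_all add: h0 sm)
qed

lemma highest_weight_inj:
  assumes "sval s * vv ^ n = sval s' * vv ^ n'"
  shows "s = s' \<and> n = n'"
proof -
  have "(sval t)\<^sup>2 = 1" for t by (cases t) auto
  then have sq: "(sval t * vv ^ m) ^ 2 = vv ^ (2 * m)" for t m
    by (simp add: power_mult_distrib mult.commute flip: power_mult)
  have "vv ^ (2 * n) = vv ^ (2 * n')" using arg_cong[OF assms, of "\<lambda>z. z ^ 2"] unfolding sq .
  then have "vv powi (2 * int n - 2 * int n') = 1" using vv_nz by (simp add: power_int_diff) (metis of_nat_mult of_nat_numeral power_int_of_nat)
  then have n: "n = n'" using vv_powi_eq_1 by fastforce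
  then have "sval s = sval s'" using assms vv_nz by simp
  moreover have "(1 :: ratfun) \<noteq> - 1"
    by (simp add: One_fract_def eq_fract one_pCons)
  ultimately have "s = s'" by (cases s; cases s') auto
  with n show ?thesis by simp
qed

text \<open>A vector killed by \<open>e\<close> is a multiple of the first basis vector.\<close>

lemma highest_weight_L_eps:
  "has_highest_weight (L_eps s n \<epsilon>) \<epsilon>' s' n' \<longleftrightarrow> \<epsilon>' = \<epsilon> \<and> s' = s \<and> n' = n"
proof
  let ?ops = "\<lambda>g. lin_ext {..n} (L_eps_act s n \<epsilon> g)"
  have opsU: "?ops (Sl2 g) = lin_ext {..n} (L_act s n g)" for g
    by (simp add: lin_ext_def fun_eq_iff)
  have opsl: "?ops Ell x = vscale (of_bool \<epsilon>) x" if "x \<in> car {..n}" for x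
  proof -
    have "L_eps_act s n \<epsilon> Ell = (\<lambda>i. vscale (of_bool \<epsilon>) (bvec {..n} i))" by (rule ext) simp
    then show ?thesis by (simp only: lin_ext_scalar[OF finite_atMost that])
  qed
  {
    assume "has_highest_weight (L_eps s n \<epsilon>) \<epsilon>' s' n'"
    then obtain x where x: "x \<in> car {..n}" "x \<noteq> (\<lambda>_. 0)" "?ops (Sl2 E) x = (\<lambda>_. 0)"
      "?ops (Sl2 K) x = vscale (sval s' * vv ^ n') x" "?ops Ell x = vscale (of_bool \<epsilon>') x"
      by (auto simp: has_highest_weight_def L_eps_smult)
    have xS: "x (Suc j) = 0" for j
    proof (cases "j < n")
      case True
      then have "int n - int j \<noteq> 0" by simp
      then show ?thesis using fun_cong[OF x(3), of j] True qint_nz[of "int j + 1"] qint_nz[of "int n - int j"]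
        by (simp add: opsU L_ops)
    qed (use x(1) in simp)
    have "x 0 \<noteq> 0"
    proof
      assume "x 0 = 0"
      then have "x j = 0" for j using xS by (cases j) auto
      then show False using x(2) by (simp add: fun_eq_iff)
    qed
    moreover from this have "\<epsilon>' = \<epsilon>"
      using fun_cong[OF x(5), of 0] unfolding opsl[OF x(1)]
      by (cases \<epsilon>; cases \<epsilon>') (simp_all add: vscale_def)
    moreover have "sval s * vv ^ n * x 0 = sval s' * vv ^ n' * x 0"
      using fun_cong[OF x(4), of 0] by (simp add: opsU L_ops vscale_def)
    ultimately show "\<epsilon>' = \<epsilon> \<and> s' = s \<and> n' = n" using highest_weight_inj[of s n s' n'] by simp
  }
  assume eq: "\<epsilon>' = \<epsilon> \<and> s' = s \<and> n' = n"
  let ?x = "bvec {..n} 0"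
  have "?ops (Sl2 E) ?x = (\<lambda>_. 0)" "?ops (Sl2 K) ?x = vscale (sval s * vv ^ n) ?x"
    by (auto simp: opsU L_ops vscale_def bvec_def fun_eq_iff)
  moreover have "?x \<noteq> (\<lambda>_. 0)" by (auto simp: bvec_def fun_eq_iff)
  ultimately show "has_highest_weight (L_eps s n \<epsilon>) \<epsilon>' s' n'"
    unfolding has_highest_weight_def using eq opsl[OF car_closed(4)]
    by (intro bexI[of _ ?x]) (simp_all add: L_eps_smult[OF car_closed(4)] del: mem_Collect_eq, simp add: bvec_def)
qed

text \<open>As a module over \<open>U\<^sub>v(sl\<^sub>2)\<close>, \<open>L\<^sup>\<plusminus>(n,01)\<close> has a second highest weight if \<open>n \<ge> 2\<close>.  Its vectors are not
eigenvectors of \<open>l\<close>, which is why the invariant includes \<open>l\<close>.\<close>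

lemma highest_weight_L01:
  assumes n: "n \<ge> 1"
  shows "has_highest_weight (L01 s n) \<epsilon> s' n' \<longleftrightarrow> \<not> \<epsilon> \<and> s' = s \<and> n' = n"
proof
  let ?ops = "\<lambda>g. lin_ext (B01 n) (L01_act s n g)"
  {
    assume "has_highest_weight (L01 s n) \<epsilon> s' n'"
    then obtain x where x: "x \<in> car (B01 n)" "x \<noteq> (\<lambda>_. 0)" "?ops (Sl2 E) x = (\<lambda>_. 0)"
      "?ops (Sl2 K) x = vscale (sval s' * vv ^ n') x" "?ops Ell x = vscale (of_bool \<epsilon>) x"
      by (auto simp: has_highest_weight_def L01_smult)
    have x0: "x b = 0" if "b \<notin> B01 n" for b using x(1) that by blast
    have l: "x (j, \<not> \<epsilon>) = 0" for j
      using fun_cong[OF x(5), of "(j, \<not> \<epsilon>)"] x0[of "(j, \<not> \<epsilon>)"]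
      by (cases \<epsilon>) (auto simp: L01_ops vscale_def split: if_splits)
    have E: "?ops (Sl2 E) x b = 0" for b using fun_cong[OF x(3)] by simp
    have T: "x (j, True) = 0" for j
    proof (cases "(j, True) \<in> B01 n \<and> \<epsilon>")
      case True
      then obtain i where i: "j = Suc i" "i < n" by (cases j) (auto simp: mem_B01)
      have "x (Suc i, False) = 0" using l[of "Suc i"] True by simp
      then show ?thesis using E[of "(i, False)"] i qint_nz[of "int i + 1"] vv_nz by (simp add: L01_ops)
    next
      case False
      then show ?thesis using x0[of "(j, True)"] l[of j] by (cases \<epsilon>) auto
    qed
    have F: "x (Suc i, False) = 0" for i
    proof (cases "Suc i < n")
      case True
      then have "int n - int i - 1 \<noteq> 0" by simp
      then show ?thesis
        using E[of "(i, False)"] True T qint_nz[of "int i + 1"] qint_nz[of "int n - int i - 1"] vv_nz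
        by (simp add: L01_ops)
    qed (use x0 in \<open>simp add: mem_B01\<close>)
    have x00: "x (0, False) \<noteq> 0"
    proof
      assume "x (0, False) = 0"
      then have "x (j, \<delta>) = 0" for j \<delta> using T F by (cases \<delta>; cases j) auto
      then show False using x(2) by (auto simp: fun_eq_iff)
    qed
    then have "\<not> \<epsilon>" using l[of 0] by auto
    moreover have "sval s * vv ^ n * x (0, False) = sval s' * vv ^ n' * x (0, False)"
      using fun_cong[OF x(4), of "(0, False)"] n by (simp add: L01_ops mem_B01 vscale_def)
    ultimately show "\<not> \<epsilon> \<and> s' = s \<and> n' = n" using x00 highest_weight_inj[of s n s' n'] by simp
  }
  assume eq: "\<not> \<epsilon> \<and> s' = s \<and> n' = n"
  let ?x = "bvec (B01 n) (0, False)"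
  have "?ops (Sl2 E) ?x b = 0" "?ops (Sl2 K) ?x b = vscale (sval s * vv ^ n) ?x b" "?ops Ell ?x b = 0" for b
    by (cases b; cases "snd b"; auto simp: L01_ops vscale_def bvec_def mem_B01)+
  then have "?ops (Sl2 E) ?x = (\<lambda>_. 0)" "?ops (Sl2 K) ?x = vscale (sval s * vv ^ n) ?x" "?ops Ell ?x = (\<lambda>_. 0)"
    by blast+
  moreover have "?x \<noteq> (\<lambda>_. 0)" using n by (auto simp: bvec_def fun_eq_iff mem_B01)
  ultimately show "has_highest_weight (L01 s n) \<epsilon> s' n'"
    unfolding has_highest_weight_def using eq
    by (intro bexI[of _ ?x]) (simp_all add: L01_smult[OF car_closed(4)] zero_fun del: mem_Collect_eq, simp add: bvec_def)
qed

text \<open>The highest weights leave only \<open>\<epsilon> = 0\<close>; but then \<open>l\<close> acts as zero on one side and not on the other.\<close>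

lemma L_eps_not_iso_L01:
  assumes "n' \<ge> 1"
  shows "\<not> module_iso MU (L_eps s n \<epsilon>) (L01 s' n')"
proof
  assume iso: "module_iso MU (L_eps s n \<epsilon>) (L01 s' n')"
  have "has_highest_weight (L01 s' n') \<epsilon> s n"
    using has_highest_weight_iso[OF left_module_L_eps left_module_L01 iso, of \<epsilon> s n]
    by (simp add: highest_weight_L_eps)
  then have \<epsilon>: "\<not> \<epsilon>" using highest_weight_L01[OF assms] by blast
  obtain h where h: "h \<in> module_hom MU (L_eps s n \<epsilon>) (L01 s' n')"
    "bij_betw h (carrier (L_eps s n \<epsilon>)) (carrier (L01 s' n'))"
    using iso by (auto simp: module_iso_def)
  let ?b = "bvec (B01 n') (1, True)"
  have b: "?b \<in> car (B01 n')" by (rule car_closed)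
  then have "?b \<in> h ` car {..n}" using h(2) by (simp only: bij_betw_def L_eps_simps L01_simps)
  then obtain y where y: "y \<in> car {..n}" "h y = ?b" by (elim imageE) simp
  have l0: "cls MU_rels (gen Ell) \<odot>\<^bsub>L_eps s n \<epsilon>\<^esub> y = (\<lambda>_. 0)"
    unfolding L_eps_smult(2)[OF y(1)] using \<epsilon> by (simp add: lin_ext_def vscale_def)
  have "cls MU_rels (gen Ell) \<odot>\<^bsub>L01 s' n'\<^esub> ?b = h (cls MU_rels (gen Ell) \<odot>\<^bsub>L_eps s n \<epsilon>\<^esub> y)"
    unfolding y(2)[symmetric] using y(1)
    by (intro module_hom_smult[OF h(1), symmetric]) (simp_all add: presented_simps(1))
  also have "\<dots> = (\<lambda>_. 0)"
    unfolding l0 using module_hom_zero[OF left_module_L_eps left_module_L01 h(1)] by simp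
  finally have "lin_ext (B01 n') (L01_act s' n' Ell) ?b (1, True) = 0"
    unfolding L01_smult(2)[OF b] by simp
  then show False using assms by (simp add: L01_ops bvec_def mem_B01)
qed

text \<open>Used with a module \<open>M\<close> of coordinates of \<open>V\<close> and a model \<open>W\<close>: Schur's lemma is applied to the composite
\<open>W \<rightarrow> M \<rightarrow> V\<close>, both ends of which are simple.\<close>

lemma iso_of_hom_from_simple:
  assumes V: "simple_module R V" and W: "simple_module R W"
    and g: "g \<in> module_hom R M V" "inj_on g (carrier M)" "left_module R M"
    and h: "h \<in> module_hom R W M" "y \<in> carrier W" "h y \<noteq> \<zero>\<^bsub>M\<^esub>"
  shows "module_iso R V W"
proof -
  have lm: "left_module R V" "left_module R W" using V W by (auto simp: simple_module_def)
  interpret M: left_module R M by fact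
  have gh: "(\<lambda>x. g (h x)) \<in> module_hom R W V"
    using g(1) h(1) by (auto simp: module_hom_def Pi_iff)
  have "h y \<in> carrier M" using module_hom_closed[OF h(1)] h(2) by auto
  then have "g (h y) \<noteq> g \<zero>\<^bsub>M\<^esub>" using inj_onD[OF g(2)] h(3) M.M.zero_closed by blast
  then have "g (h y) \<noteq> \<zero>\<^bsub>V\<^esub>" using module_hom_zero[OF g(3) lm(1) g(1)] by simp
  then have "bij_betw (\<lambda>x. g (h x)) (carrier W) (carrier V)"
    using simple_module_hom_bij[OF W V gh h(2)] by simp
  then have "module_iso R W V" using gh by (auto simp: module_iso_def)
  then show ?thesis by (rule module_iso_sym[OF _ lm(2)])
qed

text \<open>A stable subspace of coordinate functions corresponds to a submodule of \<open>V\<close>.\<close>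

lemma irreducible_rep:
  assumes rep: "gen_rep B act MU_rels" and V: "simple_module MU V"
    and h: "h \<in> module_hom MU (rep_module B act) V" "bij_betw h (car B) (carrier V)"
  shows "irreducible_MU_action vscale (bvec B ` B) (\<lambda>g. lin_ext B (act g))"
proof -
  interpret gen_rep B act MU_rels by (rule rep)
  interpret MU_action vscale "bvec B ` B" ops by (rule MU_action_rep[OF rep])
  interpret V: left_module MU V using V by (simp add: simple_module_def)
  note sp = span_bvec[OF fin]
  have h0: "h (\<lambda>_. 0) = \<zero>\<^bsub>V\<^esub>"
    using module_hom_zero[OF left_module_rep V.left_module_axioms h(1)] by simp
  have hadd: "h (vadd x y) = h x \<oplus>\<^bsub>V\<^esub> h y" if "x \<in> car B" "y \<in> car B" for x y
    using module_hom_add[OF h(1), of x y] that by simp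
  have hact: "h (free_act ops p x) = cls MU_rels p \<odot>\<^bsub>V\<^esub> h x" if "x \<in> car B" for p x
    using module_hom_smult[OF h(1), of "cls MU_rels p" x] that
    by (simp add: presented_simps(1) rep_smult[OF that])
  show ?thesis
  proof unfold_locales
    show "fun_space.span (bvec B ` B) \<noteq> {0}"
    proof
      assume "fun_space.span (bvec B ` B) = {0}"
      then have "carrier V = {\<zero>\<^bsub>V\<^esub>}" using h(2) h0 unfolding sp by (auto simp: bij_betw_def zero_fun)
      then show False using V by (simp add: simple_module_def)
    qed
    fix N assume N: "fun_space.subspace N" "N \<subseteq> fun_space.span (bvec B ` B)"
      and ops: "\<And>g x. x \<in> N \<Longrightarrow> ops g x \<in> N"
    have NB: "N \<subseteq> car B" using N(2) unfolding sp .
    have N0: "(\<lambda>_. 0) \<in> N" unfolding zero_fun by (rule fun_space.subspace_0[OF N(1)])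
    have Nadd: "vadd x y \<in> N" if "x \<in> N" "y \<in> N" for x y
      unfolding vadd_eq_plus using that by (rule fun_space.subspace_add[OF N(1)])
    have Nact: "free_act ops p x \<in> N" if "x \<in> N" for p x
      by (rule free_act_stable[OF N0 Nadd fun_space.subspace_scale[OF N(1)] ops that])
    have "Module.submodule (h ` N) MU V"
    proof (rule V.submoduleI)
      show "h ` N \<subseteq> carrier V" using bij_betwE[OF h(2)] NB by (intro image_subsetI) (simp only: subsetD)
      show "\<zero>\<^bsub>V\<^esub> \<in> h ` N" using N0 h0 by (metis imageI)
      show "y \<oplus>\<^bsub>V\<^esub> z \<in> h ` N" if yz: "y \<in> h ` N" "z \<in> h ` N" for y z
      proof -
        obtain a b where ab: "a \<in> N" "b \<in> N" "y = h a" "z = h b" using yz by blast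
        then have "y \<oplus>\<^bsub>V\<^esub> z = h (vadd a b)" by (simp only: hadd[OF subsetD[OF NB ab(1)] subsetD[OF NB ab(2)]])
        then show ?thesis using Nadd[OF ab(1,2)] by blast
      qed
      show "a \<odot>\<^bsub>V\<^esub> y \<in> h ` N" if ay: "a \<in> carrier MU" "y \<in> h ` N" for a y
      proof -
        obtain p where p: "a = cls MU_rels p" using ay(1) by (auto simp: presented_simps(1))
        obtain x where x: "x \<in> N" "y = h x" using ay(2) by blast
        have "a \<odot>\<^bsub>V\<^esub> y = h (free_act ops p x)" unfolding p x(2) by (rule hact[OF subsetD[OF NB x(1)], symmetric])
        then show ?thesis using Nact[OF x(1)] by blast
      qed
    qed
    then consider "h ` N = {\<zero>\<^bsub>V\<^esub>}" | "h ` N = carrier V" using V unfolding simple_module_def by blast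
    then show "N = {0} \<or> N = fun_space.span (bvec B ` B)"
    proof cases
      case 1
      have "x = 0" if "x \<in> N" for x
      proof -
        have "h x = h (\<lambda>_. 0)" using 1 that h0 by auto
        then have "x = (\<lambda>_. 0)"
          by (rule inj_onD[OF bij_betw_imp_inj_on[OF h(2)] _ subsetD[OF NB that] car_closed(1)])
        then show ?thesis by (simp add: zero_fun)
      qed
      then show ?thesis using N0 by (auto simp: zero_fun)
    next
      case 2
      then have "N = car B" using inj_on_image_eq_iff[of h "car B" N "car B"] h(2) NB
        by (simp add: bij_betw_def)
      then show ?thesis unfolding sp by blast
    qed
  qed
qed

theorem simple_module_classification:
  fixes V :: "(mu_gen free_alg set, 'v, 'm) module_scheme"
  assumes "fd_simple MU_rels V"
  shows "(\<exists>s n \<epsilon>. module_iso MU V (L_eps s n \<epsilon>)) \<or> (\<exists>s n. n \<ge> 1 \<and> module_iso MU V (L01 s n))"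
proof -
  have V: "simple_module MU V" "vectorspace.fin_dim ground (underlying_vs MU_rels V)"
    using assms by (auto simp: fd_simple_def)
  interpret V: presented_module MU_rels V
    using V(1) by (simp add: simple_module_def presented_module_def)
  obtain B :: "'v set" and act h where rep: "gen_rep B act MU_rels"
    and h: "h \<in> module_hom MU (rep_module B act) V" "bij_betw h (car B) (carrier V)"
    using V.fin_dim_iso_rep[OF V(2)] by (elim exE conjE)
  interpret gen_rep B act MU_rels by (rule rep)
  interpret irreducible_MU_action vscale "bvec B ` B" ops by (rule irreducible_rep[OF rep V(1) h])
  have inj: "inj_on h (carrier (rep_module B act))" using h(2) by (simp add: bij_betw_def)
  note iso = iso_of_hom_from_simple[OF V(1) _ h(1) inj left_module_rep]
  from generating_vector show ?thesis
  proof (elim disjE exE conjE)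
    fix s n \<epsilon> x
    assume x: "x \<noteq> 0" "primitive s n x" and l: "\<forall>i. l ((f ^^ i) x) = vscale (of_bool \<epsilon>) ((f ^^ i) x)"
    obtain g y where g: "g \<in> module_hom MU (L_eps s n \<epsilon>) (rep_module B act)"
      "y \<in> carrier (L_eps s n \<epsilon>)" "g y \<noteq> 0"
      using hom_from_L_eps[OF rep x(2,1), of \<epsilon>] l by blast
    have "module_iso MU V (L_eps s n \<epsilon>)"
      by (rule iso[OF L_eps_simple g(1,2)]) (use g(3) in \<open>simp add: zero_fun\<close>)
    then show ?thesis by blast
  next
    fix s n x
    assume x: "1 \<le> n" "x \<noteq> 0" "null_primitive s n x" "T x = vscale (sval s * vv powi (1 - int n)) x"
    obtain g y where g: "g \<in> module_hom MU (L01 s n) (rep_module B act)"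
      "y \<in> carrier (L01 s n)" "g y \<noteq> 0"
      using hom_from_L01[OF rep x(1,3,2,4)] by blast
    have "module_iso MU V (L01 s n)"
      by (rule iso[OF L01_simple[OF x(1)] g(1,2)]) (use g(3) in \<open>simp add: zero_fun\<close>)
    then show ?thesis using x(1) by blast
  qed
qed

theorem theorem5p8:
  fixes V :: "(mu_gen free_alg set, 'v) module"
  shows "(\<forall>s n \<epsilon>. fd_simple MU_rels (L_eps s n \<epsilon>)) \<and>
    (\<forall>s n. n \<ge> 1 \<longrightarrow> fd_simple MU_rels (L01 s n)) \<and>
    (\<forall>s n \<epsilon> s' n' \<epsilon>'. module_iso MU (L_eps s n \<epsilon>) (L_eps s' n' \<epsilon>') \<longrightarrow>
       s = s' \<and> n = n' \<and> \<epsilon> = \<epsilon>') \<and>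
    (\<forall>s n s' n'. n \<ge> 1 \<and> n' \<ge> 1 \<and> module_iso MU (L01 s n) (L01 s' n') \<longrightarrow>
       s = s' \<and> n = n') \<and>
    (\<forall>s n \<epsilon> s' n'. n' \<ge> 1 \<longrightarrow> \<not> module_iso MU (L_eps s n \<epsilon>) (L01 s' n')) \<and>
    (fd_simple MU_rels V \<longrightarrow>
       (\<exists>s n \<epsilon>. module_iso MU V (L_eps s n \<epsilon>)) \<or>
       (\<exists>s n. n \<ge> 1 \<and> module_iso MU V (L01 s n)))"
proof (intro conjI allI impI)
  show "fd_simple MU_rels (L_eps s n \<epsilon>)" for s n \<epsilon> by (rule L_eps_fd_simple)
  show "fd_simple MU_rels (L01 s n)" if "1 \<le> n" for s n using that by (rule L01_fd_simple)
next
  fix s n \<epsilon> s' n' \<epsilon>'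
  assume "module_iso MU (L_eps s n \<epsilon>) (L_eps s' n' \<epsilon>')"
  then have "has_highest_weight (L_eps s' n' \<epsilon>') \<epsilon> s n"
    using has_highest_weight_iso[OF left_module_L_eps left_module_L_eps, of s n \<epsilon> s' n' \<epsilon>' \<epsilon> s n]
    by (simp add: highest_weight_L_eps)
  then show "s = s'" "n = n'" "\<epsilon> = \<epsilon>'" by (simp_all add: highest_weight_L_eps)
next
  fix s n s' n' assume *: "1 \<le> n \<and> 1 \<le> n' \<and> module_iso MU (L01 s n) (L01 s' n')"
  then have "has_highest_weight (L01 s' n') False s n"
    using has_highest_weight_iso[OF left_module_L01 left_module_L01, of s n s' n' False s n]
    by (simp add: highest_weight_L01)
  then show "s = s'" "n = n'" using * by (simp_all add: highest_weight_L01)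
next
  show "\<not> module_iso MU (L_eps s n \<epsilon>) (L01 s' n')" if "1 \<le> n'" for s n \<epsilon> s' n'
    using that by (rule L_eps_not_iso_L01)
  show "(\<exists>s n \<epsilon>. module_iso MU V (L_eps s n \<epsilon>)) \<or> (\<exists>s n. n \<ge> 1 \<and> module_iso MU V (L01 s n))"
    if "fd_simple MU_rels V"
    using that by (rule simple_module_classification)
qed

end
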